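(* Let $\beta>0$. There is a constant $\lambda\ge1$ depending only on $\beta$ such that the following holds. Fix $r\in(0,1)$ and, for $N\ge2$, let $\mathcal{F}_N$ be the set of all functions $f$ of class $C^2$ on $\mathbb{R}^2$, supported in $\mathsf{D}(0,r)$, for which there exist a point $z$ and a length $\ell\ge\lambda N^{-1/2}$ such that $f$ is supported in $\mathsf{D}(z,\ell)$ and $|f|_2\le\ell^{-2}$. Then for every $k\in\mathbb{N}$ there is a constant $C_k=C_k(\beta)$ such that, for all $N$ sufficiently large (depending on $\beta$, $k$ and $r$), $$\mathbb{P}^\beta_N\left[\sup_{f\in\mathcal{F}_N}\left|\mathbf{L}_N(f)\right|\ \ge\ C_k\log N\right]\ \le\ N^{-k}.$$
   Context: $\mathsf{D}(z,r)$ denotes the closed disk of center $z$ and radius $r$ in $\mathbb{R}^2$, and $\mathsf{D}=\mathsf{D}(0,1)$. $|f|_2$ denotes the $L^\infty$-norm of the second derivatives of $f$. For $N\ge 2$ and $X_N=(x_1,\dots,x_N)\in(\mathbb{R}^2)^N$, let $$\mathsf{H}_N(X_N)=\frac12\sum_{1\le i\ne j\le N}-\log|x_i-x_j|+N\sum_{i=1}^N\frac{|x_i|^2}{2}.$$ $\mathbb{P}^\beta_N$ is the probability measure on $(\mathbb{R}^2)^N$ with density proportional to $\exp(-\beta\,\mathsf{H}_N(X_N))$. Let $\mathbf{m}_0$ be the uniform probability measure on $\mathsf{D}$; the fluctuation of the linear statistic of $\varphi$ is $\mathbf{L}_N(\varphi)=\sum_{i=1}^N\varphi(x_i)-N\int_{\mathsf{D}}\varphi\,d\mathbf{m}_0$.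 *)

theory Defs
  imports "HOL-Probability.Probability"
begin

section \<open>Second derivatives and supports\<close>

definition partial_deriv :: "2 \<Rightarrow> (real^2 \<Rightarrow> real) \<Rightarrow> real^2 \<Rightarrow> real" where
  "partial_deriv i f x = frechet_derivative f (at x) (axis i 1)"

definition class_C2 :: "(real^2 \<Rightarrow> real) \<Rightarrow> bool" where
  "class_C2 f \<longleftrightarrow>
     (\<forall>x. f differentiable (at x)) \<and>
     (\<forall>i x. partial_deriv i f differentiable (at x)) \<and>
     (\<forall>i j. continuous_on UNIV (partial_deriv j (partial_deriv i f)))"

text \<open>The second derivatives of a \<open>C\<^sup>2\<close> function are continuous, so their
  \<open>L\<^sup>\<infinity>\<close>-norm is a supremum. It is taken in the extended reals and hence is
  \<open>\<infinity>\<close> (not a junk value) if the second derivatives are unbounded.\<close>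

definition deriv2_norm :: "(real^2 \<Rightarrow> real) \<Rightarrow> ereal" where
  "deriv2_norm f = (SUP i. SUP j. SUP x. ereal \<bar>partial_deriv j (partial_deriv i f) x\<bar>)"

definition supported_in :: "(real^2 \<Rightarrow> real) \<Rightarrow> (real^2) set \<Rightarrow> bool" where
  "supported_in f S \<longleftrightarrow> closure {x. f x \<noteq> 0} \<subseteq> S"


section \<open>The two-dimensional Coulomb gas\<close>

text \<open>A configuration is a function on the index set \<open>{..<N}\<close> (an element of the product
  space below), so that the indices run from \<open>0\<close> to \<open>N - 1\<close>.

  Since \<open>ln 0 = 0\<close>, the energy has a finite value where two points coincide, instead of
  \<open>\<infinity>\<close>. For the Gibbs measure this is immaterial: such configurations form a
  Lebesgue null set.\<close>

definition energy :: "nat \<Rightarrow> (nat \<Rightarrow> real^2) \<Rightarrow> real" where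
  "energy N X =
     1/2 * (\<Sum>i<N. \<Sum>j\<in>{..<N} - {i}. - ln (norm (X i - X j)))
     + real N * (\<Sum>i<N. (norm (X i))\<^sup>2 / 2)"

definition config_measure :: "nat \<Rightarrow> (nat \<Rightarrow> real^2) measure" where
  "config_measure N = (\<Pi>\<^sub>M i\<in>{..<N}. lborel)"

definition partition_fun :: "real \<Rightarrow> nat \<Rightarrow> ennreal" where
  "partition_fun \<beta> N = (\<integral>\<^sup>+ X. ennreal (exp (- \<beta> * energy N X)) \<partial>config_measure N)"

definition gibbs :: "real \<Rightarrow> nat \<Rightarrow> (nat \<Rightarrow> real^2) measure" where
  "gibbs \<beta> N = density (config_measure N)
     (\<lambda>X. ennreal (exp (- \<beta> * energy N X)) / partition_fun \<beta> N)"

definition m0 :: "(real^2) measure" where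
  "m0 = uniform_measure lborel (cball 0 1)"

definition fluct :: "nat \<Rightarrow> (real^2 \<Rightarrow> real) \<Rightarrow> (nat \<Rightarrow> real^2) \<Rightarrow> real" where
  "fluct N \<phi> X = (\<Sum>i<N. \<phi> (X i)) - real N * (LINT x:cball 0 1|m0. \<phi> x)"

definition test_functions :: "real \<Rightarrow> real \<Rightarrow> nat \<Rightarrow> (real^2 \<Rightarrow> real) set" where
  "test_functions lam r N =
     {f. class_C2 f \<and> supported_in f (cball 0 r) \<and>
         (\<exists>z l. l \<ge> lam * real N powr (-1/2) \<and> supported_in f (cball z l) \<and>
                deriv2_norm f \<le> ereal (1 / l\<^sup>2))}"

definition sup_fluct :: "(real^2 \<Rightarrow> real) set \<Rightarrow> nat \<Rightarrow> (nat \<Rightarrow> real^2) \<Rightarrow> ereal" where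
  "sup_fluct F N X = (SUP f\<in>F. ereal \<bar>fluct N f X\<bar>)"


section \<open>Well-definedness\<close>

lemma sets_config_measure: "sets (config_measure N) = sets (\<Pi>\<^sub>M i\<in>{..<N}. borel)"
  unfolding config_measure_def by (intro sets_PiM_cong) auto

lemma measurable_component_config [measurable]:
  "i < N \<Longrightarrow> (\<lambda>X. X i) \<in> borel_measurable (config_measure N)"
  unfolding config_measure_def by measurable

lemma measurable_energy [measurable]: "energy N \<in> borel_measurable (config_measure N)"
  unfolding energy_def[abs_def]
  by (intro borel_measurable_add borel_measurable_times borel_measurable_sum
        borel_measurable_const borel_measurable_uminus borel_measurable_ln borel_measurable_norm
        borel_measurable_diff borel_measurable_divide borel_measurable_power
        measurable_component_config) auto

lemma nn_integral_gaussian_finite: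
  fixes c :: real
  assumes c: "c > 0"
  shows "(\<integral>\<^sup>+ x. ennreal (exp (- (c * (x::real)\<^sup>2))) \<partial>lborel) < \<infinity>"
proof -
  define s where "s = sqrt (1 / (2 * c))"
  have s: "s > 0" using c by (simp add: s_def)
  have s2: "s\<^sup>2 = 1 / (2 * c)" using c by (simp add: s_def)
  have eq: "exp (- (c * x\<^sup>2)) = sqrt (2 * pi * s\<^sup>2) * normal_density 0 s x" for x
    using s c by (simp add: normal_density_def s2 field_simps)
  have "integrable lborel (\<lambda>x. sqrt (2 * pi * s\<^sup>2) * normal_density 0 s x)"
    using s by simp
  then have "integrable lborel (\<lambda>x. exp (- (c * x\<^sup>2)))"
    unfolding eq .
  then show ?thesis
    unfolding integrable_iff_bounded by simp
qed

lemma nn_integral_gaussian2_finite: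
  fixes c :: real
  assumes c: "c > 0"
  shows "(\<integral>\<^sup>+ x. ennreal (exp (- (c * (norm (x::real^2))\<^sup>2))) \<partial>lborel) < \<infinity>"
proof -
  have eq: "ennreal (exp (- (c * (norm x)\<^sup>2))) = (\<Prod>b\<in>Basis. ennreal (exp (- (c * (x \<bullet> b)\<^sup>2))))"
    for x :: "real^2"
  proof -
    have "(norm x)\<^sup>2 = (\<Sum>b\<in>Basis. (x \<bullet> b)\<^sup>2)"
      by (simp add: norm_eq_sqrt_inner power2_eq_square euclidean_inner[symmetric])
    then have "exp (- (c * (norm x)\<^sup>2)) = (\<Prod>b\<in>Basis. exp (- (c * (x \<bullet> b)\<^sup>2)))"
      by (simp add: exp_sum sum_distrib_left sum_negf[symmetric])
    then show ?thesis by (simp add: prod_ennreal)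
  qed
  have "(\<integral>\<^sup>+ x. ennreal (exp (- (c * (norm (x::real^2))\<^sup>2))) \<partial>lborel)
      = (\<Prod>b\<in>(Basis::(real^2) set). (\<integral>\<^sup>+ x. ennreal (exp (- (c * (x::real)\<^sup>2))) \<partial>lborel))"
    unfolding eq by (rule nn_integral_lborel_prod) auto
  also have "\<dots> < \<infinity>"
    using nn_integral_gaussian_finite[OF c] by (simp add: power_less_top_ennreal)
  finally show ?thesis .
qed

lemma ln_norm_diff_le: "ln (norm (a - b)) \<le> norm a + norm (b::'a::real_normed_vector)"
proof (cases "a = b")
  case False
  then have "ln (norm (a - b)) \<le> norm (a - b) - 1" by (intro ln_le_minus_one) simp
  also have "\<dots> \<le> norm a + norm b" using norm_triangle_ineq4[of a b] by linarith
  finally show ?thesis .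
qed simp

lemma energy_lower_bound:
  "energy N X \<ge> (\<Sum>i<N. real N * ((norm (X i))\<^sup>2 / 4 - 1))"
proof -
  have "(\<Sum>i<N. \<Sum>j\<in>{..<N} - {i}. ln (norm (X i - X j)))
      \<le> (\<Sum>i<N. \<Sum>j\<in>{..<N} - {i}. norm (X i) + norm (X j))"
    by (intro sum_mono ln_norm_diff_le)
  also have "\<dots> \<le> (\<Sum>i<N. \<Sum>j<N. norm (X i) + norm (X j))"
    by (intro sum_mono sum_mono2) auto
  also have "\<dots> = 2 * (real N * (\<Sum>i<N. norm (X i)))"
    by (simp add: sum.distrib sum_distrib_left)
  finally have 1: "energy N X \<ge> - (real N * (\<Sum>i<N. norm (X i))) + real N * (\<Sum>i<N. (norm (X i))\<^sup>2 / 2)"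
    unfolding energy_def by (simp add: sum_negf)
  have 2: "- t + t\<^sup>2 / 2 \<ge> t\<^sup>2 / 4 - 1" for t :: real
    using zero_le_power2[of "t / 2 - 1"] by (simp add: power2_eq_square field_simps)
  have "(\<Sum>i<N. real N * ((norm (X i))\<^sup>2 / 4 - 1)) \<le> (\<Sum>i<N. real N * (- norm (X i) + (norm (X i))\<^sup>2 / 2))"
    by (intro sum_mono mult_left_mono 2) auto
  also have "\<dots> = - (real N * (\<Sum>i<N. norm (X i))) + real N * (\<Sum>i<N. (norm (X i))\<^sup>2 / 2)"
    by (simp add: sum_distrib_left sum.distrib sum_negf distrib_left sum_subtractf right_diff_distrib)
  finally show ?thesis using 1 by linarith
qed

lemma partition_fun_finite:
  assumes b: "\<beta> > 0"
  shows "partition_fun \<beta> N < \<infinity>"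
proof (cases "N = 0")
  case True
  then show ?thesis
    by (simp add: partition_fun_def config_measure_def energy_def PiM_empty nn_integral_count_space_finite)
next
  case False
  interpret product_sigma_finite "\<lambda>_::nat. lborel :: (real^2) measure" ..
  define g :: "real^2 \<Rightarrow> ennreal" where
    "g x = ennreal (exp (\<beta> * real N)) * ennreal (exp (- ((\<beta> * real N / 4) * (norm x)\<^sup>2)))" for x
  have fin: "(\<integral>\<^sup>+ x. g x \<partial>lborel) < \<infinity>"
    using nn_integral_gaussian2_finite[of "\<beta> * real N / 4"] b False
    by (simp add: g_def nn_integral_cmult ennreal_mult_less_top)
  have le: "ennreal (exp (- \<beta> * energy N X)) \<le> (\<Prod>i<N. g (X i))" for X
  proof -
    have "- \<beta> * energy N X \<le> - \<beta> * (\<Sum>i<N. real N * ((norm (X i))\<^sup>2 / 4 - 1))"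
      using b energy_lower_bound[of N X] by simp
    also have "\<dots> = (\<Sum>i<N. \<beta> * real N - (\<beta> * real N / 4) * (norm (X i))\<^sup>2)"
      by (simp add: sum_distrib_left sum_negf[symmetric] algebra_simps)
    finally have "exp (- \<beta> * energy N X) \<le> (\<Prod>i<N. exp (\<beta> * real N) * exp (- ((\<beta> * real N / 4) * (norm (X i))\<^sup>2)))"
      by (simp add: exp_sum[symmetric] mult_exp_exp)
    then show ?thesis
      by (simp add: g_def prod_ennreal ennreal_mult[symmetric] ennreal_leI)
  qed
  have "partition_fun \<beta> N \<le> (\<integral>\<^sup>+ X. (\<Prod>i<N. g (X i)) \<partial>(\<Pi>\<^sub>M i\<in>{..<N}. lborel))"
    unfolding partition_fun_def config_measure_def by (intro nn_integral_mono le)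
  also have "\<dots> = (\<Prod>i<N. (\<integral>\<^sup>+ x. g x \<partial>lborel))"
    by (rule product_nn_integral_prod) (auto simp: g_def[abs_def])
  also have "\<dots> < \<infinity>"
    using fin by (simp add: power_less_top_ennreal)
  finally show ?thesis .
qed

lemma partition_fun_pos: "partition_fun \<beta> N \<noteq> 0"
proof
  interpret product_sigma_finite "\<lambda>_::nat. lborel :: (real^2) measure" ..
  assume "partition_fun \<beta> N = 0"
  then have "AE X in config_measure N. ennreal (exp (- \<beta> * energy N X)) = 0"
    unfolding partition_fun_def by (subst (asm) nn_integral_0_iff_AE) measurable
  then have "AE X in config_measure N. False"
    by (rule eventually_mono) simp
  then have "emeasure (config_measure N) (space (config_measure N)) = 0"
    by (subst (asm) AE_iff_measurable[OF sets.top]) auto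
  moreover have "emeasure (config_measure N) (space (config_measure N))
      = (\<Prod>i<N. emeasure lborel (UNIV :: (real^2) set))"
    unfolding config_measure_def space_PiM by (subst emeasure_PiM) auto
  ultimately show False by simp
qed

lemma prob_space_gibbs:
  assumes "\<beta> > 0"
  shows "prob_space (gibbs \<beta> N)"
proof
  have "emeasure (gibbs \<beta> N) (space (gibbs \<beta> N))
      = (\<integral>\<^sup>+ X. ennreal (exp (- \<beta> * energy N X)) / partition_fun \<beta> N \<partial>config_measure N)"
    unfolding gibbs_def by (simp add: emeasure_density)
  also have "\<dots> = partition_fun \<beta> N / partition_fun \<beta> N"
    unfolding partition_fun_def by (rule nn_integral_divide) measurable
  also have "\<dots> = 1"
    using partition_fun_finite[OF assms, of N] partition_fun_pos[of \<beta> N]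
    by (simp add: ennreal_divide_self)
  finally show "emeasure (gibbs \<beta> N) (space (gibbs \<beta> N)) = 1" .
qed

text \<open>The supremum over an uncountable family is measurable because it is lower
  semicontinuous in the configuration.\<close>

lemma measurable_sup_fluct:
  assumes F: "\<And>f. f \<in> F \<Longrightarrow> continuous_on UNIV f"
  shows "sup_fluct F N \<in> borel_measurable (gibbs \<beta> N)"
proof -
  have cont: "continuous_on UNIV (\<lambda>X. ereal \<bar>fluct N f X\<bar>)" if "f \<in> F" for f
    unfolding fluct_def
    by (intro continuous_intros continuous_on_compose2[OF F[OF that]] continuous_on_product_coordinates)
      auto
  have lsc: "sup_fluct F N \<in> borel_measurable borel"
  proof (rule borel_measurableI_greater)
    fix y
    have "{X \<in> space borel. y < sup_fluct F N X} = (\<Union>f\<in>F. {X. y < ereal \<bar>fluct N f X\<bar>})"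
      by (auto simp: sup_fluct_def less_SUP_iff)
    moreover have "open (\<Union>f\<in>F. {X. y < ereal \<bar>fluct N f X\<bar>})"
      by (intro open_UN ballI open_Collect_less cont continuous_on_const)
    ultimately show "{X \<in> space borel. y < sup_fluct F N X} \<in> sets borel" by simp
  qed
  define ext :: "(nat \<Rightarrow> real^2) \<Rightarrow> nat \<Rightarrow> real^2" where "ext X = (\<lambda>i. if i < N then X i else 0)" for X
  have "ext \<in> measurable (config_measure N) (\<Pi>\<^sub>M i\<in>UNIV. borel)"
  proof (rule measurable_PiM_single')
    show "(\<lambda>X. ext X i) \<in> borel_measurable (config_measure N)" for i
      by (cases "i < N") (simp_all add: ext_def)
  qed auto
  then have "ext \<in> measurable (config_measure N) borel"
    using measurable_cong_sets[OF refl sets_PiM_equal_borel] by blast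
  then have "(\<lambda>X. sup_fluct F N (ext X)) \<in> borel_measurable (config_measure N)"
    using lsc by (rule measurable_compose)
  moreover have "sup_fluct F N (ext X) = sup_fluct F N X" for X
    by (simp add: sup_fluct_def fluct_def ext_def)
  ultimately show ?thesis
    by (simp add: gibbs_def cong: measurable_cong_sets)
qed

lemma sup_fluct_event_sets:
  "{X \<in> space (gibbs \<beta> N). sup_fluct (test_functions lam r N) N X \<ge> ereal c} \<in> sets (gibbs \<beta> N)"
proof -
  have "continuous_on UNIV f" if "f \<in> test_functions lam r N" for f
    using that by (auto simp: test_functions_def class_C2_def continuous_on_eq_continuous_at
        differentiable_imp_continuous_within)
  note [measurable] = measurable_sup_fluct[OF this]
  show ?thesis by measurable
qed

end

theory Submission
  imports Defs
begin

text \<open>Let \<open>h x\<close> be minus the sum of \<open>ln (norm (x - X j))\<close> over the \<open>N\<close> particles plus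
  \<open>N * ((norm x)\<^sup>2 - 1) / 2\<close>; in the unit disc this is the potential of the particles minus that
  of \<open>N\<close> times the uniform measure (\<open>local_potential\<close>). By Green's formula, the fluctuation of a
  \<open>C\<^sup>2\<close> function \<open>f\<close> supported inside the disc is \<open>- 1 / (2 * pi)\<close> times the integral of \<open>h\<close> times
  the Laplacian of \<open>f\<close> (\<open>fluct_eq_integral_lapl_potential\<close>). If \<open>f\<close> is supported in a disc of
  radius \<open>l\<close> and its second derivatives are at most \<open>1 / l\<^sup>2\<close>, the fluctuation is thus at most
  \<open>1 / (pi * l\<^sup>2)\<close> times the integral of \<open>\<bar>h\<bar>\<close> over the support. So one event suffices for all
  test functions: the event that the integral of \<open>\<bar>h\<bar>\<close> over every set of area at most \<open>M\<close> in a
  disc of radius less than \<open>1\<close> is at most a constant times \<open>M * ln N\<close>, for all \<open>M \<ge> 1 / N\<close>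
  (\<open>good_abs_potential_integral\<close>). This works with \<open>\<lambda> = 1\<close>.

  The negative part of \<open>h\<close>. Adding a particle at \<open>x\<close> changes the energy by \<open>h x\<close> up to a constant,
  so the expectation of the integral of \<open>exp (- \<beta> * h x)\<close> is a ratio of partition functions for
  \<open>N + 1\<close> and \<open>N\<close> particles. If it is at most a power of \<open>N\<close>, then the integral itself is at
  most a power of \<open>N\<close> with high probability, and the mean of the negative part over a set whose
  area is at least a power of \<open>1 / N\<close> is of order \<open>ln N\<close> (\<open>good_negative_part\<close>).

  The positive part of \<open>h\<close>. Removing the particle \<open>i\<close> shows in the same way that the potential
  acting on this particle is at most of order \<open>ln N\<close>. Away from the particles \<open>h\<close> is
  subharmonic, so the values that \<open>h\<close>, smoothed at a scale \<open>\<eta>\<close>, takes in a disc of radius less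
  than \<open>1\<close> are bounded by its value at a point within distance \<open>\<eta>\<close> of some particle
  (\<open>max_near_particle\<close>). There it is comparable to the potential acting on the particle, unless
  many other particles are very close; but such a cluster would make the mean of \<open>h\<close> over a
  small disc around it more negative than is possible (\<open>good_cluster_bound\<close>).

  The ratios of partition functions. Jensen's inequality gives lower bounds both for the ratio
  that belongs to an insertion and for the one that belongs to a removal
  (\<open>insertion_lower_bound\<close>, \<open>removal_lower_bound\<close>). A removal undoes an insertion, so each of
  these is an upper bound for the other ratio, up to a change of the confinement that is
  computed by scaling (\<open>insertion_ratio\<close>, \<open>removal_ratio\<close>). The exponents in Jensen's inequality
  contain the mean of the energy, which must be known up to an error of order \<open>N * ln N\<close>, and
  the mean of the second moment. The latter is exact by scaling (\<open>virial_identity\<close>). The former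
  is bounded above by the Gibbs variational principle (\<open>gibbs_energy_upper_bound\<close>) and below by
  a pointwise bound for the energy, which comes from the positivity of the logarithmic energy of
  neutral charges (\<open>log_kernel_cnd\<close>), applied to the particles against independent uniform
  points (\<open>pair_energy_lower_bound\<close>).\<close>

text \<open>The pattern \<open>\<lambda>X. X i\<close> of this rule matches every application of a function to an
  argument, so as an automatic rule it misleads the measurability prover.\<close>
declare measurable_component_config [measurable del]

section \<open>Radial integrals in the plane\<close>

text \<open>A disc with \<open>(norm x)\<^sup>2 \<le> s\<close> has area \<open>pi * s\<close>. In the variable \<open>s\<close> radial integrals
  therefore have a constant Jacobian, which is why they are written in terms of the squared
  norm throughout.\<close>
lemma distr_norm_square:
  "distr lborel borel (\<lambda>x::real^2. (norm x)\<^sup>2)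
     = density lborel (\<lambda>s. ennreal (pi * indicator {0..} s))"
proof (rule measure_eqI_generator_eq[where E="range (\<lambda>a::real. {..a})" and \<Omega>=UNIV
      and A="\<lambda>i::nat. {..real i}"])
  have em: "emeasure (distr lborel borel (\<lambda>x::real^2. (norm x)\<^sup>2)) {..a} = ennreal (pi * max 0 a)" for a
  proof (cases "0 \<le> a")
    case True
    have "norm x \<le> sqrt a \<longleftrightarrow> (norm x)\<^sup>2 \<le> a" for x :: "real^2"
      using True real_le_rsqrt[of "norm x" a] power_mono[of "norm x" "sqrt a" 2] by auto
    then have "(\<lambda>x::real^2. (norm x)\<^sup>2) -` {..a} = cball 0 (sqrt a)"
      by auto
    then show ?thesis
      using True by (simp add: emeasure_distr emeasure_cball unit_ball_vol_2)
  next
    case False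
    then have "(\<lambda>x::real^2. (norm x)\<^sup>2) -` {..a} = {}"
      by (auto simp: not_le) (meson not_le order_trans zero_le_power2)
    then show ?thesis using False by (simp add: emeasure_distr)
  qed
  have em2: "emeasure (density lborel (\<lambda>s. ennreal (pi * indicator {0..} s))) {..a} = ennreal (pi * max 0 a)" for a
  proof -
    have "emeasure (density lborel (\<lambda>s. ennreal (pi * indicator {0..} s))) {..a}
      = (\<integral>\<^sup>+s. ennreal pi * indicator {0..a} s \<partial>lborel)"
      by (subst emeasure_density) (auto intro!: nn_integral_cong split: split_indicator)
    also have "\<dots> = ennreal pi * emeasure lborel {0..a}"
      by (subst nn_integral_cmult_indicator) auto
    also have "\<dots> = ennreal (pi * max 0 a)"
      by (cases "0 \<le> a") (auto simp: ennreal_mult')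
    finally show ?thesis .
  qed
  show "emeasure (distr lborel borel (\<lambda>x::real^2. (norm x)\<^sup>2)) X
      = emeasure (density lborel (\<lambda>s. ennreal (pi * indicator {0..} s))) X"
    if "X \<in> range (\<lambda>a::real. {..a})" for X
    using that em em2 by auto
  show "emeasure (distr lborel borel (\<lambda>x::real^2. (norm x)\<^sup>2)) {..real i} \<noteq> \<infinity>" for i
    unfolding em by simp
  show "Int_stable (range (\<lambda>a::real. {..a}))"
    by (auto simp: Int_stable_def)
  show "(\<Union>i. {..real i}) = UNIV"
    using real_arch_simple by auto
qed (auto simp: borel_eq_atMost)

lemma nn_integral_radial:
  assumes [measurable]: "\<phi> \<in> borel_measurable borel"
  shows "(\<integral>\<^sup>+x. \<phi> ((norm (x::real^2))\<^sup>2) \<partial>lborel) = ennreal pi * (\<integral>\<^sup>+s. \<phi> s * indicator {0..} s \<partial>lborel)"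
proof -
  have "(\<integral>\<^sup>+x. \<phi> ((norm (x::real^2))\<^sup>2) \<partial>lborel) = (\<integral>\<^sup>+s. \<phi> s \<partial>distr lborel borel (\<lambda>x::real^2. (norm x)\<^sup>2))"
    by (subst nn_integral_distr) auto
  also have "\<dots> = (\<integral>\<^sup>+s. ennreal pi * (\<phi> s * indicator {0..} s) \<partial>lborel)"
    unfolding distr_norm_square
    by (subst nn_integral_density) (auto intro!: nn_integral_cong split: split_indicator)
  finally show ?thesis by (simp add: nn_integral_cmult)
qed

lemma
  fixes \<phi> :: "real \<Rightarrow> real"
  assumes [measurable]: "\<phi> \<in> borel_measurable borel"
  shows integrable_radial_iff:
      "integrable lborel (\<lambda>x::real^2. \<phi> ((norm x)\<^sup>2)) \<longleftrightarrow> set_integrable lborel {0..} \<phi>"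
    and integral_radial:
      "(LINT x|lborel. \<phi> ((norm (x::real^2))\<^sup>2)) = pi * (LINT s:{0..}|lborel. \<phi> s)"
proof -
  have "integrable lborel (\<lambda>x::real^2. \<phi> ((norm x)\<^sup>2))
      \<longleftrightarrow> integrable (distr lborel borel (\<lambda>x::real^2. (norm x)\<^sup>2)) \<phi>"
    by (subst integrable_distr_eq) auto
  also have "\<dots> \<longleftrightarrow> integrable lborel (\<lambda>s. (pi * indicator {0..} s) *\<^sub>R \<phi> s)"
    unfolding distr_norm_square by (subst integrable_density) auto
  finally show "integrable lborel (\<lambda>x::real^2. \<phi> ((norm x)\<^sup>2)) \<longleftrightarrow> set_integrable lborel {0..} \<phi>"
    by (simp add: set_integrable_def mult.assoc)
  have "(LINT x|lborel. \<phi> ((norm (x::real^2))\<^sup>2)) = (LINT s|distr lborel borel (\<lambda>x::real^2. (norm x)\<^sup>2). \<phi> s)"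
    by (subst integral_distr) auto
  also have "\<dots> = (LINT s|lborel. (pi * indicator {0..} s) *\<^sub>R \<phi> s)"
    unfolding distr_norm_square by (subst integral_density) auto
  also have "\<dots> = pi * (LINT s:{0..}|lborel. \<phi> s)"
    by (simp add: set_lebesgue_integral_def mult.assoc)
  finally show "(LINT x|lborel. \<phi> ((norm (x::real^2))\<^sup>2)) = pi * (LINT s:{0..}|lborel. \<phi> s)" .
qed

lemma sphere_null: "{y::real^2. norm y = r} \<in> null_sets lborel"
proof (rule null_setsI)
  have [measurable]: "{y::real^2. norm y = r} \<in> sets borel" by measurable
  have m2: "{y::real^2. (norm y)\<^sup>2 = r\<^sup>2} \<in> sets lborel" by measurable
  have "emeasure lborel {y::real^2. norm y = r} \<le> emeasure lborel {y::real^2. (norm y)\<^sup>2 = r\<^sup>2}"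
    by (rule emeasure_mono[OF _ m2]) auto
  also have "\<dots> = (\<integral>\<^sup>+x. indicator {r\<^sup>2} ((norm (x::real^2))\<^sup>2) \<partial>lborel)"
    unfolding nn_integral_indicator[OF m2, symmetric]
    by (intro nn_integral_cong) (auto split: split_indicator)
  also have "\<dots> = ennreal pi * (\<integral>\<^sup>+s. indicator {r\<^sup>2} s * indicator {0..} s \<partial>lborel)"
    by (rule nn_integral_radial) simp
  also have "\<dots> \<le> ennreal pi * (\<integral>\<^sup>+s. indicator {r\<^sup>2} s \<partial>lborel)"
    by (intro mult_left_mono nn_integral_mono) (auto split: split_indicator)
  also have "(\<integral>\<^sup>+s. indicator {r\<^sup>2} s \<partial>lborel) = emeasure lborel {r\<^sup>2}"
    by (rule nn_integral_indicator) simp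
  finally show "emeasure lborel {y::real^2. norm y = r} = 0" by simp
qed auto

text \<open>Provides an explicitly integrable majorant of the logarithmic singularity.\<close>
lemma neg_ln_le_powr:
  assumes "0 \<le> t" "t \<le> (1::real)"
  shows "\<bar>ln t\<bar> \<le> 2 * t powr (-1/2)"
proof (cases "t = 0")
  case False
  then have t: "t > 0" using assms by simp
  have "ln (t powr (-1/2)) \<le> t powr (-1/2) - 1" using t by (intro ln_le_minus_one) auto
  then show ?thesis using t assms by (simp add: ln_powr abs_if)
qed simp

lemma set_integrable_ln_abs_unit: "set_integrable lborel {-1..1} (\<lambda>t::real. ln \<bar>t\<bar>)"
proof -
  have "((\<lambda>t::real. t powr (-1/2)) has_integral 2) {0..1}"
    using has_integral_powr_from_0[of "-1/2" 1] by simp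
  from nn_integral_has_integral_lebesgue'[OF _ this]
  have "(\<integral>\<^sup>+x. ennreal (x powr (-1/2)) * indicator {0..1} x \<partial>lborel) = ennreal 2" by simp
  then have "(\<integral>\<^sup>+x. ennreal (indicator {0..1} x * x powr (-1/2)) \<partial>lborel) = ennreal 2"
    by (simp add: indicator_mult_ennreal mult.commute)
  then have "integrable lborel (\<lambda>x. indicator {0..1} x * x powr (-1/2) :: real)"
    by (intro integrableI_nonneg) auto
  then have int: "integrable lborel (\<lambda>x. 2 * (indicator {0..1} x * x powr (-1/2)) :: real)"
    by simp
  have p: "set_integrable lborel {0..1} (\<lambda>t::real. ln \<bar>t\<bar>)"
    unfolding set_integrable_def
    by (rule Bochner_Integration.integrable_bound[OF int])
       (auto intro!: AE_I2 simp: neg_ln_le_powr[simplified] split: split_indicator)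
  from lborel_integrable_real_affine[OF p[unfolded set_integrable_def], of "-1" 0]
  have "set_integrable lborel {-1..0} (\<lambda>t::real. ln \<bar>t\<bar>)"
    unfolding set_integrable_def
    by (rule Bochner_Integration.integrable_cong[THEN iffD1, rotated 2]) (auto split: split_indicator)
  from set_integrable_Un[OF this p] show ?thesis
    by (simp add: ivl_disj_un)
qed

lemma set_integrable_ln_abs: "set_integrable lborel {c..d} (\<lambda>t::real. ln \<bar>t - a\<bar>)"
proof -
  have i1: "integrable lborel (\<lambda>t. indicator {-1..1} (-a + 1 * t) *\<^sub>R ln \<bar>-a + 1 * t\<bar> :: real)"
    using lborel_integrable_real_affine[OF set_integrable_ln_abs_unit[unfolded set_integrable_def], of 1 "-a"]
    by simp
  have i2: "integrable lborel (\<lambda>t. indicator {c..d} t * (\<bar>c\<bar> + \<bar>d\<bar> + \<bar>a\<bar>) :: real)"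
    by (intro integrable_mult_left integrable_real_indicator) (auto simp: emeasure_lborel_Icc_eq)
  have "integrable lborel (\<lambda>t. \<bar>indicator {-1..1} (-a + 1 * t) *\<^sub>R ln \<bar>-a + 1 * t\<bar>\<bar> + indicator {c..d} t * (\<bar>c\<bar> + \<bar>d\<bar> + \<bar>a\<bar>) :: real)"
    by (intro Bochner_Integration.integrable_add integrable_abs i1 i2)
  then show ?thesis
    unfolding set_integrable_def
  proof (rule Bochner_Integration.integrable_bound)
    have "\<bar>ln \<bar>t - a\<bar>\<bar> \<le> \<bar>c\<bar> + \<bar>d\<bar> + \<bar>a\<bar>"
      if t: "\<not> (-1 \<le> t - a \<and> t - a \<le> 1)" "c \<le> t" "t \<le> d" for t
    proof -
      have g: "\<bar>t - a\<bar> > 1" using t(1) by (auto simp: abs_if)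
      then have "\<bar>ln \<bar>t - a\<bar>\<bar> = ln \<bar>t - a\<bar>" by simp
      also have "\<dots> \<le> \<bar>t - a\<bar> - 1" using g by (intro ln_le_minus_one) auto
      finally show ?thesis using t by linarith
    qed
    then show "AE t in lborel. norm (indicator {c..d} t *\<^sub>R ln \<bar>t - a\<bar>) \<le>
        norm (\<bar>indicator {-1..1} (-a + 1 * t) *\<^sub>R ln \<bar>-a + 1 * t\<bar>\<bar> + indicator {c..d} t * (\<bar>c\<bar> + \<bar>d\<bar> + \<bar>a\<bar>) :: real)"
      by (intro AE_I2) (auto split: split_indicator)
  qed auto
qed

lemma x_ln_x_continuous: "continuous_on {0..} (\<lambda>s::real. s * ln s)"
proof -
  have z: "((\<lambda>s::real. s * ln s) \<longlongrightarrow> 0) (at 0 within {0..})"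
  proof (rule Lim_null_comparison)
    show "\<forall>\<^sub>F s in at (0::real) within {0..}. norm (s * ln s) \<le> 2 * s powr (1/2)"
      unfolding eventually_at
    proof (intro exI[of _ 1] conjI ballI impI)
      fix s :: real assume s: "s \<in> {0..}" "s \<noteq> 0 \<and> dist s 0 < 1"
      then have "s * \<bar>ln s\<bar> \<le> s * (2 * s powr (-1/2))"
        using neg_ln_le_powr[of s] by (intro mult_left_mono) (auto simp: dist_real_def)
      then have "\<bar>s * ln s\<bar> \<le> s * (2 * s powr (-1/2))"
        using s by (simp add: abs_mult)
      also have "\<dots> = 2 * s powr (1/2)"
        using s by (simp add: powr_mult_base)
      finally show "norm (s * ln s) \<le> 2 * s powr (1/2)" by simp
    qed simp
    show "((\<lambda>s::real. 2 * s powr (1/2)) \<longlongrightarrow> 0) (at 0 within {0..})"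
      by (auto intro!: tendsto_eq_intros simp: eventually_at_filter)
  qed
  show ?thesis
    unfolding continuous_on
  proof
    fix x :: real assume "x \<in> {0..}"
    then show "((\<lambda>s. s * ln s) \<longlongrightarrow> x * ln x) (at x within {0..})"
      using z by (cases "x = 0") (auto intro!: tendsto_intros)
  qed
qed

lemma has_integral_ln:
  assumes "0 \<le> a" "a \<le> (b::real)"
  shows "(ln has_integral (b * ln b - b) - (a * ln a - a)) {a..b}"
proof (rule fundamental_theorem_of_calculus_interior[OF assms(2)])
  show "continuous_on {a..b} (\<lambda>s. s * ln s - s)"
    using assms by (intro continuous_intros continuous_on_subset[OF x_ln_x_continuous]) auto
  fix x assume "x \<in> {a<..<b}"
  then show "((\<lambda>s. s * ln s - s) has_vector_derivative ln x) (at x)"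
    using assms unfolding has_real_derivative_iff_has_vector_derivative[symmetric]
    by (auto intro!: derivative_eq_intros)
qed

text \<open>In the squared radius, the logarithmic potential of a disc reduces to this integral.\<close>
lemma
  assumes "0 \<le> a" "0 \<le> (b::real)"
  shows set_integrable_ln_max: "set_integrable lborel {0..b} (\<lambda>s. ln (max a s))"
    and set_integral_ln_max: "(LINT s:{0..b}|lborel. ln (max a s))
      = (if b \<le> a then b * ln a else b * ln b - b + a)"
proof -
  show i: "set_integrable lborel {0..b} (\<lambda>s. ln (max a s))"
  proof -
    have "integrable lborel (\<lambda>s. \<bar>indicator {0..b} s *\<^sub>R ln \<bar>s - 0\<bar>\<bar> + indicator {0..b} s * \<bar>ln a\<bar> :: real)"
      using set_integrable_ln_abs[of 0 b 0, unfolded set_integrable_def]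
      by (intro Bochner_Integration.integrable_add integrable_abs integrable_mult_left integrable_real_indicator)
         (auto simp: emeasure_lborel_Icc_eq)
    then show ?thesis
      unfolding set_integrable_def
      by (rule Bochner_Integration.integrable_bound)
         (auto split: split_indicator simp: max_def intro!: AE_I2)
  qed
  have "((\<lambda>s. ln (max a s)) has_integral (if b \<le> a then b * ln a else b * ln b - b + a)) {0..b}"
  proof (cases "b \<le> a")
    case True
    have "((\<lambda>s::real. ln a) has_integral (b - 0) * ln a) {0..b}"
      using has_integral_const_real[of "ln a" 0 b] assms by simp
    then have "((\<lambda>s. ln (max a s)) has_integral (b - 0) * ln a) {0..b}"
      by (rule has_integral_eq[rotated]) (use True in \<open>auto simp: max_def intro!: arg_cong[where f=ln]\<close>)
    then show ?thesis using True by simp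
  next
    case False
    have "((\<lambda>s::real. ln a) has_integral (a - 0) * ln a) {0..a}"
      using has_integral_const_real[of "ln a" 0 a] assms by simp
    then have 1: "((\<lambda>s. ln (max a s)) has_integral (a - 0) * ln a) {0..a}"
      by (rule has_integral_eq[rotated]) (auto simp: max_def)
    have 2: "((\<lambda>s. ln (max a s)) has_integral (b * ln b - b) - (a * ln a - a)) {a..b}"
      by (rule has_integral_eq[OF _ has_integral_ln]) (use False assms in \<open>auto simp: max_def\<close>)
    from has_integral_combine[OF _ _ 1 2] show ?thesis
      using False assms by (simp add: algebra_simps)
  qed
  then show "(LINT s:{0..b}|lborel. ln (max a s)) = (if b \<le> a then b * ln a else b * ln b - b + a)"
    using set_borel_integral_eq_integral(2)[OF i] by (simp add: integral_unique)
qed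

lemma lborel_distr_orthogonal:
  fixes f :: "real^2 \<Rightarrow> real^2"
  assumes f: "orthogonal_transformation f"
  shows "distr lborel borel f = lborel"
proof (rule lborel_eqI[symmetric])
  have lin: "linear f" using f by (rule orthogonal_transformation_linear)
  have [measurable]: "f \<in> borel_measurable borel"
    using lin by (intro borel_measurable_continuous_onI linear_continuous_on) (simp add: linear_conv_bounded_linear)
  have bij: "bij f" using f by (rule orthogonal_transformation_bij)
  fix l u :: "real^2" assume lu: "\<And>b. b \<in> Basis \<Longrightarrow> l \<bullet> b \<le> u \<bullet> b"
  have im: "f -` box l u = inv f ` box l u"
    using bij by (simp add: bij_vimage_eq_inv_image)
  have m: "inv f ` box l u \<in> lmeasurable"
    using measurable_orthogonal_image[OF orthogonal_transformation_inv[OF f]] by blast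
  have "emeasure (distr lborel borel f) (box l u) = emeasure lborel (f -` box l u)"
    by (simp add: emeasure_distr)
  also have "\<dots> = emeasure lebesgue (inv f ` box l u)"
    unfolding im[symmetric]
    using measurable_sets_borel[of f borel "box l u"] by simp
  also have "\<dots> = ennreal (measure lebesgue (inv f ` box l u))"
    using m by (simp add: emeasure_eq_measure2)
  also have "\<dots> = ennreal (measure lebesgue (box l u))"
    by (subst measure_orthogonal_image[OF orthogonal_transformation_inv[OF f]]) auto
  also have "\<dots> = emeasure lborel (box l u)"
    by (simp add: emeasure_lborel_box lu inner_diff_left measure_lborel_box prod_nonneg measure_completion)
  also have "\<dots> = ennreal (\<Prod>b\<in>Basis. (u - l) \<bullet> b)"
    by (simp add: emeasure_lborel_box lu)
  finally show "emeasure (distr lborel borel f) (box l u) = ennreal (\<Prod>b\<in>Basis. (u - l) \<bullet> b)" .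
qed simp

section \<open>The logarithmic potential of a disc\<close>

lemma cball_borel_sets [measurable]: "cball (z::real^2) R \<in> sets borel"
  by simp

text \<open>The plane as the complex numbers: their powers turn averages of \<open>ln\<close> over rotations
  into \<open>ln\<close> of a single polynomial.\<close>
definition cpx :: "real^2 \<Rightarrow> complex" where "cpx v = Complex (v $ 1) (v $ 2)"

definition rot :: "real \<Rightarrow> real^2 \<Rightarrow> real^2" where
  "rot \<theta> v = vector [cos \<theta> * v $ 1 - sin \<theta> * v $ 2, sin \<theta> * v $ 1 + cos \<theta> * v $ 2]"

lemma cmod_cpx: "cmod (cpx v) = norm v"
  by (simp add: cpx_def complex_norm norm_vec_def L2_set_def sum_2)

lemma cpx_diff: "cpx (v - w) = cpx v - cpx w"
  by (simp add: cpx_def complex_eq_iff)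

lemma cpx_rot: "cpx (rot \<theta> v) = cis \<theta> * cpx v"
  by (simp add: cpx_def rot_def complex_eq_iff)

lemma norm_rot: "norm (rot \<theta> v) = norm v"
  by (simp add: cmod_cpx[symmetric] cpx_rot norm_mult)

lemma orthogonal_rot: "orthogonal_transformation (rot \<theta>)"
proof -
  have "linear (rot \<theta>)"
    by (rule linearI) (simp_all add: rot_def vec_eq_iff forall_2 algebra_simps)
  then show ?thesis by (simp add: orthogonal_transformation norm_rot)
qed

lemma measurable_cpx [measurable]: "cpx \<in> borel_measurable borel"
  unfolding cpx_def Complex_eq
  by (intro borel_measurable_continuous_onI continuous_intros)

lemma measurable_rot [measurable]: "rot \<theta> \<in> borel_measurable borel"
  using orthogonal_transformation_linear[OF orthogonal_rot]
  by (intro borel_measurable_continuous_onI linear_continuous_on) (simp add: linear_conv_bounded_linear)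

lemma
  fixes g :: "real^2 \<Rightarrow> real"
  assumes [measurable]: "g \<in> borel_measurable borel"
  shows integral_disc_rot: "(LINT y:cball 0 R|lborel. g (rot \<theta> y)) = (LINT y:cball 0 R|lborel. g y)"
    and integrable_disc_rot: "set_integrable lborel (cball 0 R) g \<Longrightarrow> set_integrable lborel (cball 0 R) (\<lambda>y. g (rot \<theta> y))"
proof -
  define G where "G y = indicator (cball 0 R) y *\<^sub>R g y" for y :: "real^2"
  have [measurable]: "G \<in> borel_measurable borel" 
    unfolding G_def using assms by (intro borel_measurable_scaleR borel_measurable_indicator) auto
  have e: "indicator (cball 0 R) y *\<^sub>R g (rot \<theta> y) = G (rot \<theta> y)" for y
    by (simp add: norm_rot G_def split: split_indicator)
  have d: "distr lborel borel (rot \<theta>) = lborel"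
    by (rule lborel_distr_orthogonal[OF orthogonal_rot])
  show "(LINT y:cball 0 R|lborel. g (rot \<theta> y)) = (LINT y:cball 0 R|lborel. g y)"
    unfolding set_lebesgue_integral_def e
    using integral_distr[of "rot \<theta>" lborel borel G] by (simp add: d G_def[abs_def])
  show "set_integrable lborel (cball 0 R) (\<lambda>y. g (rot \<theta> y))" if "set_integrable lborel (cball 0 R) g"
    using that integrable_distr_eq[of "rot \<theta>" lborel borel G]
    unfolding set_integrable_def e by (simp add: d G_def[abs_def])
qed

text \<open>This is the mean of \<open>ln (norm (x - w y))\<close> over the roots of unity \<open>w\<close> of order
  \<open>n = 2 ^ m\<close>, because the product of the factors \<open>x - w y\<close> is \<open>x ^ n - y ^ n\<close>. Restricting
  the order to powers of two makes each mean an average of two copies of the preceding one.\<close>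
definition iterated_log :: "real^2 \<Rightarrow> nat \<Rightarrow> real^2 \<Rightarrow> real" where
  "iterated_log x m y = ln (cmod (cpx x ^ (2 ^ m) - cpx y ^ (2 ^ m))) / 2 ^ m"

lemma measurable_iterated_log [measurable]: "iterated_log x m \<in> borel_measurable borel"
  unfolding iterated_log_def by measurable

text \<open>Rotating \<open>y\<close> by \<open>pi / 2 ^ m\<close> changes the sign of \<open>Y = y ^ (2 ^ m)\<close>, and
  \<open>(X - Y) * (X + Y) = X\<^sup>2 - Y\<^sup>2\<close>. Distinct norms keep all the logarithms away from the
  value \<open>ln 0 = 0\<close>, where \<open>ln\<close> is not additive.\<close>
lemma iterated_log_Suc:
  assumes ne: "norm y \<noteq> norm x"
  shows "iterated_log x (Suc m) y = (iterated_log x m y + iterated_log x m (rot (pi / 2 ^ m) y)) / 2"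
proof -
  define X where "X = cpx x ^ (2 ^ m)"
  define Y where "Y = cpx y ^ (2 ^ m)"
  have "cpx (rot (pi / 2 ^ m) y) ^ (2 ^ m) = - Y"
    by (simp add: cpx_rot power_mult_distrib Complex.DeMoivre Y_def)
  then have 1: "iterated_log x m (rot (pi / 2 ^ m) y) = ln (cmod (X + Y)) / 2 ^ m"
    by (simp add: iterated_log_def X_def)
  have "norm x ^ (2 ^ m) \<noteq> norm y ^ (2 ^ m)"
    using ne by (simp add: power_eq_iff_eq_base)
  then have n: "cmod X \<noteq> cmod Y" by (simp add: X_def Y_def norm_power cmod_cpx)
  then have "X \<noteq> Y" "X \<noteq> - Y" by auto
  then have ne: "X - Y \<noteq> 0" "X + Y \<noteq> 0" by (auto simp: eq_neg_iff_add_eq_0)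
  have "cpx x ^ (2 ^ Suc m) = X * X" "cpx y ^ (2 ^ Suc m) = Y * Y"
    by (simp_all add: X_def Y_def power_add[symmetric] mult_2)
  then have "cpx x ^ (2 ^ Suc m) - cpx y ^ (2 ^ Suc m) = (X - Y) * (X + Y)"
    by (simp only:) (simp add: algebra_simps)
  then have "iterated_log x (Suc m) y = ln (cmod (X - Y) * cmod (X + Y)) / 2 ^ Suc m"
    unfolding iterated_log_def by (simp only: norm_mult)
  also have "\<dots> = (ln (cmod (X - Y)) + ln (cmod (X + Y))) / (2 * 2 ^ m)"
    using ne by (simp add: ln_mult)
  finally have "iterated_log x (Suc m) y = (ln (cmod (X - Y)) + ln (cmod (X + Y))) / (2 * 2 ^ m)" .
  then show ?thesis
    unfolding 1 by (simp add: iterated_log_def X_def Y_def field_simps)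
qed

text \<open>With \<open>M\<close> the larger and \<open>s\<close> the smaller of the two norms, the modulus of
  \<open>x ^ n - y ^ n\<close> lies between \<open>M ^ (n - 1) * (M - s)\<close> and \<open>2 * M ^ n\<close>; its logarithm
  divided by \<open>n\<close> is therefore \<open>ln M\<close> up to an error of order \<open>1 / n\<close>.\<close>
lemma iterated_log_near_max:
  assumes ne: "norm y \<noteq> norm x"
  shows "\<bar>iterated_log x m y - ln (max (norm x) (norm y))\<bar>
    \<le> (3 * ln 2 + \<bar>ln \<bar>(norm y)\<^sup>2 - (norm x)\<^sup>2\<bar>\<bar> + 2 * \<bar>ln (max (norm x) (norm y))\<bar>) / 2 ^ m"
proof -
  define n :: nat where "n = 2 ^ m"
  have n: "n \<ge> 1" by (simp add: n_def)
  define M where "M = max (norm x) (norm y)"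
  define s where "s = min (norm x) (norm y)"
  have M: "0 < M" "0 \<le> s" "s < M" using ne by (auto simp: M_def s_def max_def min_def)
  have dsq: "\<bar>(norm y)\<^sup>2 - (norm x)\<^sup>2\<bar> = (M - s) * (M + s)"
  proof -
    have "\<bar>(norm y)\<^sup>2 - (norm x)\<^sup>2\<bar> = \<bar>norm y - norm x\<bar> * (norm y + norm x)"
      by (simp add: power2_eq_square square_diff_square_factored abs_mult add_ac mult_ac)
    then show ?thesis by (auto simp: M_def s_def max_def min_def abs_if)
  qed
  define z where "z = cpx x ^ n - cpx y ^ n"
  have up: "cmod z \<le> 2 * M ^ n"
  proof -
    have "cmod z \<le> norm x ^ n + norm y ^ n"
      unfolding z_def using norm_triangle_ineq4[of "cpx x ^ n" "cpx y ^ n"] by (simp add: norm_power cmod_cpx)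
    also have "\<dots> \<le> M ^ n + M ^ n" by (intro add_mono power_mono) (auto simp: M_def)
    finally show ?thesis by simp
  qed
  have lo: "M ^ (n - 1) * (M - s) \<le> cmod z"
  proof -
    have "\<bar>norm x ^ n - norm y ^ n\<bar> \<le> cmod z"
      unfolding z_def using norm_triangle_ineq3[of "cpx x ^ n" "cpx y ^ n"] by (simp add: norm_power cmod_cpx)
    moreover have "\<bar>norm x ^ n - norm y ^ n\<bar> = M ^ n - s ^ n"
      using power_mono[of "norm x" "norm y" n] power_mono[of "norm y" "norm x" n]
      by (cases "norm x \<le> norm y") (simp_all add: M_def s_def max_def min_def)
    moreover have "s ^ n \<le> M ^ (n - 1) * s"
    proof -
      have "s ^ n = s ^ (n - 1) * s" using power_minus_mult[of n s] n by simp
      also have "\<dots> \<le> M ^ (n - 1) * s" using M by (intro mult_right_mono power_mono) auto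
      finally show ?thesis .
    qed
    moreover have "M ^ n = M ^ (n - 1) * M" using power_minus_mult[of n M] n by simp
    ultimately show ?thesis by (simp add: right_diff_distrib)
  qed
  have zp: "cmod z > 0"
    using lo M by (meson less_le_trans mult_pos_pos zero_less_power diff_gt_0_iff_gt)
  have u: "ln (cmod z) \<le> ln 2 + n * ln M"
  proof -
    have "ln (cmod z) \<le> ln (2 * M ^ n)" using up zp M by (subst ln_le_cancel_iff) auto
    then show ?thesis using M by (simp add: ln_mult ln_realpow)
  qed
  have l: "ln (cmod z) \<ge> n * ln M - ln M + ln (M - s)"
  proof -
    have "ln (M ^ (n - 1) * (M - s)) \<le> ln (cmod z)" using lo zp M by (subst ln_le_cancel_iff) auto
    moreover have "ln (M ^ (n - 1) * (M - s)) = (real n - 1) * ln M + ln (M - s)"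
      using M n by (subst ln_mult) (simp_all add: ln_realpow of_nat_diff)
    ultimately show ?thesis by (simp add: left_diff_distrib)
  qed
  have "ln (M - s) \<ge> ln \<bar>(norm y)\<^sup>2 - (norm x)\<^sup>2\<bar> - ln 2 - ln M"
  proof -
    have "ln (M + s) \<le> ln (2 * M)" using M by (subst ln_le_cancel_iff) auto
    then show ?thesis using M by (simp add: dsq ln_mult)
  qed
  with u l have "\<bar>ln (cmod z) - n * ln M\<bar> \<le> 3 * ln 2 + \<bar>ln \<bar>(norm y)\<^sup>2 - (norm x)\<^sup>2\<bar>\<bar> + 2 * \<bar>ln M\<bar>"
    by (simp add: abs_le_iff) (smt (verit) ln_ge_zero)
  moreover have "iterated_log x m y - ln M = (ln (cmod z) - n * ln M) / 2 ^ m"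
    by (simp add: iterated_log_def z_def n_def diff_divide_distrib)
  ultimately show ?thesis
    by (simp add: M_def abs_divide divide_right_mono)
qed

definition log_bound :: "real^2 \<Rightarrow> real^2 \<Rightarrow> real" where
  "log_bound x y = 3 * ln 2 + \<bar>ln \<bar>(norm y)\<^sup>2 - (norm x)\<^sup>2\<bar>\<bar> + 2 * \<bar>ln (max (norm x) (norm y))\<bar>"

lemma disc_radial:
  fixes \<phi> :: "real \<Rightarrow> real"
  assumes [measurable]: "\<phi> \<in> borel_measurable borel" and R: "0 \<le> R"
  shows "set_integrable lborel (cball (0::real^2) R) (\<lambda>y. \<phi> ((norm y)\<^sup>2)) \<longleftrightarrow> set_integrable lborel {0..R\<^sup>2} \<phi>"
    and "(LINT y:cball (0::real^2) R|lborel. \<phi> ((norm y)\<^sup>2)) = pi * (LINT s:{0..R\<^sup>2}|lborel. \<phi> s)"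
proof -
  have e: "indicator (cball 0 R) y *\<^sub>R \<phi> ((norm y)\<^sup>2) = (\<lambda>s. indicator {0..R\<^sup>2} s * \<phi> s) ((norm y)\<^sup>2)" for y :: "real^2"
    using R by (auto split: split_indicator simp: abs_le_square_iff[symmetric])
  have e2: "indicator {0..} s * (indicator {0..R\<^sup>2} s * \<phi> s) = indicator {0..R\<^sup>2} s * \<phi> s" for s
    by (auto split: split_indicator)
  show "set_integrable lborel (cball (0::real^2) R) (\<lambda>y. \<phi> ((norm y)\<^sup>2)) \<longleftrightarrow> set_integrable lborel {0..R\<^sup>2} \<phi>"
    unfolding set_integrable_def e
    by (subst integrable_radial_iff) (auto simp: set_integrable_def e2)
  show "(LINT y:cball (0::real^2) R|lborel. \<phi> ((norm y)\<^sup>2)) = pi * (LINT s:{0..R\<^sup>2}|lborel. \<phi> s)"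
    unfolding set_lebesgue_integral_def e
    by (subst integral_radial) (auto simp: set_lebesgue_integral_def e2)
qed

lemma ln_max_norm: "ln (max (norm x) (norm (y::real^2))) = ln (max ((norm x)\<^sup>2) ((norm y)\<^sup>2)) / 2"
proof -
  have "max ((norm x)\<^sup>2) ((norm y)\<^sup>2) = (max (norm x) (norm y))\<^sup>2"
    by (auto simp: max_def abs_le_square_iff[symmetric])
  then show ?thesis by (cases "max (norm x) (norm y) = 0") (auto simp: ln_realpow max_def)
qed

lemma
  assumes R: "0 \<le> R"
  shows integrable_disc_ln_max: "set_integrable lborel (cball 0 R) (\<lambda>y::real^2. ln (max (norm x) (norm y)))"
    and integral_disc_ln_max: "(LINT y:cball 0 R|lborel. ln (max (norm x) (norm (y::real^2))))
      = pi / 2 * (if R\<^sup>2 \<le> (norm x)\<^sup>2 then R\<^sup>2 * ln ((norm x)\<^sup>2) else R\<^sup>2 * ln (R\<^sup>2) - R\<^sup>2 + (norm x)\<^sup>2)"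
  unfolding ln_max_norm
  using disc_radial[of "\<lambda>s. ln (max ((norm x)\<^sup>2) s) / 2" R] R
    set_integrable_ln_max[of "(norm x)\<^sup>2" "R\<^sup>2"] set_integral_ln_max[of "(norm x)\<^sup>2" "R\<^sup>2"]
  by auto

lemma integrable_log_bound:
  assumes R: "0 \<le> R"
  shows "set_integrable lborel (cball 0 R) (log_bound x)"
proof -
  have "set_integrable lborel {0..R\<^sup>2} (\<lambda>s. \<bar>ln \<bar>s - (norm x)\<^sup>2\<bar>\<bar>)"
    using set_integrable_abs[OF set_integrable_ln_abs] by blast
  then have "set_integrable lborel (cball 0 R) (\<lambda>y::real^2. \<bar>ln \<bar>(norm y)\<^sup>2 - (norm x)\<^sup>2\<bar>\<bar>)"
    using disc_radial(1)[of "\<lambda>s. \<bar>ln \<bar>s - (norm x)\<^sup>2\<bar>\<bar>" R] R by simp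
  moreover have "set_integrable lborel (cball (0::real^2) R) (\<lambda>_. 3 * ln 2 :: real)"
    unfolding set_integrable_def by (intro integrable_scaleR_left integrable_real_indicator) (auto simp: emeasure_cball R)
  moreover have "set_integrable lborel (cball 0 R) (\<lambda>y::real^2. 2 * \<bar>ln (max (norm x) (norm y))\<bar>)"
    using set_integrable_abs[OF integrable_disc_ln_max[OF R, of x]] by simp
  ultimately show ?thesis
    unfolding log_bound_def[abs_def] by (intro set_integral_add(1))
qed

text \<open>Newton's theorem in the plane. Averaging over rotations leaves the integral over the
  disc unchanged, while the averaged integrand converges to \<open>ln (max (norm x) (norm y))\<close> at
  the rate \<open>2 ^ (- m)\<close> with the integrable constant \<open>log_bound\<close>.\<close>
lemma
  assumes R: "0 \<le> R"
  shows integrable_disc_ln: "set_integrable lborel (cball 0 R) (\<lambda>y::real^2. ln (norm (x - y)))"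
    and integral_disc_ln: "(LINT y:cball 0 R|lborel. ln (norm (x - y)))
      = (LINT y:cball 0 R|lborel. ln (max (norm x) (norm (y::real^2))))"
proof -
  let ?D = "cball (0::real^2) R"
  define M where "M y = ln (max (norm x) (norm y))" for y :: "real^2"
  have [measurable]: "M \<in> borel_measurable borel" unfolding M_def by measurable
  have ae: "AE y in lborel. norm (y::real^2) \<noteq> norm x"
    by (rule AE_I'[OF sphere_null[of "norm x"]]) auto
  note iM = integrable_disc_ln_max[OF R, of x, folded M_def]
  note iB = integrable_log_bound[OF R, of x]
  have bd: "AE y in lborel. \<bar>iterated_log x m y - M y\<bar> \<le> log_bound x y / 2 ^ m" for m
    using ae by eventually_elim (use iterated_log_near_max in \<open>auto simp: M_def log_bound_def\<close>)
  have iD: "set_integrable lborel ?D (\<lambda>y. iterated_log x m y - M y)" for m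
  proof -
    have "integrable lborel (\<lambda>y. indicator ?D y *\<^sub>R log_bound x y / 2 ^ m)"
      using iB by (simp add: set_integrable_def)
    then show ?thesis
      unfolding set_integrable_def
      by (rule Bochner_Integration.integrable_bound)
         (use bd[of m] in \<open>auto split: split_indicator simp: abs_divide elim!: eventually_mono intro: order_trans[OF _ divide_right_mono[OF abs_ge_self]]\<close>)
  qed
  have iK: "set_integrable lborel ?D (iterated_log x m)" for m
    using set_integral_add(1)[OF iD[of m] iM] by simp
  \<comment> \<open>by rotation invariance the two summands of the recursion have the same integral\<close>
  have step: "(LINT y:?D|lborel. iterated_log x (Suc m) y) = (LINT y:?D|lborel. iterated_log x m y)" for m
  proof -
    have "(LINT y:?D|lborel. iterated_log x (Suc m) y)
      = (LINT y:?D|lborel. (iterated_log x m y + iterated_log x m (rot (pi / 2 ^ m) y)) / 2)"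
      unfolding set_lebesgue_integral_def
      by (rule integral_cong_AE) (use ae in \<open>auto simp: iterated_log_Suc elim!: eventually_mono\<close>)
    also have "\<dots> = ((LINT y:?D|lborel. iterated_log x m y) + (LINT y:?D|lborel. iterated_log x m (rot (pi / 2 ^ m) y))) / 2"
      by (simp add: set_integral_add(2)[OF iK integrable_disc_rot[OF _ iK]])
    finally show ?thesis by (simp add: integral_disc_rot)
  qed
  have const: "(LINT y:?D|lborel. iterated_log x m y) = (LINT y:?D|lborel. iterated_log x 0 y)" for m
    by (induction m) (simp_all add: step)
  have "\<bar>(LINT y:?D|lborel. iterated_log x 0 y) - (LINT y:?D|lborel. M y)\<bar> \<le> (LINT y:?D|lborel. log_bound x y) / 2 ^ m" for m
  proof -
    have "(LINT y:?D|lborel. iterated_log x 0 y) - (LINT y:?D|lborel. M y) = (LINT y:?D|lborel. iterated_log x m y - M y)"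
      using set_integral_diff(2)[OF iK[of m] iM] const[of m] by simp
    also have "\<bar>\<dots>\<bar> \<le> (LINT y:?D|lborel. \<bar>iterated_log x m y - M y\<bar>)"
      using integral_abs_bound[of lborel "\<lambda>y. indicator ?D y *\<^sub>R (iterated_log x m y - M y)"]
      by (simp add: set_lebesgue_integral_def abs_mult)
    also have "\<dots> \<le> (LINT y:?D|lborel. log_bound x y / 2 ^ m)"
      unfolding set_lebesgue_integral_def
    proof (rule integral_mono_AE)
      show "integrable lborel (\<lambda>y. indicator ?D y *\<^sub>R \<bar>iterated_log x m y - M y\<bar>)"
        using set_integrable_abs[OF iD] by (simp add: set_integrable_def)
      show "integrable lborel (\<lambda>y. indicator ?D y *\<^sub>R (log_bound x y / 2 ^ m))"
        using iB by (simp add: set_integrable_def)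
      show "AE y in lborel. indicator ?D y *\<^sub>R \<bar>iterated_log x m y - M y\<bar> \<le> indicator ?D y *\<^sub>R (log_bound x y / 2 ^ m)"
        using bd[of m] by eventually_elim (auto split: split_indicator)
    qed
    finally show ?thesis by simp
  qed
  note close = this
  have lim: "(\<lambda>m. (LINT y:?D|lborel. log_bound x y) / 2 ^ m) \<longlonglongrightarrow> 0"
    by (rule LIMSEQ_divide_realpow_zero) simp
  have "\<bar>(LINT y:?D|lborel. iterated_log x 0 y) - (LINT y:?D|lborel. M y)\<bar> \<le> 0"
    by (rule LIMSEQ_le_const[OF lim]) (use close in blast)
  then have "(LINT y:?D|lborel. iterated_log x 0 y) = (LINT y:?D|lborel. M y)" by simp
  moreover have "iterated_log x 0 = (\<lambda>y. ln (norm (x - y)))"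
    by (simp add: fun_eq_iff iterated_log_def cpx_diff[symmetric] cmod_cpx)
  ultimately show "(LINT y:?D|lborel. ln (norm (x - y))) = (LINT y:?D|lborel. ln (max (norm x) (norm y)))"
    "set_integrable lborel ?D (\<lambda>y. ln (norm (x - y)))"
    using iK[of 0] by (simp_all add: M_def)
qed

lemma
  assumes R: "0 < R"
  shows integrable_cball_ln: "set_integrable lborel (cball z R) (\<lambda>y::real^2. ln (norm (y - x)))"
    and integral_cball_ln: "(LINT y:cball z R|lborel. ln (norm (y - x)))
      = pi * R\<^sup>2 * (if R \<le> norm (x - z) then ln (norm (x - z))
                 else ln R - 1/2 + (norm (x - z))\<^sup>2 / (2 * R\<^sup>2))"
proof -
  define G where "G y = indicator (cball z R) y *\<^sub>R ln (norm (y - x))" for y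
  have [measurable]: "G \<in> borel_measurable borel" unfolding G_def by measurable
  have e: "G (z + y) = indicator (cball 0 R) y *\<^sub>R ln (norm ((x - z) - y))" for y
  proof -
    have "norm (z + y - x) = norm (x - z - y)" by (metis diff_diff_eq norm_minus_commute)
    then show ?thesis by (auto simp: G_def dist_norm split: split_indicator)
  qed
  have tr: "lborel = distr lborel borel (\<lambda>y. z + y)" by (rule lborel_distr_plus[symmetric])
  show "set_integrable lborel (cball z R) (\<lambda>y::real^2. ln (norm (y - x)))"
    using integrable_distr_eq[of "\<lambda>y. z + y" lborel borel G] integrable_disc_ln[of R "x - z"] R
    unfolding set_integrable_def G_def[symmetric] e[symmetric] tr[symmetric] by simp
  have "(LINT y:cball z R|lborel. ln (norm (y - x))) = (LINT y:cball 0 R|lborel. ln (norm ((x - z) - y)))"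
    using integral_distr[of "\<lambda>y. z + y" lborel borel G]
    unfolding set_lebesgue_integral_def G_def[symmetric] e[symmetric] tr[symmetric] by simp
  also have "\<dots> = pi / 2 * (if R\<^sup>2 \<le> (norm (x - z))\<^sup>2 then R\<^sup>2 * ln ((norm (x - z))\<^sup>2) else R\<^sup>2 * ln (R\<^sup>2) - R\<^sup>2 + (norm (x - z))\<^sup>2)"
    using R by (simp add: integral_disc_ln integral_disc_ln_max)
  also have "\<dots> = pi * R\<^sup>2 * (if R \<le> norm (x - z) then ln (norm (x - z))
                 else ln R - 1/2 + (norm (x - z))\<^sup>2 / (2 * R\<^sup>2))"
  proof -
    have "R\<^sup>2 \<le> (norm (x - z))\<^sup>2 \<longleftrightarrow> R \<le> norm (x - z)" using R by (simp add: abs_le_square_iff[symmetric])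
    moreover have "ln ((norm (x - z))\<^sup>2) = 2 * ln (norm (x - z))" if "R \<le> norm (x - z)" using that R by (simp add: ln_realpow)
    ultimately show ?thesis using R by (simp add: ln_realpow field_simps)
  qed
  finally show "(LINT y:cball z R|lborel. ln (norm (y - x)))
      = pi * R\<^sup>2 * (if R \<le> norm (x - z) then ln (norm (x - z))
                 else ln R - 1/2 + (norm (x - z))\<^sup>2 / (2 * R\<^sup>2))" .
qed

section \<open>Conditional negativity of the logarithmic kernel\<close>

text \<open>Every power of the inner product is, by the binomial theorem, a positive combination
  of products of a function of \<open>p i\<close> with the same function of \<open>p j\<close>, so it contributes a
  sum of squares; the exponential series combines the powers with nonnegative coefficients.\<close>
lemma exp_kernel_psd:
  fixes b :: "'i \<Rightarrow> real" and p :: "'i \<Rightarrow> real^2"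
  assumes "finite I" "0 \<le> t"
  shows "0 \<le> (\<Sum>i\<in>I. \<Sum>j\<in>I. b i * b j * exp (t * (p i \<bullet> p j)))"
proof -
  have pw: "0 \<le> (\<Sum>i\<in>I. \<Sum>j\<in>I. b i * b j * (p i \<bullet> p j) ^ k)" for k
  proof -
    have "(p i \<bullet> p j) ^ k = (\<Sum>a\<le>k. real (k choose a) * (p i $ 1 ^ a * p i $ 2 ^ (k - a)) * (p j $ 1 ^ a * p j $ 2 ^ (k - a)))" for i j
      by (simp add: inner_vec_def sum_2 binomial_ring power_mult_distrib mult_ac)
    then have "(\<Sum>i\<in>I. \<Sum>j\<in>I. b i * b j * (p i \<bullet> p j) ^ k)
        = (\<Sum>i\<in>I. \<Sum>j\<in>I. \<Sum>a\<le>k. real (k choose a) * ((b i * (p i $ 1 ^ a * p i $ 2 ^ (k - a))) * (b j * (p j $ 1 ^ a * p j $ 2 ^ (k - a)))))"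
      by (simp add: sum_distrib_left mult_ac)
    also have "\<dots> = (\<Sum>i\<in>I. \<Sum>a\<le>k. \<Sum>j\<in>I. real (k choose a) * ((b i * (p i $ 1 ^ a * p i $ 2 ^ (k - a))) * (b j * (p j $ 1 ^ a * p j $ 2 ^ (k - a)))))"
      by (intro sum.cong refl sum.swap)
    also have "\<dots> = (\<Sum>a\<le>k. \<Sum>i\<in>I. \<Sum>j\<in>I. real (k choose a) * ((b i * (p i $ 1 ^ a * p i $ 2 ^ (k - a))) * (b j * (p j $ 1 ^ a * p j $ 2 ^ (k - a)))))"
      by (rule sum.swap)
    also have "\<dots> = (\<Sum>a\<le>k. real (k choose a) * (\<Sum>i\<in>I. b i * (p i $ 1 ^ a * p i $ 2 ^ (k - a)))\<^sup>2)"
      unfolding power2_eq_square sum_product by (simp add: sum_distrib_left)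
    also have "\<dots> \<ge> 0" by (intro sum_nonneg mult_nonneg_nonneg) auto
    finally show ?thesis .
  qed
  have e: "(\<lambda>k. (t * x) ^ k /\<^sub>R fact k) sums exp (t * x)" for x :: real
    by (rule exp_converges)
  have "(\<lambda>k. \<Sum>i\<in>I. \<Sum>j\<in>I. b i * b j * ((t * (p i \<bullet> p j)) ^ k /\<^sub>R fact k)) sums
      (\<Sum>i\<in>I. \<Sum>j\<in>I. b i * b j * exp (t * (p i \<bullet> p j)))"
    by (intro sums_sum sums_mult e)
  moreover have "0 \<le> (\<Sum>i\<in>I. \<Sum>j\<in>I. b i * b j * ((t * (p i \<bullet> p j)) ^ k /\<^sub>R fact k))" for k
  proof -
    have "(\<Sum>i\<in>I. \<Sum>j\<in>I. b i * b j * ((t * (p i \<bullet> p j)) ^ k /\<^sub>R fact k))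
      = t ^ k / fact k * (\<Sum>i\<in>I. \<Sum>j\<in>I. b i * b j * (p i \<bullet> p j) ^ k)"
      by (simp add: sum_distrib_left power_mult_distrib divide_inverse mult_ac)
    then show ?thesis using pw[of k] assms by (simp add: zero_le_mult_iff)
  qed
  ultimately show ?thesis by (metis (no_types, lifting) sums_le sums_zero)
qed

text \<open>The factors \<open>exp (- t * (norm (p i))\<^sup>2)\<close> can be absorbed into the coefficients, which
  leaves the exponential kernel.\<close>
lemma gauss_kernel_psd:
  fixes c :: "'i \<Rightarrow> real" and p :: "'i \<Rightarrow> real^2"
  assumes "finite I" "0 \<le> t"
  shows "0 \<le> (\<Sum>i\<in>I. \<Sum>j\<in>I. c i * c j * exp (- (t * (norm (p i - p j))\<^sup>2)))"
proof -
  have "exp (- (t * (norm (p i - p j))\<^sup>2))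
      = exp (- (t * (norm (p i))\<^sup>2)) * exp (- (t * (norm (p j))\<^sup>2)) * exp ((2 * t) * (p i \<bullet> p j))" for i j
    by (simp add: mult_exp_exp power2_norm_eq_inner inner_diff_left inner_diff_right inner_commute algebra_simps)
  then have "(\<Sum>i\<in>I. \<Sum>j\<in>I. c i * c j * exp (- (t * (norm (p i - p j))\<^sup>2)))
    = (\<Sum>i\<in>I. \<Sum>j\<in>I. (c i * exp (- (t * (norm (p i))\<^sup>2))) * (c j * exp (- (t * (norm (p j))\<^sup>2))) * exp ((2 * t) * (p i \<bullet> p j)))"
    by (simp add: mult_ac)
  also have "\<dots> \<ge> 0"
    by (rule exp_kernel_psd) (use assms in auto)
  finally show ?thesis .
qed

text \<open>As \<open>1 / (B + d)\<close> is the integral of \<open>exp (- t * (B + d))\<close> over \<open>t \<ge> 0\<close>, this kernel is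
  a mixture of Gaussian ones.\<close>
lemma cauchy_kernel_psd:
  fixes c :: "'i \<Rightarrow> real" and p :: "'i \<Rightarrow> real^2"
  assumes "finite I" "0 < B"
  shows "0 \<le> (\<Sum>i\<in>I. \<Sum>j\<in>I. c i * c j / (B + (norm (p i - p j))\<^sup>2))"
proof -
  have "((\<lambda>t. exp (- (B + d\<^sup>2) * t)) has_integral 1 / (B + d\<^sup>2)) {0..}" for d :: real
    using has_integral_exp_minus_to_infinity[of "B + d\<^sup>2" 0] assms by (simp add: add_pos_nonneg)
  then have "((\<lambda>t. \<Sum>i\<in>I. \<Sum>j\<in>I. c i * c j * exp (- (B + (norm (p i - p j))\<^sup>2) * t)) has_integral
      (\<Sum>i\<in>I. \<Sum>j\<in>I. c i * c j * (1 / (B + (norm (p i - p j))\<^sup>2)))) {0..}"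
    by (intro has_integral_sum has_integral_mult_right assms)
  then have "0 \<le> (\<Sum>i\<in>I. \<Sum>j\<in>I. c i * c j * (1 / (B + (norm (p i - p j))\<^sup>2)))"
  proof (rule has_integral_nonneg)
    fix t :: real assume t: "t \<in> {0..}"
    have "(\<Sum>i\<in>I. \<Sum>j\<in>I. c i * c j * exp (- (B + (norm (p i - p j))\<^sup>2) * t))
      = exp (- (B * t)) * (\<Sum>i\<in>I. \<Sum>j\<in>I. c i * c j * exp (- (t * (norm (p i - p j))\<^sup>2)))"
      by (simp add: sum_distrib_left mult_exp_exp algebra_simps)
    also have "\<dots> \<ge> 0"
      using t gauss_kernel_psd[OF assms(1), of t c p] by simp
    finally show "0 \<le> (\<Sum>i\<in>I. \<Sum>j\<in>I. c i * c j * exp (- (B + (norm (p i - p j))\<^sup>2) * t))" .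
  qed
  then show ?thesis by simp
qed

text \<open>The derivative in \<open>B\<close> is the quadratic form of the preceding kernel, so the sum
  increases with \<open>B\<close>. Neutrality allows \<open>ln B\<close> to be subtracted from every term, after which
  the sum tends to \<open>0\<close> as \<open>B\<close> grows; hence it is nonpositive.\<close>
lemma log_kernel_cnd:
  fixes c :: "'i \<Rightarrow> real" and p :: "'i \<Rightarrow> real^2"
  assumes fin: "finite I" and neutral: "(\<Sum>i\<in>I. c i) = 0" and B: "0 < B"
  shows "(\<Sum>i\<in>I. \<Sum>j\<in>I. c i * c j * ln (B + (norm (p i - p j))\<^sup>2)) \<le> 0"
proof -
  define g where "g T = (\<Sum>i\<in>I. \<Sum>j\<in>I. c i * c j * ln (T + (norm (p i - p j))\<^sup>2))" for T
  have "g B \<le> g T" if "B \<le> T" for T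
  proof (rule DERIV_nonneg_imp_nondecreasing[OF that])
    fix x assume x: "B \<le> x" "x \<le> T"
    have "0 < x + (norm (p i - p j))\<^sup>2" for i j
      using x B by (simp add: add_pos_nonneg)
    then have "(g has_real_derivative (\<Sum>i\<in>I. \<Sum>j\<in>I. c i * c j * (1 / (x + (norm (p i - p j))\<^sup>2)))) (at x)"
      unfolding g_def by (intro DERIV_sum DERIV_cmult) (auto intro!: derivative_eq_intros)
    moreover have "0 \<le> (\<Sum>i\<in>I. \<Sum>j\<in>I. c i * c j * (1 / (x + (norm (p i - p j))\<^sup>2)))"
      using cauchy_kernel_psd[OF fin, of x c p] x B by simp
    ultimately show "\<exists>y. (g has_real_derivative y) (at x) \<and> 0 \<le> y" by blast
  qed
  moreover have "(g \<longlongrightarrow> 0) at_top"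
  proof -
    have lim: "((\<lambda>T. ln (1 + d / T)) \<longlongrightarrow> 0) at_top" for d :: real
    proof -
      have "((\<lambda>T. d / T) \<longlongrightarrow> 0) at_top"
        by (rule tendsto_divide_0[OF tendsto_const filterlim_at_top_imp_at_infinity[OF filterlim_ident]])
      then have "((\<lambda>T. ln (1 + d / T)) \<longlongrightarrow> ln (1 + 0)) at_top"
        by (intro tendsto_ln tendsto_add tendsto_const) auto
      then show ?thesis by simp
    qed
    have "((\<lambda>T. \<Sum>i\<in>I. \<Sum>j\<in>I. c i * c j * ln (1 + (norm (p i - p j))\<^sup>2 / T)) \<longlongrightarrow> (\<Sum>i\<in>I. \<Sum>j\<in>I. c i * c j * 0)) at_top"
      by (intro tendsto_sum tendsto_mult tendsto_const lim)
    moreover have "\<forall>\<^sub>F T in at_top. (\<Sum>i\<in>I. \<Sum>j\<in>I. c i * c j * ln (1 + (norm (p i - p j))\<^sup>2 / T)) = g T"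
      using eventually_gt_at_top[of 0]
    proof eventually_elim
      case (elim T)
      have "ln (1 + d\<^sup>2 / T) = ln (T + d\<^sup>2) - ln T" for d :: real
      proof -
        have "1 + d\<^sup>2 / T = (T + d\<^sup>2) / T" using elim by (simp add: field_simps)
        moreover have "T + d\<^sup>2 > 0" using elim by (rule add_pos_nonneg) simp
        ultimately show ?thesis using elim by (simp add: ln_div)
      qed
      then have "(\<Sum>i\<in>I. \<Sum>j\<in>I. c i * c j * ln (1 + (norm (p i - p j))\<^sup>2 / T))
        = g T - ln T * ((\<Sum>i\<in>I. c i) * (\<Sum>i\<in>I. c i))"
        unfolding g_def by (simp add: right_diff_distrib sum_subtractf sum_product sum_distrib_left mult_ac)
      then show ?case by (simp add: neutral)
    qed
    ultimately show ?thesis by (simp add: tendsto_cong)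
  qed
  ultimately have "g B \<le> 0"
    by (intro tendsto_lowerbound[of g 0 at_top]) (auto simp: eventually_at_top_linorder)
  then show ?thesis by (simp add: g_def)
qed

text \<open>The points \<open>x i\<close> carry the charge \<open>1\<close> and the points \<open>y i\<close> the charge \<open>-1\<close>.\<close>
lemma log_kernel_two_families:
  fixes x y :: "nat \<Rightarrow> real^2"
  assumes "0 < B"
  defines "L \<equiv> \<lambda>v::real^2. ln (B + (norm v)\<^sup>2) / 2"
  shows "(\<Sum>i<n. \<Sum>j<n. L (x i - x j)) + (\<Sum>i<n. \<Sum>j<n. L (y i - y j))
      \<le> 2 * (\<Sum>i<n. \<Sum>j<n. L (x i - y j))"
proof -
  define I where "I = (UNIV :: bool set) \<times> {..<n}"
  define c :: "bool \<times> nat \<Rightarrow> real" where "c = (\<lambda>(s, i). if s then 1 else -1)"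
  define p :: "bool \<times> nat \<Rightarrow> real^2" where "p = (\<lambda>(s, i). if s then x i else y i)"
  have I: "(\<Sum>a\<in>I. f a) = (\<Sum>i<n. f (True, i)) + (\<Sum>i<n. f (False, i))" for f :: "bool \<times> nat \<Rightarrow> real"
    unfolding I_def by (subst sum.cartesian_product[symmetric, where g="\<lambda>s i. f (s, i)", simplified]) (simp add: UNIV_bool add.commute)
  have "(\<Sum>a\<in>I. \<Sum>b\<in>I. c a * c b * ln (B + (norm (p a - p b))\<^sup>2)) \<le> 0"
    by (rule log_kernel_cnd) (auto simp: I assms, auto simp: I_def c_def)
  then have "(\<Sum>i<n. \<Sum>j<n. ln (B + (norm (x i - x j))\<^sup>2)) - (\<Sum>i<n. \<Sum>j<n. ln (B + (norm (x i - y j))\<^sup>2))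
     - (\<Sum>i<n. \<Sum>j<n. ln (B + (norm (y i - x j))\<^sup>2)) + (\<Sum>i<n. \<Sum>j<n. ln (B + (norm (y i - y j))\<^sup>2)) \<le> 0"
    by (simp add: I c_def p_def sum.distrib sum_negf sum_subtractf algebra_simps)
  moreover have "(\<Sum>i<n. \<Sum>j<n. ln (B + (norm (y i - x j))\<^sup>2)) = (\<Sum>i<n. \<Sum>j<n. ln (B + (norm (x i - y j))\<^sup>2))"
    by (subst sum.swap) (simp add: norm_minus_commute)
  ultimately show ?thesis
    unfolding L_def by (simp add: sum_divide_distrib[symmetric])
qed

section \<open>Adding, removing, relabelling and rescaling particles\<close>

definition pair_energy :: "nat set \<Rightarrow> (nat \<Rightarrow> real^2) \<Rightarrow> real" where
  "pair_energy I X = 1/2 * (\<Sum>i\<in>I. \<Sum>j\<in>I - {i}. - ln (norm (X i - X j)))"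

text \<open>The strength \<open>a\<close> of the confinement is kept apart from the number of particles, and
  the index set is arbitrary: adding or removing a particle changes the number but leaves
  the confinement as it was, and the removed index can be any.\<close>
definition gas_energy :: "real \<Rightarrow> nat set \<Rightarrow> (nat \<Rightarrow> real^2) \<Rightarrow> real" where
  "gas_energy a I X = pair_energy I X + a * (\<Sum>i\<in>I. (norm (X i))\<^sup>2 / 2)"

definition added_energy :: "real \<Rightarrow> nat set \<Rightarrow> (nat \<Rightarrow> real^2) \<Rightarrow> real^2 \<Rightarrow> real" where
  "added_energy a I X x = (\<Sum>j\<in>I. - ln (norm (x - X j))) + a * ((norm x)\<^sup>2 / 2)"

abbreviation configs :: "nat set \<Rightarrow> (nat \<Rightarrow> real^2) measure" where
  "configs I \<equiv> \<Pi>\<^sub>M i\<in>I. lborel"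

definition gas_partition :: "real \<Rightarrow> real \<Rightarrow> nat set \<Rightarrow> ennreal" where
  "gas_partition \<beta> a I = (\<integral>\<^sup>+X. ennreal (exp (- \<beta> * gas_energy a I X)) \<partial>configs I)"

lemma energy_eq_gas_energy: "energy N X = gas_energy (real N) {..<N} X"
  by (simp add: energy_def gas_energy_def pair_energy_def)

lemma partition_fun_eq: "partition_fun \<beta> N = gas_partition \<beta> (real N) {..<N}"
  by (simp add: partition_fun_def gas_partition_def energy_eq_gas_energy config_measure_def)

lemma component_measurable:
  "i \<in> I \<Longrightarrow> (\<lambda>X. X i) \<in> borel_measurable (configs I)"
  using measurable_component_singleton[of i I "\<lambda>_. lborel"] by simp

lemma pair_energy_measurable [measurable]: "pair_energy I \<in> borel_measurable (configs I)"
  unfolding pair_energy_def[abs_def]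
  by (intro borel_measurable_times borel_measurable_sum borel_measurable_const borel_measurable_uminus
      borel_measurable_ln borel_measurable_norm borel_measurable_diff component_measurable) auto

lemma moment_measurable [measurable]: "(\<lambda>X. \<Sum>i\<in>I. (norm (X i))\<^sup>2 / 2) \<in> borel_measurable (configs I)"
  by (intro borel_measurable_sum borel_measurable_divide borel_measurable_power borel_measurable_norm
      component_measurable borel_measurable_const) auto

lemma gas_energy_measurable [measurable]: "gas_energy a I \<in> borel_measurable (configs I)"
  unfolding gas_energy_def[abs_def] by measurable

lemma added_energy_measurable [measurable]: "added_energy a I X \<in> borel_measurable borel"
  unfolding added_energy_def[abs_def] by measurable

lemma gas_energy_insert:
  assumes I: "finite I" "i \<notin> I"
  shows "gas_energy a (insert i I) X = gas_energy a I X + added_energy a I X (X i)"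
proof -
  have 1: "insert i I - {i} = I" using I by auto
  have 2: "(\<Sum>j\<in>insert i I - {k}. - ln (norm (X k - X j))) = - ln (norm (X i - X k)) + (\<Sum>j\<in>I - {k}. - ln (norm (X k - X j)))"
    if "k \<in> I" for k
  proof -
    have "insert i I - {k} = insert i (I - {k})" using I that by auto
    then show ?thesis using I by (simp add: norm_minus_commute)
  qed
  have "(\<Sum>k\<in>insert i I. \<Sum>j\<in>insert i I - {k}. - ln (norm (X k - X j)))
    = (\<Sum>j\<in>I. - ln (norm (X i - X j))) + (\<Sum>k\<in>I. - ln (norm (X i - X k)) + (\<Sum>j\<in>I - {k}. - ln (norm (X k - X j))))"
    using I by (simp add: 1 2 cong: sum.cong)
  also have "\<dots> = 2 * (\<Sum>j\<in>I. - ln (norm (X i - X j))) + (\<Sum>k\<in>I. \<Sum>j\<in>I - {k}. - ln (norm (X k - X j)))"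
    unfolding sum.distrib by simp
  finally have "pair_energy (insert i I) X = pair_energy I X + (\<Sum>j\<in>I. - ln (norm (X i - X j)))"
    unfolding pair_energy_def by simp
  then show ?thesis
    using I by (simp add: gas_energy_def added_energy_def distrib_left)
qed

lemma gas_energy_cong: "(\<And>i. i \<in> I \<Longrightarrow> X i = Y i) \<Longrightarrow> gas_energy a I X = gas_energy a I Y"
  unfolding gas_energy_def pair_energy_def by (auto intro!: sum.cong arg_cong2[where f="(+)"])

lemma added_energy_cong: "(\<And>i. i \<in> I \<Longrightarrow> X i = Y i) \<Longrightarrow> added_energy a I X x = added_energy a I Y x"
  unfolding added_energy_def by (auto intro!: sum.cong)

lemma added_energy_pair_measurable:
  assumes "finite I"
  shows "(\<lambda>X. added_energy a I X (X i)) \<in> borel_measurable (configs (insert i I))"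
  unfolding added_energy_def
  by (intro borel_measurable_times borel_measurable_add borel_measurable_sum borel_measurable_const borel_measurable_uminus
      borel_measurable_ln borel_measurable_norm borel_measurable_diff component_measurable
      borel_measurable_divide borel_measurable_power) auto

lemma configs_nn_integral_insert:
  assumes "finite I" "i \<notin> I" "f \<in> borel_measurable (configs (insert i I))"
  shows "(\<integral>\<^sup>+X. f X \<partial>configs (insert i I)) = (\<integral>\<^sup>+X. (\<integral>\<^sup>+x. f (X(i := x)) \<partial>lborel) \<partial>configs I)"
proof -
  interpret product_sigma_finite "\<lambda>_::nat. lborel :: (real^2) measure" ..
  show ?thesis by (rule product_nn_integral_insert[OF assms])
qed

lemma gas_partition_insert:
  assumes I: "finite I" "i \<notin> I"
  shows "gas_partition \<beta> a (insert i I)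
    = (\<integral>\<^sup>+X. ennreal (exp (- \<beta> * gas_energy a I X)) * (\<integral>\<^sup>+x. ennreal (exp (- \<beta> * added_energy a I X x)) \<partial>lborel) \<partial>configs I)"
proof -
  have "gas_partition \<beta> a (insert i I) = (\<integral>\<^sup>+X. (\<integral>\<^sup>+x. ennreal (exp (- \<beta> * gas_energy a (insert i I) (X(i := x)))) \<partial>lborel) \<partial>configs I)"
    unfolding gas_partition_def by (rule configs_nn_integral_insert[OF I]) measurable
  also have "\<dots> = (\<integral>\<^sup>+X. (\<integral>\<^sup>+x. ennreal (exp (- \<beta> * gas_energy a I X)) * ennreal (exp (- \<beta> * added_energy a I X x)) \<partial>lborel) \<partial>configs I)"
  proof (intro nn_integral_cong)
    fix X :: "nat \<Rightarrow> real^2" and x :: "real^2"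
    have "gas_energy a I (X(i := x)) = gas_energy a I X" using I by (intro gas_energy_cong) auto
    moreover have "added_energy a I (X(i := x)) x = added_energy a I X x" using I by (intro added_energy_cong) auto
    ultimately show "ennreal (exp (- \<beta> * gas_energy a (insert i I) (X(i := x))))
       = ennreal (exp (- \<beta> * gas_energy a I X)) * ennreal (exp (- \<beta> * added_energy a I X x))"
      by (simp add: gas_energy_insert[OF I] ennreal_mult[symmetric] mult_exp_exp distrib_left)
  qed
  also have "\<dots> = (\<integral>\<^sup>+X. ennreal (exp (- \<beta> * gas_energy a I X)) * (\<integral>\<^sup>+x. ennreal (exp (- \<beta> * added_energy a I X x)) \<partial>lborel) \<partial>configs I)"
    by (intro nn_integral_cong nn_integral_cmult) measurable
  finally show ?thesis .
qed

text \<open>The weight \<open>exp (\<beta> * added_energy)\<close> cancels the Boltzmann factor of the particle \<open>i\<close>,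
  whose position then becomes independent of the others.\<close>
lemma gas_partition_remove:
  assumes I: "finite I" "i \<notin> I" and g [measurable]: "g \<in> borel_measurable borel"
  shows "(\<integral>\<^sup>+X. ennreal (exp (- \<beta> * gas_energy a (insert i I) X)) * (ennreal (exp (\<beta> * added_energy a I X (X i))) * g (X i)) \<partial>configs (insert i I))
    = (\<integral>\<^sup>+x. g x \<partial>lborel) * gas_partition \<beta> a I"
proof -
  note [measurable] = added_energy_pair_measurable[OF I(1), of a i]
  have [measurable]: "(\<lambda>X. X i) \<in> borel_measurable (configs (insert i I))" by (rule component_measurable) simp
  have "(\<integral>\<^sup>+X. ennreal (exp (- \<beta> * gas_energy a (insert i I) X)) * (ennreal (exp (\<beta> * added_energy a I X (X i))) * g (X i)) \<partial>configs (insert i I))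
    = (\<integral>\<^sup>+X. (\<integral>\<^sup>+x. ennreal (exp (- \<beta> * gas_energy a (insert i I) (X(i := x)))) * (ennreal (exp (\<beta> * added_energy a I (X(i := x)) ((X(i := x)) i))) * g ((X(i := x)) i)) \<partial>lborel) \<partial>configs I)"
    by (rule configs_nn_integral_insert[OF I]) measurable
  also have "\<dots> = (\<integral>\<^sup>+X. (\<integral>\<^sup>+x. ennreal (exp (- \<beta> * gas_energy a I X)) * g x \<partial>lborel) \<partial>configs I)"
  proof (intro nn_integral_cong)
    fix X :: "nat \<Rightarrow> real^2" and x :: "real^2"
    have "gas_energy a I (X(i := x)) = gas_energy a I X" using I by (intro gas_energy_cong) auto
    moreover have "added_energy a I (X(i := x)) x = added_energy a I X x" using I by (intro added_energy_cong) auto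
    ultimately have "ennreal (exp (- \<beta> * gas_energy a (insert i I) (X(i := x)))) * ennreal (exp (\<beta> * added_energy a I (X(i := x)) ((X(i := x)) i)))
       = ennreal (exp (- \<beta> * gas_energy a I X))"
      by (simp add: gas_energy_insert[OF I] ennreal_mult[symmetric] mult_exp_exp distrib_left)
    then show "ennreal (exp (- \<beta> * gas_energy a (insert i I) (X(i := x)))) * (ennreal (exp (\<beta> * added_energy a I (X(i := x)) ((X(i := x)) i))) * g ((X(i := x)) i))
       = ennreal (exp (- \<beta> * gas_energy a I X)) * g x"
      by (simp add: mult.assoc[symmetric])
  qed
  also have "\<dots> = (\<integral>\<^sup>+X. ennreal (exp (- \<beta> * gas_energy a I X)) * (\<integral>\<^sup>+x. g x \<partial>lborel) \<partial>configs I)"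
    by (intro nn_integral_cong nn_integral_cmult) (simp add: g)
  also have "\<dots> = gas_partition \<beta> a I * (\<integral>\<^sup>+x. g x \<partial>lborel)"
    unfolding gas_partition_def by (rule nn_integral_multc) measurable
  finally show ?thesis by (simp add: mult.commute)
qed

lemma configs_reindex:
  assumes fin: "finite I" and b: "bij_betw \<pi> J I"
  shows "distr (configs I) (configs J) (\<lambda>X. \<lambda>j\<in>J. X (\<pi> j)) = configs J"
proof -
  interpret product_sigma_finite "\<lambda>_::nat. lborel :: (real^2) measure" ..
  have finJ: "finite J" using fin b by (simp add: bij_betw_finite)
  have \<pi>: "\<pi> j \<in> I" if "j \<in> J" for j using b that by (auto simp: bij_betw_def)
  have [measurable]: "(\<lambda>X. \<lambda>j\<in>J. X (\<pi> j)) \<in> measurable (configs I) (configs J)"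
    by (intro measurable_restrict) (use \<pi> measurable_component_singleton[of _ I "\<lambda>_. lborel"] in auto)
  show ?thesis
  proof (rule PiM_eqI[OF finJ])
    fix A :: "nat \<Rightarrow> (real^2) set" assume A: "\<And>j. j \<in> J \<Longrightarrow> A j \<in> sets lborel"
    have AI: "A (inv_into J \<pi> i) \<in> sets lborel" if "i \<in> I" for i
      using A b that by (metis bij_betw_def inv_into_into)
    have "(\<lambda>X. \<lambda>j\<in>J. X (\<pi> j)) -` Pi\<^sub>E J A \<inter> space (configs I) = Pi\<^sub>E I (\<lambda>i. A (inv_into J \<pi> i))"
      using b by (auto simp: space_PiM PiE_iff bij_betw_def inv_into_f_f)
    then have "emeasure (distr (configs I) (configs J) (\<lambda>X. \<lambda>j\<in>J. X (\<pi> j))) (Pi\<^sub>E J A) = emeasure (configs I) (Pi\<^sub>E I (\<lambda>i. A (inv_into J \<pi> i)))"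
      using A finJ by (simp add: emeasure_distr sets_PiM_I_finite)
    also have "\<dots> = (\<Prod>i\<in>I. emeasure lborel (A (inv_into J \<pi> i)))"
      using fin AI by (rule emeasure_PiM)
    also have "\<dots> = (\<Prod>j\<in>J. emeasure lborel (A j))"
      using b prod.reindex_bij_betw[OF b, of "\<lambda>i. emeasure lborel (A (inv_into J \<pi> i))"]
      by (simp add: bij_betw_def inv_into_f_f)
    finally show "emeasure (distr (configs I) (configs J) (\<lambda>X. \<lambda>j\<in>J. X (\<pi> j))) (Pi\<^sub>E J A) = (\<Prod>j\<in>J. emeasure lborel (A j))" .
  qed simp
qed

lemma gas_energy_reindex:
  assumes b: "bij_betw \<pi> J I"
  shows "gas_energy a I X = gas_energy a J (\<lambda>j\<in>J. X (\<pi> j))"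
proof -
  have inj: "inj_on \<pi> J" and im: "\<pi> ` J = I" using b by (auto simp: bij_betw_def)
  have s: "(\<Sum>i\<in>I. f i) = (\<Sum>j\<in>J. f (\<pi> j))" for f :: "nat \<Rightarrow> real"
    using sum.reindex_bij_betw[OF b, of f] by simp
  have s2: "(\<Sum>k\<in>I - {\<pi> j}. f k) = (\<Sum>l\<in>J - {j}. f (\<pi> l))" if "j \<in> J" for j and f :: "nat \<Rightarrow> real"
  proof -
    have "bij_betw \<pi> (J - {j}) (I - {\<pi> j})"
      using inj im that by (auto simp: bij_betw_def inj_on_diff dest: inj_onD)
    from sum.reindex_bij_betw[OF this, of f] show ?thesis by simp
  qed
  have "gas_energy a J (\<lambda>j\<in>J. X (\<pi> j)) = gas_energy a J (\<lambda>j. X (\<pi> j))"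
    by (rule gas_energy_cong) simp
  then show ?thesis
    unfolding gas_energy_def pair_energy_def s by (simp add: s2 cong: sum.cong)
qed

lemma gas_partition_card:
  assumes "finite I" "finite J" "card I = card J"
  shows "gas_partition \<beta> a I = gas_partition \<beta> a J"
proof -
  obtain \<pi> where b: "bij_betw \<pi> J I" using assms finite_same_card_bij by metis
  have \<pi>: "\<pi> j \<in> I" if "j \<in> J" for j using b that by (auto simp: bij_betw_def)
  have m: "(\<lambda>X. \<lambda>j\<in>J. X (\<pi> j)) \<in> measurable (configs I) (configs J)"
    by (intro measurable_restrict) (use \<pi> measurable_component_singleton[of _ I "\<lambda>_. lborel"] in auto)
  have "gas_partition \<beta> a J = (\<integral>\<^sup>+X. ennreal (exp (- \<beta> * gas_energy a J X)) \<partial>distr (configs I) (configs J) (\<lambda>X. \<lambda>j\<in>J. X (\<pi> j)))"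
    unfolding configs_reindex[OF assms(1) b] by (simp add: gas_partition_def)
  also have "\<dots> = (\<integral>\<^sup>+X. ennreal (exp (- \<beta> * gas_energy a J (\<lambda>j\<in>J. X (\<pi> j)))) \<partial>configs I)"
    by (rule nn_integral_distr[OF m]) measurable
  also have "\<dots> = gas_partition \<beta> a I"
    by (simp add: gas_partition_def gas_energy_reindex[OF b])
  finally show ?thesis by simp
qed

lemma AE_configs_distinct:
  assumes fin: "finite I"
  shows "AE X in configs I. inj_on X I"
proof -
  have "AE X in configs I. X i \<noteq> X j" if ij: "i \<in> I" "j \<in> I" "i \<noteq> j" for i j
  proof -
    define J where "J = I - {i}"
    have J: "finite J" "i \<notin> J" "insert i J = I" "j \<in> J" using fin ij by (auto simp: J_def)
    have [measurable]: "(\<lambda>X. X i) \<in> borel_measurable (configs I)" "(\<lambda>X. X j) \<in> borel_measurable (configs I)"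
      using ij by (auto intro: component_measurable)
    have S [measurable]: "{X \<in> space (configs I). X i = X j} \<in> sets (configs I)" by measurable
    have "emeasure (configs I) {X \<in> space (configs I). X i = X j} = (\<integral>\<^sup>+X. indicator {0} (X i - X j) \<partial>configs I)"
      unfolding nn_integral_indicator[OF S, symmetric]
      by (intro nn_integral_cong) (auto split: split_indicator)
    also have "\<dots> = (\<integral>\<^sup>+X. (\<integral>\<^sup>+x. indicator {0} ((X(i := x)) i - (X(i := x)) j) \<partial>lborel) \<partial>configs J)"
      using configs_nn_integral_insert[OF J(1,2), of "\<lambda>X. indicator {0} (X i - X j)"] unfolding J(3) by simp
    also have "\<dots> = (\<integral>\<^sup>+X. (\<integral>\<^sup>+x. indicator {X j} x \<partial>lborel) \<partial>configs J)"
      using ij by (intro nn_integral_cong) (auto split: split_indicator)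
    also have "\<dots> = 0" by simp
    finally have "{X \<in> space (configs I). X i = X j} \<in> null_sets (configs I)" using S by blast
    then show ?thesis by (rule AE_I') auto
  qed
  then have "AE X in configs I. \<forall>i\<in>I. \<forall>j\<in>I. i \<noteq> j \<longrightarrow> X i \<noteq> X j"
    using fin by (auto intro!: AE_finite_allI)
  then show ?thesis by eventually_elim (auto simp: inj_on_def)
qed

lemma configs_scale:
  assumes fin: "finite I" and s: "0 < s"
  shows "configs I = density (distr (configs I) (configs I) (\<lambda>X. \<lambda>i\<in>I. s *\<^sub>R X i)) (\<lambda>_. ennreal (s ^ (2 * card I)))"
proof -
  interpret product_sigma_finite "\<lambda>_::nat. lborel :: (real^2) measure" ..
  have m: "(\<lambda>X. \<lambda>i\<in>I. s *\<^sub>R X i) \<in> measurable (configs I) (configs I)"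
    by (intro measurable_restrict) (simp add: component_measurable)
  show ?thesis
  proof (rule PiM_eqI[OF fin, symmetric])
    fix A :: "nat \<Rightarrow> (real^2) set" assume A: "\<And>i. i \<in> I \<Longrightarrow> A i \<in> sets lborel"
    have V: "(\<lambda>x. s *\<^sub>R x) -` A i \<in> sets lborel" if "i \<in> I" for i
      using measurable_sets_borel[of "\<lambda>x::real^2. s *\<^sub>R x" borel "A i"] A[OF that] by simp
    have one: "ennreal (s ^ 2) * emeasure lborel ((\<lambda>x. s *\<^sub>R x) -` A i) = emeasure lborel (A i)" if "i \<in> I" for i
    proof -
      have "lborel = density (distr lborel borel (\<lambda>x::real^2. s *\<^sub>R x)) (\<lambda>_. ennreal (s ^ 2))"
        using lborel_affine[of s "0::real^2"] s by simp
      then have "emeasure lborel (A i) = emeasure (density (distr lborel borel (\<lambda>x::real^2. s *\<^sub>R x)) (\<lambda>_. ennreal (s ^ 2))) (A i)"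
        by simp
      also have "\<dots> = ennreal (s ^ 2) * emeasure lborel ((\<lambda>x. s *\<^sub>R x) -` A i)"
        using A[OF that] by (subst emeasure_density) (auto simp: nn_integral_cmult_indicator emeasure_distr)
      finally show ?thesis by simp
    qed
    have PA: "Pi\<^sub>E I A \<in> sets (configs I)" using A fin by (intro sets_PiM_I_finite)
    have "(\<lambda>X. \<lambda>i\<in>I. s *\<^sub>R X i) -` Pi\<^sub>E I A \<inter> space (configs I) = Pi\<^sub>E I (\<lambda>i. (\<lambda>x. s *\<^sub>R x) -` A i)"
      by (auto simp: space_PiM PiE_iff)
    then have "emeasure (density (distr (configs I) (configs I) (\<lambda>X. \<lambda>i\<in>I. s *\<^sub>R X i)) (\<lambda>_. ennreal (s ^ (2 * card I)))) (Pi\<^sub>E I A)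
      = ennreal (s ^ (2 * card I)) * emeasure (configs I) (Pi\<^sub>E I (\<lambda>i. (\<lambda>x. s *\<^sub>R x) -` A i))"
      using PA m by (subst emeasure_density) (auto simp: nn_integral_cmult_indicator emeasure_distr)
    also have "\<dots> = (\<Prod>i\<in>I. ennreal (s ^ 2)) * (\<Prod>i\<in>I. emeasure lborel ((\<lambda>x. s *\<^sub>R x) -` A i))"
      using fin V s by (subst emeasure_PiM) (auto simp: ennreal_power power_mult)
    also have "\<dots> = (\<Prod>i\<in>I. emeasure lborel (A i))"
      unfolding prod.distrib[symmetric] by (intro prod.cong refl one)
    finally show "emeasure (density (distr (configs I) (configs I) (\<lambda>X. \<lambda>i\<in>I. s *\<^sub>R X i)) (\<lambda>_. ennreal (s ^ (2 * card I)))) (Pi\<^sub>E I A)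
      = (\<Prod>i\<in>I. emeasure lborel (A i))" .
  qed simp
qed

text \<open>Coinciding points are excluded because \<open>ln 0 = 0\<close> does not change under scaling.\<close>
lemma gas_energy_scale:
  assumes inj: "inj_on X I" and s: "0 < s"
  shows "gas_energy a I (\<lambda>i\<in>I. s *\<^sub>R X i) = gas_energy (s\<^sup>2 * a) I X - real (card I) * (real (card I) - 1) / 2 * ln s"
proof (cases "finite I")
  case True
  have "(\<Sum>i\<in>I. \<Sum>j\<in>I - {i}. - ln (norm (s *\<^sub>R X i - s *\<^sub>R X j))) = (\<Sum>i\<in>I. \<Sum>j\<in>I - {i}. - ln (norm (X i - X j)) - ln s)"
  proof (intro sum.cong refl)
    fix i j assume "i \<in> I" "j \<in> I - {i}"
    then have "X i \<noteq> X j" using inj by (auto dest: inj_onD)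
    then show "- ln (norm (s *\<^sub>R X i - s *\<^sub>R X j)) = - ln (norm (X i - X j)) - ln s"
      using s by (simp add: scaleR_diff_right[symmetric] ln_mult)
  qed
  also have "\<dots> = (\<Sum>i\<in>I. \<Sum>j\<in>I - {i}. - ln (norm (X i - X j))) - real (card I) * (real (card I) - 1) * ln s"
  proof (cases "card I = 0")
    case False
    then have "real (card I - Suc 0) = real (card I) - 1" by (simp add: of_nat_diff Suc_leI)
    then show ?thesis using True by (simp add: sum_subtractf sum_negf card_Diff_singleton cong: sum.cong)
  qed (use True in simp)
  finally have p: "pair_energy I (\<lambda>i. s *\<^sub>R X i) = pair_energy I X - real (card I) * (real (card I) - 1) / 2 * ln s"
    unfolding pair_energy_def by simp
  have "gas_energy a I (\<lambda>i\<in>I. s *\<^sub>R X i) = gas_energy a I (\<lambda>i. s *\<^sub>R X i)"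
    by (rule gas_energy_cong) simp
  also have "\<dots> = gas_energy (s\<^sup>2 * a) I X - real (card I) * (real (card I) - 1) / 2 * ln s"
    unfolding gas_energy_def p using s by (simp add: power_mult_distrib sum_distrib_left mult_ac)
  finally show ?thesis .
qed (simp add: gas_energy_def pair_energy_def)

text \<open>Under a dilation of the plane that multiplies areas by \<open>c\<close>, the volume element
  contributes \<open>c\<close> for each of the \<open>n\<close> particles, and every pair contributes \<open>c\<close> to the power
  \<open>\<beta> / 2\<close>.\<close>
definition scaling_exponent :: "real \<Rightarrow> nat \<Rightarrow> real" where
  "scaling_exponent \<beta> n = real n + \<beta> * (real n * (real n - 1)) / 4"

text \<open>Substitution of \<open>sqrt c *\<^sub>R X i\<close> for \<open>X i\<close>: it multiplies the confinement by \<open>c\<close> and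
  only shifts the pair energy.\<close>
lemma gas_partition_scale:
  assumes fin: "finite I" and c: "0 < c"
  shows "gas_partition \<beta> a I = ennreal (c powr scaling_exponent \<beta> (card I)) * gas_partition \<beta> (c * a) I"
proof -
  define s where "s = sqrt c"
  have s: "0 < s" "s\<^sup>2 = c" "ln s = ln c / 2" using c by (auto simp: s_def ln_sqrt)
  let ?n = "real (card I)"
  have m: "(\<lambda>X. \<lambda>i\<in>I. s *\<^sub>R X i) \<in> measurable (configs I) (configs I)"
    by (intro measurable_restrict) (simp add: component_measurable)
  have gm: "(\<lambda>X. ennreal (exp (- \<beta> * gas_energy a I X))) \<in> borel_measurable (configs I)" by measurable
  have "gas_partition \<beta> a I = (\<integral>\<^sup>+X. ennreal (exp (- \<beta> * gas_energy a I X))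
      \<partial>density (distr (configs I) (configs I) (\<lambda>X. \<lambda>i\<in>I. s *\<^sub>R X i)) (\<lambda>_. ennreal (s ^ (2 * card I))))"
    unfolding configs_scale[OF fin s(1), symmetric] by (simp add: gas_partition_def)
  also have "\<dots> = (\<integral>\<^sup>+X. ennreal (s ^ (2 * card I)) * ennreal (exp (- \<beta> * gas_energy a I X)) \<partial>distr (configs I) (configs I) (\<lambda>X. \<lambda>i\<in>I. s *\<^sub>R X i))"
    using gm by (subst nn_integral_density) auto
  also have "\<dots> = (\<integral>\<^sup>+X. ennreal (s ^ (2 * card I)) * ennreal (exp (- \<beta> * gas_energy a I (\<lambda>i\<in>I. s *\<^sub>R X i))) \<partial>configs I)"
    using gm by (subst nn_integral_distr[OF m]) auto
  also have "\<dots> = (\<integral>\<^sup>+X. ennreal (c powr scaling_exponent \<beta> (card I)) * ennreal (exp (- \<beta> * gas_energy (c * a) I X)) \<partial>configs I)"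
  proof (rule nn_integral_cong_AE)
    show "AE X in configs I. ennreal (s ^ (2 * card I)) * ennreal (exp (- \<beta> * gas_energy a I (\<lambda>i\<in>I. s *\<^sub>R X i)))
       = ennreal (c powr scaling_exponent \<beta> (card I)) * ennreal (exp (- \<beta> * gas_energy (c * a) I X))"
      using AE_configs_distinct[OF fin]
    proof eventually_elim
      case (elim X)
      have "s ^ (2 * card I) = exp (?n * ln c)"
        using c by (simp add: power_mult s(2) exp_of_nat_mult)
      moreover have "c powr scaling_exponent \<beta> (card I) = exp (scaling_exponent \<beta> (card I) * ln c)"
        using c by (simp add: powr_def)
      ultimately show ?case
        by (simp add: gas_energy_scale[OF elim s(1)] s(2,3) ennreal_mult[symmetric] mult_exp_exp scaling_exponent_def)
           (simp add: algebra_simps add_divide_distrib)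
    qed
  qed
  also have "\<dots> = ennreal (c powr scaling_exponent \<beta> (card I)) * gas_partition \<beta> (c * a) I"
    unfolding gas_partition_def by (rule nn_integral_cmult) measurable
  finally show ?thesis .
qed

section \<open>The uniform measure on the disc\<close>

text \<open>Jensen's inequality in the form used for ratios of partition functions, which arise as
  nonnegative integrals: if the right-hand side is infinite there is nothing to show.\<close>
lemma jensen_exp:
  assumes M: "prob_space M" and X: "integrable M X"
  shows "ennreal (exp (LINT x|M. X x)) \<le> (\<integral>\<^sup>+x. ennreal (exp (X x)) \<partial>M)"
proof (cases "(\<integral>\<^sup>+x. ennreal (exp (X x)) \<partial>M) < \<infinity>")
  case True
  interpret prob_space M by fact
  have [measurable]: "X \<in> borel_measurable M" using X by auto
  define m where "m = (LINT x|M. X x)"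
  have ie: "integrable M (\<lambda>x. exp (X x))"
    using True by (intro integrableI_bounded) auto
  have "exp m * (1 + (X x - m)) \<le> exp (X x)" for x
  proof -
    have "exp m * (1 + (X x - m)) \<le> exp m * exp (X x - m)"
      by (intro mult_left_mono exp_ge_add_one_self) simp
    then show ?thesis by (simp add: mult_exp_exp)
  qed
  then have "(LINT x|M. exp m * (1 + (X x - m))) \<le> (LINT x|M. exp (X x))"
    using X ie by (intro integral_mono) auto
  moreover have "(LINT x|M. exp m * (1 + (X x - m))) = exp m"
    using X by (simp add: m_def prob_space)
  ultimately have "exp m \<le> (LINT x|M. exp (X x))" by simp
  then show ?thesis
    using ie by (simp add: nn_integral_eq_integral m_def ennreal_leI)
next
  case False
  then show ?thesis by (simp add: not_less top_unique)
qed

lemma prob_space_m0: "prob_space m0"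
  unfolding m0_def by (rule prob_space_uniform_measure) (auto simp: emeasure_cball unit_ball_vol_2)

lemma sets_m0 [measurable_cong, simp]: "sets m0 = sets borel" by (simp add: m0_def)
lemma space_m0 [simp]: "space m0 = UNIV" by (simp add: m0_def)

lemma m0_density: "m0 = density lborel (\<lambda>x. ennreal (indicator (cball 0 1) x / pi))"
proof -
  have "emeasure lborel (cball (0::real^2) 1) = ennreal pi"
    by (simp add: emeasure_cball unit_ball_vol_2)
  moreover have "indicator (cball 0 1) x / ennreal pi = ennreal (indicator (cball 0 1) x / pi)" for x :: "real^2"
    by (simp add: divide_ennreal[symmetric] ennreal_indicator)
  ultimately show ?thesis by (simp add: m0_def uniform_measure_def)
qed

lemma AE_m0_cball: "AE x in m0. x \<in> cball 0 1"
  unfolding m0_density by (subst AE_density) (auto intro!: AE_I2 split: split_indicator_asm)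

lemma AE_m0_lborel: "AE x in lborel. P x \<Longrightarrow> AE x in m0. P x"
  unfolding m0_density by (subst AE_density) (auto elim: eventually_mono)

lemma nn_integral_m0:
  "f \<in> borel_measurable borel \<Longrightarrow> (\<integral>\<^sup>+x. f x \<partial>m0) = (\<integral>\<^sup>+x. ennreal (indicator (cball 0 1) x / pi) * f x \<partial>lborel)"
  unfolding m0_density by (subst nn_integral_density) auto

lemma
  fixes f :: "real^2 \<Rightarrow> real"
  assumes [measurable]: "f \<in> borel_measurable borel"
  shows integrable_m0_iff: "integrable m0 f \<longleftrightarrow> set_integrable lborel (cball 0 1) f"
    and integral_m0: "(LINT x|m0. f x) = (LINT x:cball 0 1|lborel. f x) / pi"
proof -
  have e: "(\<lambda>x. (indicator (cball 0 1) x / pi) *\<^sub>R f x) = (\<lambda>x. (1 / pi) * (indicator (cball 0 1) x *\<^sub>R f x))"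
    by (rule ext) simp
  have "integrable m0 f \<longleftrightarrow> integrable lborel (\<lambda>x. (indicator (cball 0 1) x / pi) *\<^sub>R f x)"
    unfolding m0_density by (rule integrable_density) auto
  then show "integrable m0 f \<longleftrightarrow> set_integrable lborel (cball 0 1) f"
    unfolding e set_integrable_def
    using integrable_mult_left_iff[of lborel "1 / pi" "\<lambda>x. indicator (cball 0 1) x *\<^sub>R f x"] by simp
  have "(LINT x|m0. f x) = (LINT x|lborel. (indicator (cball 0 1) x / pi) *\<^sub>R f x)"
    unfolding m0_density by (rule integral_density) auto
  then show "(LINT x|m0. f x) = (LINT x:cball 0 1|lborel. f x) / pi"
    unfolding e set_lebesgue_integral_def by simp
qed

lemma integrable_m0_continuous:
  fixes f :: "real^2 \<Rightarrow> real"
  assumes "continuous_on UNIV f"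
  shows "integrable m0 f"
proof -
  have "f \<in> borel_measurable borel" using assms by (rule borel_measurable_continuous_onI)
  moreover have "set_integrable lborel (cball 0 1) f"
    unfolding set_integrable_def by (intro borel_integrable_compact continuous_on_subset[OF assms]) auto
  ultimately show ?thesis by (simp add: integrable_m0_iff)
qed

lemma integral_m0_norm_sq: "(LINT x|m0. (norm x)\<^sup>2) = 1/2"
proof -
  have "(LINT y:cball (0::real^2) 1|lborel. (norm y)\<^sup>2) = pi * (LINT s:{0..1}|lborel. (s::real))"
    using disc_radial(2)[of "\<lambda>s. s" 1] by simp
  also have "(LINT s:{0..1}|lborel. (s::real)) = 1/2"
  proof -
    have "has_bochner_integral lborel (\<lambda>x. x * indicator {0..1} x :: real) (1\<^sup>2 / 2 - 0\<^sup>2 / 2)"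
      by (rule has_bochner_integral_FTC_Icc_real) (auto intro!: derivative_eq_intros)
    then show ?thesis by (simp add: set_lebesgue_integral_def has_bochner_integral_iff mult.commute)
  qed
  finally show ?thesis by (simp add: integral_m0)
qed

definition disc_potential :: "real^2 \<Rightarrow> real" where
  "disc_potential x = (LINT y|m0. ln (norm (x - y)))"

lemma integrable_m0_ln: "integrable m0 (\<lambda>y. ln (norm (x - y)))"
  using integrable_disc_ln[of 1 x] by (subst integrable_m0_iff) auto

lemma disc_potential_eq:
  "disc_potential x = (if 1 \<le> norm x then ln (norm x) else ((norm x)\<^sup>2 - 1) / 2)"
proof -
  have "disc_potential x = (LINT y:cball 0 1|lborel. ln (norm (y - x))) / pi"
    unfolding disc_potential_def by (subst integral_m0) (auto simp: norm_minus_commute)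
  then show ?thesis
    using integral_cball_ln[of 1 0 x] by (simp add: diff_divide_distrib)
qed

text \<open>The potential of the disc never exceeds its quadratic expression inside the disc;
  outside, this is \<open>ln s \<le> s - 1\<close> for the squared norm.\<close>
lemma disc_potential_le: "disc_potential x \<le> ((norm x)\<^sup>2 - 1) / 2"
proof (cases "1 \<le> norm x")
  case True
  then have "2 * ln (norm x) = ln ((norm x)\<^sup>2)" by (simp add: ln_realpow)
  also have "\<dots> \<le> (norm x)\<^sup>2 - 1" using True by (intro ln_le_minus_one) auto
  finally show ?thesis using True by (simp add: disc_potential_eq)
qed (simp add: disc_potential_eq)

lemma disc_potential_ge: "- (1/2) \<le> disc_potential x"
  using zero_le_power2[of "norm x"] by (auto simp: disc_potential_eq intro: order_trans[of _ 0])

lemma disc_potential_measurable [measurable]: "disc_potential \<in> borel_measurable borel"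
  unfolding disc_potential_eq[abs_def] by measurable

lemma integral_disc_potential: "(LINT x|m0. disc_potential x) = - 1/4"
proof -
  have "(LINT x|m0. disc_potential x) = (LINT x|m0. (norm x)\<^sup>2 / 2 - 1 / 2)"
    by (rule integral_cong_AE) (use AE_m0_cball in \<open>auto simp: disc_potential_eq diff_divide_distrib elim!: eventually_mono\<close>)
  also have "\<dots> = - 1/4"
  proof -
    interpret prob_space m0 by (rule prob_space_m0)
    have "integrable m0 (\<lambda>x. (norm x)\<^sup>2 / 2)" by (intro integrable_m0_continuous continuous_intros) auto
    then show ?thesis using integral_m0_norm_sq prob_space by simp
  qed
  finally show ?thesis .
qed

lemma integral_m0_abs_ln_le:
  assumes "norm x \<le> 1"
  shows "(LINT y|m0. \<bar>ln (norm (x - y))\<bar>) \<le> 2"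
proof -
  interpret prob_space m0 by (rule prob_space_m0)
  have "(LINT y|m0. \<bar>ln (norm (x - y))\<bar>) \<le> (LINT y|m0. 2 * ln 2 - ln (norm (x - y)))"
  proof (rule integral_mono_AE)
    show "AE y in m0. \<bar>ln (norm (x - y))\<bar> \<le> 2 * ln 2 - ln (norm (x - y))"
      using AE_m0_cball
    proof eventually_elim
      case (elim y)
      then have "norm (x - y) \<le> 2" using assms norm_triangle_ineq4[of x y] by simp
      then have "ln (norm (x - y)) \<le> ln 2" by (cases "x = y") auto
      then show ?case using ln_ge_zero[of "2::real"] by (auto simp: abs_if)
    qed
  qed (use integrable_m0_ln in auto)
  also have "\<dots> = 2 * ln 2 - disc_potential x"
    using integrable_m0_ln prob_space by (simp add: disc_potential_def)
  also have "\<dots> \<le> 2" using disc_potential_ge[of x] ln_2_less_1 ln2_le_25_over_36 by simp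
  finally show ?thesis .
qed

text \<open>Controls the error made by smoothing the logarithm. The bound has to be uniform in
  \<open>x\<close>, because \<open>x\<close> will run over the particles of an arbitrary configuration.\<close>
lemma nn_integral_m0_inverse_norm: "(\<integral>\<^sup>+y. ennreal (1 / norm (x - y)) \<partial>m0) \<le> 3"
proof -
  interpret prob_space m0 by (rule prob_space_m0)
  define k where "k w = indicator (cball 0 1) w / norm w" for w :: "real^2"
  have [measurable]: "k \<in> borel_measurable borel" unfolding k_def by measurable
  have half: "(\<integral>\<^sup>+w. ennreal (k w) \<partial>lborel) = ennreal (2 * pi)"
  proof -
    define \<phi> where "\<phi> s = indicator {0..1} s * s powr (-1/2)" for s :: real
    have [measurable]: "\<phi> \<in> borel_measurable borel" unfolding \<phi>_def by measurable
    have "k w = \<phi> ((norm w)\<^sup>2)" for w :: "real^2"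
    proof (cases "w = 0")
      case False
      have "((norm w)\<^sup>2) powr (-1/2) = 1 / norm w"
      proof -
        have "(norm w)\<^sup>2 = norm w powr 2" using False by (simp add: powr_numeral)
        then have "((norm w)\<^sup>2) powr (-1/2) = norm w powr (2 * (-1/2))" by (simp only: powr_powr)
        also have "\<dots> = 1 / norm w" using powr_minus_divide[of "norm w" 1] by simp
        finally show ?thesis .
      qed
      then show ?thesis
        unfolding k_def \<phi>_def by (auto split: split_indicator simp: power_le_one_iff)
    qed (simp add: k_def \<phi>_def)
    then have "(\<integral>\<^sup>+w. ennreal (k w) \<partial>lborel) = ennreal pi * (\<integral>\<^sup>+s. ennreal (\<phi> s) * indicator {0..} s \<partial>lborel)"
      using nn_integral_radial[of "\<lambda>s. ennreal (\<phi> s)"] by simp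
    also have "(\<integral>\<^sup>+s. ennreal (\<phi> s) * indicator {0..} s \<partial>lborel) = (\<integral>\<^sup>+s. ennreal (s powr (-1/2)) * indicator {0..1} s \<partial>lborel)"
      by (intro nn_integral_cong) (auto simp: \<phi>_def split: split_indicator)
    also have "\<dots> = ennreal 2"
    proof (rule nn_integral_has_integral_lebesgue')
      show "((\<lambda>t::real. t powr (-1/2)) has_integral 2) {0..1}"
        using has_integral_powr_from_0[of "-1/2" 1] by simp
    qed simp
    finally show ?thesis by (simp add: ennreal_mult' mult.commute)
  qed
  have "(\<integral>\<^sup>+y. ennreal (1 / norm (x - y)) \<partial>m0) \<le> (\<integral>\<^sup>+y. 1 + ennreal (k (y - x)) \<partial>m0)"
  proof (rule nn_integral_mono)
    fix y :: "real^2"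
    show "ennreal (1 / norm (x - y)) \<le> 1 + ennreal (k (y - x))"
    proof (cases "norm (y - x) \<le> 1")
      case True
      then have "1 / norm (x - y) = k (y - x)" by (simp add: k_def norm_minus_commute)
      then show ?thesis by simp
    next
      case False
      then have "1 / norm (x - y) \<le> 1" by (simp add: norm_minus_commute divide_le_eq)
      then have "ennreal (1 / norm (x - y)) \<le> 1" using ennreal_leI by fastforce
      then show ?thesis by (simp add: add_increasing2)
    qed
  qed
  also have "\<dots> = 1 + (\<integral>\<^sup>+y. ennreal (k (y - x)) \<partial>m0)"
    using emeasure_space_1 by (subst nn_integral_add) auto
  also have "(\<integral>\<^sup>+y. ennreal (k (y - x)) \<partial>m0) \<le> (\<integral>\<^sup>+y. ennreal (1 / pi) * ennreal (k (y - x)) \<partial>lborel)"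
    by (subst nn_integral_m0) (auto intro!: nn_integral_mono mult_right_mono ennreal_leI divide_right_mono split: split_indicator)
  also have "\<dots> = ennreal (1 / pi) * (\<integral>\<^sup>+y. ennreal (k (y - x)) \<partial>lborel)"
    by (rule nn_integral_cmult) measurable
  also have "(\<integral>\<^sup>+y. ennreal (k (y - x)) \<partial>lborel) = (\<integral>\<^sup>+w. ennreal (k w) \<partial>lborel)"
  proof -
    have "(\<integral>\<^sup>+y. ennreal (k (y - x)) \<partial>lborel) = (\<integral>\<^sup>+y. ennreal (k (y - x)) \<partial>distr lborel borel (\<lambda>w. x + w))"
      by (simp only: lborel_distr_plus)
    also have "\<dots> = (\<integral>\<^sup>+w. ennreal (k w) \<partial>lborel)"
      by (subst nn_integral_distr) auto
    finally show ?thesis .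
  qed
  also have "ennreal (1 / pi) * \<dots> = ennreal 2"
    unfolding half by (subst ennreal_mult[symmetric]) auto
  finally have "(\<integral>\<^sup>+y. ennreal (1 / norm (x - y)) \<partial>m0) \<le> 1 + ennreal 2" by (simp add: add_left_mono)
  also have "1 + ennreal 2 = ennreal (1 + 2)" by (subst ennreal_plus) auto
  also have "\<dots> = 3" by simp
  finally show ?thesis .
qed

lemma
  shows integrable_m0_inverse_norm: "integrable m0 (\<lambda>y. 1 / norm (x - y))"
    and integral_m0_inverse_norm: "(LINT y|m0. 1 / norm (x - y)) \<le> 3"
proof -
  have "(\<integral>\<^sup>+y. ennreal (norm (1 / norm (x - y))) \<partial>m0) < \<infinity>"
    using nn_integral_m0_inverse_norm[of x] by (auto intro: le_less_trans)
  then show i: "integrable m0 (\<lambda>y. 1 / norm (x - y))"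
    by (intro integrableI_bounded) auto
  have "ennreal (LINT y|m0. 1 / norm (x - y)) \<le> ennreal 3"
    using nn_integral_m0_inverse_norm[of x] by (subst nn_integral_eq_integral[OF i, symmetric]) auto
  then show "(LINT y|m0. 1 / norm (x - y)) \<le> 3" by (subst (asm) ennreal_le_iff) auto
qed

lemma
  assumes M: "prob_space M" and I: "finite I" "i \<in> I" "j \<in> I" "i \<noteq> j"
  shows distr_PiM_pair: "distr (\<Pi>\<^sub>M k\<in>I. M) (M \<Otimes>\<^sub>M M) (\<lambda>X. (X i, X j)) = M \<Otimes>\<^sub>M M"
proof -
  interpret prob_space M by fact
  interpret product_sigma_finite "\<lambda>_. M" ..
  have m: "(\<lambda>X. (X i, X j)) \<in> measurable (\<Pi>\<^sub>M k\<in>I. M) (M \<Otimes>\<^sub>M M)"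
    using I by (intro measurable_Pair measurable_component_singleton) auto
  show ?thesis
  proof (rule pair_measure_eqI[symmetric])
    fix A B assume A: "A \<in> sets M" and B: "B \<in> sets M"
    let ?S = "\<lambda>k. if k = i then A else if k = j then B else space M"
    have "(\<lambda>X. (X i, X j)) -` (A \<times> B) \<inter> space (\<Pi>\<^sub>M k\<in>I. M) = Pi\<^sub>E I ?S"
      using I sets.sets_into_space[OF A] sets.sets_into_space[OF B]
      by (auto simp: space_PiM PiE_iff split: if_splits) (metis subsetD)
    then have "emeasure (distr (\<Pi>\<^sub>M k\<in>I. M) (M \<Otimes>\<^sub>M M) (\<lambda>X. (X i, X j))) (A \<times> B) = emeasure (\<Pi>\<^sub>M k\<in>I. M) (Pi\<^sub>E I ?S)"
      using m A B by (simp add: emeasure_distr)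
    also have "\<dots> = (\<Prod>k\<in>I. emeasure M (?S k))"
      using I A B by (intro emeasure_PiM) auto
    also have "\<dots> = (\<Prod>k\<in>{i, j}. emeasure M (?S k))"
      using I by (intro prod.mono_neutral_right) (auto simp: emeasure_space_1)
    also have "\<dots> = emeasure M A * emeasure M B" using I by simp
    finally show "emeasure M A * emeasure M B = emeasure (distr (\<Pi>\<^sub>M k\<in>I. M) (M \<Otimes>\<^sub>M M) (\<lambda>X. (X i, X j))) (A \<times> B)" by simp
  qed (auto intro: sigma_finite_measure_axioms)
qed

abbreviation m0_configs :: "nat set \<Rightarrow> (nat \<Rightarrow> real^2) measure" where
  "m0_configs I \<equiv> \<Pi>\<^sub>M i\<in>I. m0"

lemma
  fixes f :: "real^2 \<Rightarrow> real"
  assumes I: "i \<in> I" and f: "integrable m0 f"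
  shows integrable_m0_configs_one: "integrable (m0_configs I) (\<lambda>Y. f (Y i))"
    and integral_m0_configs_one: "(LINT Y|m0_configs I. f (Y i)) = (LINT y|m0. f y)"
proof -
  have d: "distr (m0_configs I) m0 (\<lambda>Y. Y i) = m0"
    by (rule distr_PiM_component) (auto intro: prob_space_m0 I)
  have m: "(\<lambda>Y. Y i) \<in> measurable (m0_configs I) m0" using I by (rule measurable_component_singleton)
  have fm: "f \<in> borel_measurable m0" using f by auto
  show "integrable (m0_configs I) (\<lambda>Y. f (Y i))"
    using integrable_distr_eq[OF m fm] f unfolding d by simp
  show "(LINT Y|m0_configs I. f (Y i)) = (LINT y|m0. f y)"
    using integral_distr[OF m fm] unfolding d by simp
qed

text \<open>Fubini's theorem for two independent coordinates. The kernel is controlled only at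
  points \<open>x\<close> of the disc because the mean of \<open>\<bar>ln (norm (x - y))\<bar>\<close> is not bounded uniformly
  in the plane.\<close>
lemma
  fixes k :: "real^2 \<Rightarrow> real^2 \<Rightarrow> real"
  assumes km [measurable]: "(\<lambda>p. k (fst p) (snd p)) \<in> borel_measurable (borel \<Otimes>\<^sub>M borel)"
    and k1: "\<And>x. norm x \<le> 1 \<Longrightarrow> integrable m0 (k x)"
    and k2: "\<And>x. norm x \<le> 1 \<Longrightarrow> (LINT y|m0. \<bar>k x y\<bar>) \<le> C"
    and I: "finite I" "i \<in> I" "j \<in> I" "i \<noteq> j"
  shows integrable_m0_configs_pair: "integrable (m0_configs I) (\<lambda>Y. k (Y i) (Y j))"
    and integral_m0_configs_pair: "(LINT Y|m0_configs I. k (Y i) (Y j)) = (LINT x|m0. (LINT y|m0. k x y))"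
proof -
  interpret m: prob_space m0 by (rule prob_space_m0)
  interpret pair_sigma_finite m0 m0 ..
  have [measurable_cong]: "sets (m0 \<Otimes>\<^sub>M m0) = sets (borel \<Otimes>\<^sub>M borel)"
    by (intro sets_pair_measure_cong) auto
  have km0: "(\<lambda>p. k (fst p) (snd p)) \<in> borel_measurable (m0 \<Otimes>\<^sub>M m0)" by measurable
  have i: "integrable (m0 \<Otimes>\<^sub>M m0) (\<lambda>p. k (fst p) (snd p))"
  proof (rule Fubini_integrable[OF km0])
    show "AE x in m0. integrable m0 (\<lambda>y. k (fst (x, y)) (snd (x, y)))"
      using AE_m0_cball by eventually_elim (use k1 in auto)
    show "integrable m0 (\<lambda>x. LINT y|m0. norm (k (fst (x, y)) (snd (x, y))))"
    proof (rule m.integrable_const_bound[where B="\<bar>C\<bar>"])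
      show "AE x in m0. norm (LINT y|m0. norm (k (fst (x, y)) (snd (x, y)))) \<le> \<bar>C\<bar>"
        using AE_m0_cball
      proof eventually_elim
        case (elim x)
        have "0 \<le> (LINT y|m0. \<bar>k x y\<bar>)" by simp
        then show ?case using k2[of x] elim by simp
      qed
      have "(\<lambda>p. norm (k (fst p) (snd p))) \<in> borel_measurable (m0 \<Otimes>\<^sub>M m0)" by measurable
      then have "(\<lambda>(x, y). norm (k x y)) \<in> borel_measurable (m0 \<Otimes>\<^sub>M m0)" by (simp add: case_prod_beta)
      then show "(\<lambda>x. LINT y|m0. norm (k (fst (x, y)) (snd (x, y)))) \<in> borel_measurable m0"
        using m.borel_measurable_lebesgue_integral[of "\<lambda>x y. norm (k x y)" m0] by simp
    qed
  qed
  have d: "distr (m0_configs I) (m0 \<Otimes>\<^sub>M m0) (\<lambda>Y. (Y i, Y j)) = m0 \<Otimes>\<^sub>M m0"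
    by (rule distr_PiM_pair[OF prob_space_m0 I])
  have m: "(\<lambda>Y. (Y i, Y j)) \<in> measurable (m0_configs I) (m0 \<Otimes>\<^sub>M m0)"
    using I by (intro measurable_Pair measurable_component_singleton) auto
  show "integrable (m0_configs I) (\<lambda>Y. k (Y i) (Y j))"
    using integrable_distr_eq[OF m km0] i unfolding d by simp
  have "(LINT Y|m0_configs I. k (Y i) (Y j)) = (LINT p|(m0 \<Otimes>\<^sub>M m0). k (fst p) (snd p))"
    using integral_distr[OF m km0] unfolding d by simp
  also have "\<dots> = (LINT x|m0. (LINT y|m0. k x y))"
    using integral_fst'[OF i] by simp
  finally show "(LINT Y|m0_configs I. k (Y i) (Y j)) = (LINT x|m0. (LINT y|m0. k x y))" .
qed

lemma prob_space_m0_configs: "prob_space (m0_configs I)"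
  by (intro prob_space_PiM prob_space_m0)

lemma m0_configs_density:
  assumes fin: "finite I"
  shows "m0_configs I = density (configs I) (\<lambda>X. \<Prod>i\<in>I. ennreal (indicator (cball 0 1) (X i) / pi))"
proof -
  interpret prob_space m0 by (rule prob_space_m0)
  interpret P: product_sigma_finite "\<lambda>_::nat. m0" ..
  interpret L: product_sigma_finite "\<lambda>_::nat. lborel :: (real^2) measure" ..
  have wm [measurable]: "(\<lambda>X. \<Prod>i\<in>I. ennreal (indicator (cball 0 1) (X i) / pi)) \<in> borel_measurable (configs I)"
  proof (intro borel_measurable_prod_ennreal)
    fix i assume "i \<in> I"
    then have [measurable]: "(\<lambda>X. X i) \<in> borel_measurable (configs I)" by (rule component_measurable)
    show "(\<lambda>X. ennreal (indicator (cball 0 1) (X i) / pi)) \<in> borel_measurable (configs I)" by measurable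
  qed
  show ?thesis
  proof (rule P.PiM_eqI[OF fin, symmetric])
    show "sets (density (configs I) (\<lambda>X. \<Prod>i\<in>I. ennreal (indicator (cball 0 1) (X i) / pi))) = sets (m0_configs I)"
      by (simp, intro sets_PiM_cong) auto
    fix A :: "nat \<Rightarrow> (real^2) set" assume A: "\<And>i. i \<in> I \<Longrightarrow> A i \<in> sets m0"
    then have PA: "Pi\<^sub>E I A \<in> sets (configs I)" using fin by (intro sets_PiM_I_finite) auto
    have "emeasure (density (configs I) (\<lambda>X. \<Prod>i\<in>I. ennreal (indicator (cball 0 1) (X i) / pi))) (Pi\<^sub>E I A)
      = (\<integral>\<^sup>+X. (\<Prod>i\<in>I. ennreal (indicator (cball 0 1) (X i) / pi)) * indicator (Pi\<^sub>E I A) X \<partial>configs I)"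
      using PA by (subst emeasure_density) auto
    also have "\<dots> = (\<integral>\<^sup>+X. (\<Prod>i\<in>I. ennreal (indicator (cball 0 1) (X i) / pi) * indicator (A i) (X i)) \<partial>configs I)"
    proof (intro nn_integral_cong)
      fix X :: "nat \<Rightarrow> real^2" assume "X \<in> space (configs I)"
      then have "indicator (Pi\<^sub>E I A) X = (\<Prod>i\<in>I. indicator (A i) (X i) :: ennreal)"
        using fin by (auto simp: space_PiM PiE_iff indicator_def prod_zero_iff)
      then show "(\<Prod>i\<in>I. ennreal (indicator (cball 0 1) (X i) / pi)) * indicator (Pi\<^sub>E I A) X
         = (\<Prod>i\<in>I. ennreal (indicator (cball 0 1) (X i) / pi) * indicator (A i) (X i))"
        by (simp add: prod.distrib)
    qed
    also have "\<dots> = (\<Prod>i\<in>I. \<integral>\<^sup>+x. ennreal (indicator (cball 0 1) x / pi) * indicator (A i) x \<partial>lborel)"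
      using fin A by (intro L.product_nn_integral_prod) auto
    also have "\<dots> = (\<Prod>i\<in>I. emeasure m0 (A i))"
      using A by (intro prod.cong refl) (simp add: nn_integral_m0[symmetric])
    finally show "emeasure (density (configs I) (\<lambda>X. \<Prod>i\<in>I. ennreal (indicator (cball 0 1) (X i) / pi))) (Pi\<^sub>E I A)
      = (\<Prod>i\<in>I. emeasure m0 (A i))" .
  qed
qed

text \<open>Compares independent uniform points with Lebesgue measure; it enters through the lower
  bound for the partition function.\<close>
lemma nn_integral_m0_configs_le:
  assumes fin: "finite I" and F: "F \<in> borel_measurable (configs I)"
  shows "ennreal (pi ^ card I) * (\<integral>\<^sup>+Y. F Y \<partial>m0_configs I) \<le> (\<integral>\<^sup>+X. F X \<partial>configs I)"
proof -
  have wm [measurable]: "(\<lambda>X. \<Prod>i\<in>I. ennreal (indicator (cball 0 1) (X i) / pi)) \<in> borel_measurable (configs I)"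
  proof (intro borel_measurable_prod_ennreal)
    fix i assume "i \<in> I"
    then have [measurable]: "(\<lambda>X. X i) \<in> borel_measurable (configs I)" by (rule component_measurable)
    show "(\<lambda>X. ennreal (indicator (cball 0 1) (X i) / pi)) \<in> borel_measurable (configs I)" by measurable
  qed
  have "(\<integral>\<^sup>+Y. F Y \<partial>m0_configs I) = (\<integral>\<^sup>+X. (\<Prod>i\<in>I. ennreal (indicator (cball 0 1) (X i) / pi)) * F X \<partial>configs I)"
    unfolding m0_configs_density[OF fin] using F wm by (subst nn_integral_density) auto
  also have "\<dots> \<le> (\<integral>\<^sup>+X. ennreal (1 / pi ^ card I) * F X \<partial>configs I)"
  proof (intro nn_integral_mono mult_right_mono)
    fix X :: "nat \<Rightarrow> real^2"
    have "(\<Prod>i\<in>I. indicator (cball 0 1) (X i) / pi) \<le> (\<Prod>i\<in>I. 1 / pi :: real)"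
      by (intro prod_mono) (auto intro!: divide_right_mono split: split_indicator)
    also have "\<dots> = 1 / pi ^ card I" by (simp add: power_one_over)
    finally have "ennreal (\<Prod>i\<in>I. indicator (cball 0 1) (X i) / pi) \<le> ennreal (1 / pi ^ card I)"
      by (rule ennreal_leI)
    then show "(\<Prod>i\<in>I. ennreal (indicator (cball 0 1) (X i) / pi)) \<le> ennreal (1 / pi ^ card I)"
      by (subst prod_ennreal) auto
  qed simp
  also have "\<dots> = ennreal (1 / pi ^ card I) * (\<integral>\<^sup>+X. F X \<partial>configs I)"
    using F by (rule nn_integral_cmult)
  finally have "ennreal (pi ^ card I) * (\<integral>\<^sup>+Y. F Y \<partial>m0_configs I) \<le> ennreal (pi ^ card I) * (ennreal (1 / pi ^ card I) * (\<integral>\<^sup>+X. F X \<partial>configs I))"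
    by (rule mult_left_mono) simp
  also have "\<dots> = (\<integral>\<^sup>+X. F X \<partial>configs I)"
    unfolding mult.assoc[symmetric] by (subst ennreal_mult[symmetric]) auto
  finally show ?thesis .
qed

section \<open>Lower bounds for the energy and the partition function\<close>

lemma ln_le_reg_log:
  assumes "v \<noteq> (0::real^2)"
  shows "ln (norm v) \<le> ln (\<eta>\<^sup>2 + (norm v)\<^sup>2) / 2"
proof -
  have "2 * ln (norm v) = ln ((norm v)\<^sup>2)" using assms by (simp add: ln_realpow)
  also have "\<dots> \<le> ln (\<eta>\<^sup>2 + (norm v)\<^sup>2)" using assms by (subst ln_le_cancel_iff) (auto intro: add_nonneg_pos)
  finally show ?thesis by simp
qed

lemma reg_log_le:
  assumes v: "v \<noteq> (0::real^2)" and \<eta>: "0 < \<eta>"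
  shows "ln (\<eta>\<^sup>2 + (norm v)\<^sup>2) / 2 \<le> ln (norm v) + \<eta> * (1 / norm v)"
proof -
  define d where "d = norm v"
  have d: "0 < d" using v by (simp add: d_def)
  have "\<eta>\<^sup>2 + d\<^sup>2 \<le> (\<eta> + d)\<^sup>2" using \<eta> d by (simp add: power2_eq_square algebra_simps)
  then have "ln (\<eta>\<^sup>2 + d\<^sup>2) \<le> ln ((\<eta> + d)\<^sup>2)" using \<eta> d by (subst ln_le_cancel_iff) (auto intro: add_pos_pos)
  also have "\<dots> = 2 * ln (\<eta> + d)" using \<eta> d by (simp add: ln_realpow)
  also have "\<eta> + d = d * (1 + \<eta> / d)" using d by (simp add: distrib_left)
  also have "ln (d * (1 + \<eta> / d)) = ln d + ln (1 + \<eta> / d)"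
  proof -
    have "0 < 1 + \<eta> / d" using \<eta> d by (simp add: add_pos_pos)
    then show ?thesis using d by (simp add: ln_mult)
  qed
  also have "ln (1 + \<eta> / d) \<le> \<eta> / d" using \<eta> d by (intro ln_add_one_self_le_self) auto
  finally show ?thesis by (simp add: d_def mult.commute)
qed

text \<open>The smoothed logarithm is finite at coinciding points and changes the potential of the
  disc by a multiple of \<open>\<eta>\<close> only.\<close>
lemma
  assumes \<eta>: "0 < \<eta>"
  shows integrable_m0_reg_log: "integrable m0 (\<lambda>y. ln (\<eta>\<^sup>2 + (norm (x - y))\<^sup>2) / 2)"
    and integral_m0_reg_log_le: "(LINT y|m0. ln (\<eta>\<^sup>2 + (norm (x - y))\<^sup>2) / 2) \<le> disc_potential x + 3 * \<eta>"
    and integral_m0_reg_log_ge: "disc_potential x \<le> (LINT y|m0. ln (\<eta>\<^sup>2 + (norm (x - y))\<^sup>2) / 2)"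
    and integral_m0_abs_reg_log: "norm x \<le> 1 \<Longrightarrow> (LINT y|m0. \<bar>ln (\<eta>\<^sup>2 + (norm (x - y))\<^sup>2) / 2\<bar>) \<le> 2 + 3 * \<eta>"
proof -
  let ?L = "\<lambda>y. ln (\<eta>\<^sup>2 + (norm (x - y))\<^sup>2) / 2"
  have p: "\<eta>\<^sup>2 + (norm (x - y))\<^sup>2 \<noteq> 0" for y
    using \<eta> by (simp add: add_pos_nonneg less_imp_neq[symmetric])
  show i: "integrable m0 ?L"
    by (intro integrable_m0_continuous continuous_intros) (use p in auto)
  have ne: "AE y in m0. y \<noteq> x" by (rule AE_m0_lborel[OF AE_lborel_singleton])
  have i2: "integrable m0 (\<lambda>y. \<eta> * (1 / norm (x - y)))"
    by (rule integrable_mult_right[OF integrable_m0_inverse_norm])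
  have n3: "(LINT y|m0. \<eta> * (1 / norm (x - y))) \<le> 3 * \<eta>"
  proof -
    have "(LINT y|m0. \<eta> * (1 / norm (x - y))) = \<eta> * (LINT y|m0. 1 / norm (x - y))"
      by (rule integral_mult_right_zero)
    also have "\<dots> \<le> \<eta> * 3" using \<eta> integral_m0_inverse_norm[of x] by (intro mult_left_mono) auto
    finally show ?thesis by simp
  qed
  have "(LINT y|m0. ?L y) \<le> (LINT y|m0. ln (norm (x - y)) + \<eta> * (1 / norm (x - y)))"
  proof (intro integral_mono_AE i Bochner_Integration.integrable_add integrable_m0_ln i2)
    show "AE y in m0. ?L y \<le> ln (norm (x - y)) + \<eta> * (1 / norm (x - y))"
      using ne
    proof eventually_elim
      case (elim y)
      then show ?case using reg_log_le[of "x - y" \<eta>] \<eta> by simp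
    qed
  qed
  also have "\<dots> = disc_potential x + (LINT y|m0. \<eta> * (1 / norm (x - y)))"
    unfolding disc_potential_def by (rule Bochner_Integration.integral_add[OF integrable_m0_ln i2])
  also have "\<dots> \<le> disc_potential x + 3 * \<eta>" using n3 by simp
  finally show "(LINT y|m0. ?L y) \<le> disc_potential x + 3 * \<eta>" .
  show "disc_potential x \<le> (LINT y|m0. ?L y)"
    unfolding disc_potential_def
  proof (intro integral_mono_AE i integrable_m0_ln)
    show "AE y in m0. ln (norm (x - y)) \<le> ?L y"
      using ne
    proof eventually_elim
      case (elim y)
      then show ?case using ln_le_reg_log[of "x - y" \<eta>] by simp
    qed
  qed
  show "(LINT y|m0. \<bar>?L y\<bar>) \<le> 2 + 3 * \<eta>" if "norm x \<le> 1"
  proof -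
    have "(LINT y|m0. \<bar>?L y\<bar>) \<le> (LINT y|m0. \<bar>ln (norm (x - y))\<bar> + \<eta> * (1 / norm (x - y)))"
    proof (intro integral_mono_AE integrable_abs i Bochner_Integration.integrable_add integrable_m0_ln i2)
      show "AE y in m0. \<bar>?L y\<bar> \<le> \<bar>ln (norm (x - y))\<bar> + \<eta> * (1 / norm (x - y))"
        using ne
      proof eventually_elim
        case (elim y)
        then have v: "x - y \<noteq> 0" by simp
        have "0 \<le> \<eta> * (1 / norm (x - y))" using \<eta> by simp
        then show ?case using reg_log_le[OF v \<eta>] ln_le_reg_log[OF v, of \<eta>] by linarith
      qed
    qed
    also have "\<dots> = (LINT y|m0. \<bar>ln (norm (x - y))\<bar>) + (LINT y|m0. \<eta> * (1 / norm (x - y)))"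
      by (rule Bochner_Integration.integral_add[OF integrable_abs[OF integrable_m0_ln] i2])
    also have "\<dots> \<le> 2 + 3 * \<eta>" using n3 integral_m0_abs_ln_le[OF that] by simp
    finally show ?thesis .
  qed
qed

lemma integral_double_sum:
  fixes f :: "'i \<Rightarrow> 'j \<Rightarrow> 'a \<Rightarrow> real"
  assumes "\<And>i j. i \<in> A \<Longrightarrow> j \<in> B i \<Longrightarrow> integrable M (f i j)"
    and "\<And>i j. i \<in> A \<Longrightarrow> j \<in> B i \<Longrightarrow> (LINT x|M. f i j x) = c i j"
  shows "(LINT x|M. (\<Sum>i\<in>A. \<Sum>j\<in>B i. f i j x)) = (\<Sum>i\<in>A. \<Sum>j\<in>B i. c i j)"
proof -
  have "(LINT x|M. (\<Sum>i\<in>A. \<Sum>j\<in>B i. f i j x)) = (\<Sum>i\<in>A. (LINT x|M. (\<Sum>j\<in>B i. f i j x)))"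
    by (intro Bochner_Integration.integral_sum Bochner_Integration.integrable_sum assms(1))
  also have "\<dots> = (\<Sum>i\<in>A. \<Sum>j\<in>B i. (LINT x|M. f i j x))"
    by (intro sum.cong refl Bochner_Integration.integral_sum assms(1))
  also have "\<dots> = (\<Sum>i\<in>A. \<Sum>j\<in>B i. c i j)"
    by (intro sum.cong refl assms(2))
  finally show ?thesis .
qed

lemma measurable_ln_pair [measurable]:
  "(\<lambda>p. ln (norm (fst p - snd p))) \<in> borel_measurable ((borel :: (real^2) measure) \<Otimes>\<^sub>M borel)"
  by measurable

text \<open>The particles, with charge \<open>1\<close>, are compared with \<open>n\<close> independent uniform points of
  the disc, with charge \<open>-1\<close>. Conditional negativity of the smoothed logarithm for this
  neutral system, averaged over the uniform points, bounds the interaction among the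
  particles by their interaction with the uniform density. Smoothing at scale \<open>1 / n\<close> costs
  \<open>n * ln n\<close> for the self-interactions of each family and an error of order \<open>n\<close> for the
  mutual ones.\<close>
lemma pair_energy_lower_bound:
  assumes n: "1 \<le> n" and inj: "inj_on X {..<n}"
  shows "2 * pair_energy {..<n} X
    \<ge> - 2 * (real n * ln (real n)) - 2 * real n * (\<Sum>i<n. disc_potential (X i)) - (real n)\<^sup>2 / 4 - 6 * real n"
proof -
  define \<eta> where "\<eta> = 1 / real n"
  have \<eta>: "0 < \<eta>" using n by (simp add: \<eta>_def)
  define L where "L v = ln (\<eta>\<^sup>2 + (norm v)\<^sup>2) / 2" for v :: "real^2"
  have L0: "L 0 = - ln (real n)" using n \<eta> by (simp add: L_def ln_realpow \<eta>_def ln_div)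
  let ?\<mu> = "m0_configs {..<n}"
  interpret \<mu>: prob_space ?\<mu> by (rule prob_space_m0_configs)
  interpret m: prob_space m0 by (rule prob_space_m0)
  have iL: "integrable m0 (\<lambda>y. L (x - y))" for x
    unfolding L_def by (rule integrable_m0_reg_log[OF \<eta>])
  have i1: "integrable ?\<mu> (\<lambda>Y. L (X i - Y j))" and e1: "(LINT Y|?\<mu>. L (X i - Y j)) = (LINT y|m0. L (X i - y))"
    if "j < n" for i j
    using integrable_m0_configs_one[OF _ iL[of "X i"]] integral_m0_configs_one[OF _ iL[of "X i"]] that by auto
  have mL: "(\<lambda>p. L (fst p - snd p)) \<in> borel_measurable ((borel :: (real^2) measure) \<Otimes>\<^sub>M borel)"
    unfolding L_def by measurable
  have bL: "(LINT y|m0. \<bar>L (x - y)\<bar>) \<le> 2 + 3 * \<eta>" if "norm x \<le> 1" for x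
    unfolding L_def by (rule integral_m0_abs_reg_log[OF \<eta> that])
  define J where "J = (LINT x|m0. (LINT y|m0. L (x - y)))"
  have i2: "integrable ?\<mu> (\<lambda>Y. L (Y i - Y j))" and e2: "(LINT Y|?\<mu>. L (Y i - Y j)) = J"
    if "i < n" "j < n" "i \<noteq> j" for i j
    using integrable_m0_configs_pair[of "\<lambda>x y. L (x - y)", OF mL iL bL, of "{..<n}" i j]
      integral_m0_configs_pair[of "\<lambda>x y. L (x - y)", OF mL iL bL, of "{..<n}" i j] that
    by (auto simp: J_def)
  have J: "- 1/4 \<le> J"
  proof -
    have "- 1/4 = (LINT x|m0. disc_potential x)" by (simp add: integral_disc_potential)
    also have "\<dots> \<le> J"
      unfolding J_def
    proof (rule integral_mono_AE)
      show "integrable m0 disc_potential"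
      proof (rule m.integrable_const_bound[where B=1])
        show "AE x in m0. norm (disc_potential x) \<le> 1"
          using AE_m0_cball
        proof eventually_elim
          case (elim x)
          then have "(norm x)\<^sup>2 \<le> 1" by (simp add: power_le_one)
          then show ?case using disc_potential_le[of x] disc_potential_ge[of x] by (auto simp: abs_if)
        qed
      qed measurable
      show "integrable m0 (\<lambda>x. LINT y|m0. L (x - y))"
      proof (rule m.integrable_const_bound[where B="2 + 3 * \<eta>"])
        show "AE x in m0. norm (LINT y|m0. L (x - y)) \<le> 2 + 3 * \<eta>"
          using AE_m0_cball
        proof eventually_elim
          case (elim x)
          have "(LINT y|m0. \<bar>L (x - y)\<bar>) \<le> 2 + 3 * \<eta>" using bL[of x] elim by simp
          from order_trans[OF integral_abs_bound this] show ?case unfolding real_norm_def .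
        qed
        have "(\<lambda>(x, y). L (x - y)) \<in> borel_measurable (m0 \<Otimes>\<^sub>M m0)"
          using mL by (simp add: case_prod_beta cong: measurable_cong_sets sets_pair_measure_cong)
        then show "(\<lambda>x. LINT y|m0. L (x - y)) \<in> borel_measurable m0"
          using m.borel_measurable_lebesgue_integral[of "\<lambda>x y. L (x - y)" m0] by simp
      qed
      show "AE x in m0. disc_potential x \<le> (LINT y|m0. L (x - y))"
        unfolding L_def by (intro AE_I2 integral_m0_reg_log_ge[OF \<eta>])
    qed
    finally show ?thesis .
  qed
  have split_diag: "(\<Sum>i<n. \<Sum>j<n. L (Y i - Y j)) = (\<Sum>i<n. \<Sum>j\<in>{..<n} - {i}. L (Y i - Y j)) - real n * ln (real n)" for Y :: "nat \<Rightarrow> real^2"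
  proof -
    have "(\<Sum>i<n. \<Sum>j<n. L (Y i - Y j)) = (\<Sum>i<n. L 0 + (\<Sum>j\<in>{..<n} - {i}. L (Y i - Y j)))"
      by (intro sum.cong refl) (subst sum.remove[of "{..<n}"], auto)
    then show ?thesis by (simp add: sum.distrib sum_subtractf L0)
  qed
  have xx: "(\<Sum>i<n. \<Sum>j<n. L (X i - X j)) \<ge> - 2 * pair_energy {..<n} X - real n * ln (real n)"
  proof -
    have "(\<Sum>i<n. \<Sum>j\<in>{..<n} - {i}. ln (norm (X i - X j))) \<le> (\<Sum>i<n. \<Sum>j\<in>{..<n} - {i}. L (X i - X j))"
      using inj unfolding L_def by (intro sum_mono ln_le_reg_log) (auto dest: inj_onD)
    moreover have "(\<Sum>i<n. \<Sum>j\<in>{..<n} - {i}. ln (norm (X i - X j))) = - 2 * pair_energy {..<n} X"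
      by (simp add: pair_energy_def sum_negf)
    ultimately show ?thesis using split_diag[of X] by simp
  qed
  have "(\<Sum>i<n. \<Sum>j<n. L (X i - X j)) + (\<Sum>i<n. \<Sum>j<n. L (Y i - Y j)) \<le> 2 * (\<Sum>i<n. \<Sum>j<n. L (X i - Y j))" for Y :: "nat \<Rightarrow> real^2"
    unfolding L_def using log_kernel_two_families[where B="\<eta>\<^sup>2" and n=n and x=X and y=Y] \<eta> by simp
  note two = this
  have pw: "- 2 * pair_energy {..<n} X - 2 * (real n * ln (real n)) + (\<Sum>i<n. \<Sum>j\<in>{..<n} - {i}. L (Y i - Y j))
      \<le> 2 * (\<Sum>i<n. \<Sum>j<n. L (X i - Y j))" for Y
    using xx split_diag[of Y] two[of Y] by linarith
  have iS: "integrable ?\<mu> (\<lambda>Y. \<Sum>i<n. \<Sum>j\<in>{..<n} - {i}. L (Y i - Y j))"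
    by (intro Bochner_Integration.integrable_sum i2) auto
  have iT: "integrable ?\<mu> (\<lambda>Y. \<Sum>i<n. \<Sum>j<n. L (X i - Y j))"
    by (intro Bochner_Integration.integrable_sum i1) auto
  have "(LINT Y|?\<mu>. - 2 * pair_energy {..<n} X - 2 * (real n * ln (real n)) + (\<Sum>i<n. \<Sum>j\<in>{..<n} - {i}. L (Y i - Y j)))
    \<le> (LINT Y|?\<mu>. 2 * (\<Sum>i<n. \<Sum>j<n. L (X i - Y j)))"
    by (intro integral_mono pw Bochner_Integration.integrable_add iS integrable_mult_right iT) auto
  moreover have "(LINT Y|?\<mu>. - 2 * pair_energy {..<n} X - 2 * (real n * ln (real n)) + (\<Sum>i<n. \<Sum>j\<in>{..<n} - {i}. L (Y i - Y j)))
    = - 2 * pair_energy {..<n} X - 2 * (real n * ln (real n)) + (\<Sum>i<n. \<Sum>j\<in>{..<n} - {i}. J)"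
  proof -
    have "(LINT Y|?\<mu>. (\<Sum>i<n. \<Sum>j\<in>{..<n} - {i}. L (Y i - Y j))) = (\<Sum>i<n. \<Sum>j\<in>{..<n} - {i}. J)"
      by (rule integral_double_sum) (auto intro: i2 e2)
    then show ?thesis using iS by (simp add: \<mu>.prob_space)
  qed
  moreover have "(\<Sum>i<n. \<Sum>j\<in>{..<n} - {i}. J) \<ge> - (real n)\<^sup>2 / 4"
  proof -
    have "(\<Sum>i<n. \<Sum>j\<in>{..<n} - {i}. J) = real n * (real n - 1) * J"
      using n by (simp add: of_nat_diff)
    moreover have "real n * (real n - 1) * (- 1/4) \<le> real n * (real n - 1) * J"
      using J n by (intro mult_left_mono) auto
    ultimately show ?thesis using n by (simp add: power2_eq_square algebra_simps)
  qed
  moreover have "(LINT Y|?\<mu>. 2 * (\<Sum>i<n. \<Sum>j<n. L (X i - Y j))) \<le> 2 * real n * (\<Sum>i<n. disc_potential (X i)) + 6 * real n"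
  proof -
    have "(LINT Y|?\<mu>. (\<Sum>i<n. \<Sum>j<n. L (X i - Y j))) = (\<Sum>i<n. \<Sum>j<n. (LINT y|m0. L (X i - y)))"
      by (rule integral_double_sum) (auto intro: i1 e1)
    also have "\<dots> \<le> (\<Sum>i<n. \<Sum>j<n. disc_potential (X i) + 3 * \<eta>)"
      unfolding L_def by (intro sum_mono integral_m0_reg_log_le[OF \<eta>])
    also have "\<dots> = real n * (\<Sum>i<n. disc_potential (X i)) + 3 * real n"
      using n by (simp add: sum.distrib sum_distrib_left \<eta>_def distrib_left)
    finally show ?thesis by (simp add: mult.assoc)
  qed
  ultimately show ?thesis by linarith
qed

text \<open>The constant \<open>3/8\<close> is the energy of the uniform measure on the disc: \<open>1/8\<close> from the
  pair interaction and \<open>1/4\<close> from the confinement.\<close>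
lemma energy_lower_bound_precise:
  assumes n: "1 \<le> n" and inj: "inj_on X {..<n}"
  shows "energy n X \<ge> 3/8 * (real n)\<^sup>2 - real n * ln (real n) - 3 * real n"
proof -
  have "(\<Sum>i<n. disc_potential (X i)) \<le> (\<Sum>i<n. ((norm (X i))\<^sup>2 - 1) / 2)"
    by (intro sum_mono disc_potential_le)
  also have "\<dots> = (\<Sum>i<n. (norm (X i))\<^sup>2 / 2) - real n / 2"
    by (simp add: diff_divide_distrib sum_subtractf)
  finally have "2 * real n * (\<Sum>i<n. disc_potential (X i)) \<le> 2 * real n * ((\<Sum>i<n. (norm (X i))\<^sup>2 / 2) - real n / 2)"
    by (intro mult_left_mono) auto
  also have "\<dots> = 2 * real n * (\<Sum>i<n. (norm (X i))\<^sup>2 / 2) - (real n)\<^sup>2"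
    by (simp add: right_diff_distrib power2_eq_square)
  finally show ?thesis
    using pair_energy_lower_bound[OF n inj] by (simp add: energy_eq_gas_energy gas_energy_def)
qed

lemma integral_m0_pair_ln: "(LINT x|m0. (LINT y|m0. ln (norm (x - y)))) = - 1/4"
  using integral_disc_potential by (simp add: disc_potential_def)

text \<open>Jensen's inequality with respect to independent uniform points of the disc, whose mean
  energy is at most \<open>3/8 * n\<^sup>2\<close>.\<close>
lemma partition_fun_lower_bound:
  assumes \<beta>: "0 < \<beta>"
  shows "ennreal (pi ^ n * exp (- \<beta> * (3/8 * (real n)\<^sup>2))) \<le> partition_fun \<beta> n"
proof -
  let ?\<mu> = "m0_configs {..<n}"
  interpret \<mu>: prob_space ?\<mu> by (rule prob_space_m0_configs)
  have kl: "integrable m0 (\<lambda>y. ln (norm (x - y)))" for x by (rule integrable_m0_ln)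
  have i2: "integrable ?\<mu> (\<lambda>Y. ln (norm (Y i - Y j)))" and e2: "(LINT Y|?\<mu>. ln (norm (Y i - Y j))) = - 1/4"
    if "i < n" "j < n" "i \<noteq> j" for i j
    using integrable_m0_configs_pair[of "\<lambda>x y. ln (norm (x - y))", OF measurable_ln_pair kl integral_m0_abs_ln_le, of "{..<n}" i j]
      integral_m0_configs_pair[of "\<lambda>x y. ln (norm (x - y))", OF measurable_ln_pair kl integral_m0_abs_ln_le, of "{..<n}" i j] that
    by (auto simp: integral_m0_pair_ln)
  have sq: "integrable m0 (\<lambda>y. (norm y)\<^sup>2 / 2)" by (intro integrable_m0_continuous continuous_intros) auto
  have i1: "integrable ?\<mu> (\<lambda>Y. (norm (Y i))\<^sup>2 / 2)" and e1: "(LINT Y|?\<mu>. (norm (Y i))\<^sup>2 / 2) = 1/4" if "i < n" for i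
    using integrable_m0_configs_one[OF _ sq] integral_m0_configs_one[OF _ sq] integral_m0_norm_sq that by auto
  have iP: "integrable ?\<mu> (\<lambda>Y. \<Sum>i<n. \<Sum>j\<in>{..<n} - {i}. - ln (norm (Y i - Y j)))"
    by (intro Bochner_Integration.integrable_sum Bochner_Integration.integrable_minus i2) auto
  have iM: "integrable ?\<mu> (\<lambda>Y. \<Sum>i<n. (norm (Y i))\<^sup>2 / 2)"
    by (intro Bochner_Integration.integrable_sum i1) auto
  have iE: "integrable ?\<mu> (energy n)"
    unfolding energy_def[abs_def]
    by (intro Bochner_Integration.integrable_add integrable_mult_right iP iM)
  have "(LINT Y|?\<mu>. energy n Y) = 1/2 * (LINT Y|?\<mu>. (\<Sum>i<n. \<Sum>j\<in>{..<n} - {i}. - ln (norm (Y i - Y j)))) + real n * (LINT Y|?\<mu>. (\<Sum>i<n. (norm (Y i))\<^sup>2 / 2))"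
    unfolding energy_def using iP iM by simp
  also have "(LINT Y|?\<mu>. (\<Sum>i<n. \<Sum>j\<in>{..<n} - {i}. - ln (norm (Y i - Y j)))) = (\<Sum>i<n. \<Sum>j\<in>{..<n} - {i}. 1/4)"
    by (rule integral_double_sum) (auto intro: i2 simp: e2)
  also have "(LINT Y|?\<mu>. (\<Sum>i<n. (norm (Y i))\<^sup>2 / 2)) = real n / 4"
  proof -
    have "(LINT Y|?\<mu>. (\<Sum>i<n. (norm (Y i))\<^sup>2 / 2)) = (\<Sum>i<n. (LINT Y|?\<mu>. (norm (Y i))\<^sup>2 / 2))"
      by (rule Bochner_Integration.integral_sum) (auto intro!: i1)
    also have "\<dots> = (\<Sum>i<n. 1/4)" by (intro sum.cong refl e1) auto
    finally show ?thesis by simp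
  qed
  also have "1/2 * (\<Sum>i<n. \<Sum>j\<in>{..<n} - {i}. 1/4) + real n * (real n / 4) \<le> 3/8 * (real n)\<^sup>2"
    by (cases "n = 0") (auto simp: of_nat_diff Suc_leI power2_eq_square algebra_simps)
  finally have EE: "(LINT Y|?\<mu>. energy n Y) \<le> 3/8 * (real n)\<^sup>2" .
  have "ennreal (exp (- \<beta> * (3/8 * (real n)\<^sup>2))) \<le> ennreal (exp (LINT Y|?\<mu>. - \<beta> * energy n Y))"
    using EE \<beta> by (intro ennreal_leI) simp
  also have "\<dots> \<le> (\<integral>\<^sup>+Y. ennreal (exp (- \<beta> * energy n Y)) \<partial>?\<mu>)"
    by (rule jensen_exp[OF prob_space_m0_configs]) (intro integrable_mult_right iE)
  finally have "ennreal (pi ^ n) * ennreal (exp (- \<beta> * (3/8 * (real n)\<^sup>2))) \<le> ennreal (pi ^ card {..<n}) * (\<integral>\<^sup>+Y. ennreal (exp (- \<beta> * energy n Y)) \<partial>?\<mu>)"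
    by (auto intro: mult_left_mono)
  also have "\<dots> \<le> (\<integral>\<^sup>+X. ennreal (exp (- \<beta> * energy n X)) \<partial>configs {..<n})"
    using measurable_energy[of n] unfolding config_measure_def by (intro nn_integral_m0_configs_le) auto
  finally show ?thesis
    by (simp add: partition_fun_def config_measure_def ennreal_mult)
qed

section \<open>Mean energy and mean second moment\<close>

lemma sets_gibbs [measurable_cong, simp]: "sets (gibbs \<beta> n) = sets (configs {..<n})"
  by (simp add: gibbs_def config_measure_def)

text \<open>Multiplying by the partition function instead of dividing by it keeps the calculations
  free of quotients of extended reals.\<close>
lemma nn_integral_gibbs:
  assumes \<beta>: "0 < \<beta>" and F: "F \<in> borel_measurable (configs {..<n})"
  shows "(\<integral>\<^sup>+X. F X \<partial>gibbs \<beta> n) * partition_fun \<beta> n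
    = (\<integral>\<^sup>+X. ennreal (exp (- \<beta> * gas_energy (real n) {..<n} X)) * F X \<partial>configs {..<n})"
proof -
  let ?Z = "partition_fun \<beta> n"
  have Z: "?Z \<noteq> 0" "?Z < top" using partition_fun_pos partition_fun_finite[OF \<beta>] by auto
  have "(\<integral>\<^sup>+X. F X \<partial>gibbs \<beta> n) = (\<integral>\<^sup>+X. ennreal (exp (- \<beta> * gas_energy (real n) {..<n} X)) / ?Z * F X \<partial>configs {..<n})"
    unfolding gibbs_def config_measure_def energy_eq_gas_energy using F by (subst nn_integral_density) auto
  also have "\<dots> = (\<integral>\<^sup>+X. (ennreal (exp (- \<beta> * gas_energy (real n) {..<n} X)) * F X) / ?Z \<partial>configs {..<n})"
    by (simp add: divide_ennreal_def mult_ac)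
  also have "\<dots> = (\<integral>\<^sup>+X. ennreal (exp (- \<beta> * gas_energy (real n) {..<n} X)) * F X \<partial>configs {..<n}) / ?Z"
    using F by (intro nn_integral_divide) auto
  finally have eq: "(\<integral>\<^sup>+X. F X \<partial>gibbs \<beta> n) = (\<integral>\<^sup>+X. ennreal (exp (- \<beta> * gas_energy (real n) {..<n} X)) * F X \<partial>configs {..<n}) / ?Z" .
  have "A / ?Z * ?Z = A * (?Z / ?Z)" for A
    by (simp only: divide_ennreal_def mult_ac)
  then show ?thesis unfolding eq using ennreal_divide_self[OF Z] by simp
qed

lemma AE_gibbs: "AE X in configs {..<n}. P X \<Longrightarrow> AE X in gibbs \<beta> n. P X"
  unfolding gibbs_def config_measure_def energy_eq_gas_energy
  by (subst AE_density) (auto elim: eventually_mono)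

lemma AE_gibbs_distinct: "AE X in gibbs \<beta> n. inj_on X {..<n}"
  by (intro AE_gibbs AE_configs_distinct) simp

definition second_moment :: "nat \<Rightarrow> (nat \<Rightarrow> real^2) \<Rightarrow> real" where
  "second_moment n X = (\<Sum>i<n. (norm (X i))\<^sup>2)"

lemma second_moment_measurable [measurable]: "second_moment n \<in> borel_measurable (configs {..<n})"
  unfolding second_moment_def[abs_def]
  by (intro borel_measurable_sum borel_measurable_power borel_measurable_norm component_measurable) auto

lemma second_moment_nonneg: "0 \<le> second_moment n X"
  by (simp add: second_moment_def sum_nonneg)

lemma gas_energy_moment: "gas_energy a {..<n} X = pair_energy {..<n} X + a * second_moment n X / 2"
  by (simp add: gas_energy_def second_moment_def sum_divide_distrib[symmetric])

lemma energy_moment: "energy n X = pair_energy {..<n} X + real n * second_moment n X / 2"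
  by (simp add: energy_eq_gas_energy gas_energy_moment)

lemma energy_measurable [measurable]: "energy n \<in> borel_measurable (configs {..<n})"
  using measurable_energy[of n] by (simp add: config_measure_def)

text \<open>After a shift that makes it nonnegative, the energy is dominated by the exponential of
  \<open>\<beta> / 2\<close> times itself. Energy times Boltzmann factor is thus dominated by the Boltzmann
  factor at \<open>\<beta> / 2\<close>, which has a finite integral.\<close>
lemma
  assumes \<beta>: "0 < \<beta>" and n: "1 \<le> n"
  shows integrable_gibbs_energy: "integrable (gibbs \<beta> n) (energy n)"
    and integrable_gibbs_moment: "integrable (gibbs \<beta> n) (second_moment n)"
proof -
  interpret prob_space "gibbs \<beta> n" by (rule prob_space_gibbs[OF \<beta>])
  define G where "G X = energy n X + (real n)\<^sup>2" for X
  have Gm [measurable]: "G \<in> borel_measurable (configs {..<n})" unfolding G_def[abs_def] by measurable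
  have lb: "real n / 4 * second_moment n X \<le> G X" for X
  proof -
    have "(\<Sum>i<n. real n * ((norm (X i))\<^sup>2 / 4 - 1)) = real n / 4 * second_moment n X - (real n)\<^sup>2"
      by (simp add: second_moment_def sum_subtractf right_diff_distrib sum_distrib_left power2_eq_square)
    then show ?thesis using energy_lower_bound[of n X] by (simp add: G_def)
  qed
  have G0: "0 \<le> G X" for X
    using lb[of X] second_moment_nonneg[of n X] n by (meson divide_nonneg_pos mult_nonneg_nonneg of_nat_0_le_iff order_trans zero_less_numeral)
  have fin: "(\<integral>\<^sup>+X. ennreal (G X) \<partial>gibbs \<beta> n) < \<infinity>"
  proof -
    have "(\<integral>\<^sup>+X. ennreal (G X) \<partial>gibbs \<beta> n) * partition_fun \<beta> n
      = (\<integral>\<^sup>+X. ennreal (exp (- \<beta> * gas_energy (real n) {..<n} X)) * ennreal (G X) \<partial>configs {..<n})"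
      by (rule nn_integral_gibbs[OF \<beta>]) measurable
    also have "\<dots> \<le> (\<integral>\<^sup>+X. ennreal (2 / \<beta> * exp (\<beta> / 2 * (real n)\<^sup>2)) * ennreal (exp (- (\<beta> / 2) * gas_energy (real n) {..<n} X)) \<partial>configs {..<n})"
    proof (rule nn_integral_mono)
      fix X :: "nat \<Rightarrow> real^2"
      have "\<beta> / 2 * G X \<le> exp (\<beta> / 2 * G X)" using exp_ge_add_one_self[of "\<beta> / 2 * G X"] by linarith
      then have "G X \<le> 2 / \<beta> * exp (\<beta> / 2 * G X)" using \<beta> by (simp add: field_simps)
      then have "exp (- \<beta> * energy n X) * G X \<le> exp (- \<beta> * energy n X) * (2 / \<beta> * exp (\<beta> / 2 * G X))"
        by (intro mult_left_mono) auto
      also have "\<dots> = 2 / \<beta> * exp (- \<beta> * energy n X + \<beta> / 2 * G X)" by (simp only: exp_add mult.left_commute)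
      also have "- \<beta> * energy n X + \<beta> / 2 * G X = \<beta> / 2 * (real n)\<^sup>2 + (- (\<beta> / 2) * energy n X)"
        by (simp add: G_def algebra_simps)
      finally have "exp (- \<beta> * energy n X) * G X \<le> 2 / \<beta> * exp (\<beta> / 2 * (real n)\<^sup>2) * exp (- (\<beta> / 2) * energy n X)"
        by (simp only: exp_add mult.assoc)
      then show "ennreal (exp (- \<beta> * gas_energy (real n) {..<n} X)) * ennreal (G X)
        \<le> ennreal (2 / \<beta> * exp (\<beta> / 2 * (real n)\<^sup>2)) * ennreal (exp (- (\<beta> / 2) * gas_energy (real n) {..<n} X))"
        using \<beta> G0[of X] unfolding energy_eq_gas_energy[symmetric] by (simp add: ennreal_mult[symmetric] ennreal_leI)
    qed
    also have "\<dots> = ennreal (2 / \<beta> * exp (\<beta> / 2 * (real n)\<^sup>2)) * partition_fun (\<beta> / 2) n"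
      unfolding partition_fun_eq gas_partition_def by (rule nn_integral_cmult) measurable
    also have "\<dots> < \<infinity>"
      using partition_fun_finite[of "\<beta> / 2" n] \<beta> by (simp add: ennreal_mult_less_top)
    finally show ?thesis using partition_fun_pos[of \<beta> n] by (auto simp: ennreal_mult_less_top)
  qed
  have iG: "integrable (gibbs \<beta> n) G"
    using fin G0 by (intro integrableI_nonneg) auto
  then have "integrable (gibbs \<beta> n) (\<lambda>X. G X - (real n)\<^sup>2)" by simp
  then show "integrable (gibbs \<beta> n) (energy n)" by (simp add: G_def)
  have "integrable (gibbs \<beta> n) (\<lambda>X. 4 / real n * G X)" using iG by (rule integrable_mult_right)
  then show "integrable (gibbs \<beta> n) (second_moment n)"
  proof (rule Bochner_Integration.integrable_bound)
    show "AE X in gibbs \<beta> n. norm (second_moment n X) \<le> norm (4 / real n * G X)"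
    proof (rule AE_I2)
      fix X
      have "second_moment n X \<le> 4 / real n * G X" using lb[of X] n by (simp add: field_simps)
      then show "norm (second_moment n X) \<le> norm (4 / real n * G X)"
        using second_moment_nonneg[of n X] abs_ge_self[of "4 / real n * G X"]
        unfolding real_norm_def by linarith
    qed
  qed measurable
qed

text \<open>Multiplying the confinement by \<open>c\<close> changes the partition function by an exact power of
  \<open>c\<close>, whereas Jensen's inequality bounds this change by the exponential of the mean second
  moment. The two agree at \<open>c = 1\<close> and the inequality holds on both sides of it, so their
  derivatives there agree.\<close>
lemma virial_identity:
  assumes \<beta>: "0 < \<beta>" and n: "1 \<le> n"
  shows "\<beta> * real n * (LINT X|gibbs \<beta> n. second_moment n X) / 2 = scaling_exponent \<beta> n"
proof -
  define m2 where "m2 = (LINT X|gibbs \<beta> n. second_moment n X)"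
  define K where "K = \<beta> * real n * m2 / 2"
  define e where "e = scaling_exponent \<beta> n"
  have ineq: "e * ln c \<le> K * (c - 1)" if c: "0 < c" for c
  proof -
    let ?Z = "partition_fun \<beta> n"
    define gp where "gp = gas_partition \<beta> (c * real n) {..<n}"
    have Zs: "?Z = ennreal (c powr e) * gp"
      unfolding gp_def e_def partition_fun_eq
      by (rule gas_partition_scale[OF _ c, of "{..<n}", unfolded card_lessThan]) simp
    have "?Z \<noteq> 0" "?Z < top" using partition_fun_pos partition_fun_finite[OF \<beta>] by auto
    then have "gp \<noteq> 0" "gp < top" using c unfolding Zs by (auto simp: ennreal_mult_less_top)
    then obtain g where g: "gp = ennreal g" "0 < g"
      by (cases gp) (auto simp: ennreal_eq_0_iff not_le top_unique)
    define F where "F X = exp (- (\<beta> * (c - 1) * real n / 2) * second_moment n X)" for X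
    have "(\<integral>\<^sup>+X. ennreal (F X) \<partial>gibbs \<beta> n) * ?Z
      = (\<integral>\<^sup>+X. ennreal (exp (- \<beta> * gas_energy (real n) {..<n} X)) * ennreal (F X) \<partial>configs {..<n})"
      unfolding F_def by (rule nn_integral_gibbs[OF \<beta>]) measurable
    also have "\<dots> = gp"
      unfolding gp_def gas_partition_def
    proof (intro nn_integral_cong)
      fix X :: "nat \<Rightarrow> real^2"
      have "- \<beta> * gas_energy (real n) {..<n} X + - (\<beta> * (c - 1) * real n / 2) * second_moment n X = - \<beta> * gas_energy (c * real n) {..<n} X"
        unfolding gas_energy_moment by (simp add: field_simps)
      then show "ennreal (exp (- \<beta> * gas_energy (real n) {..<n} X)) * ennreal (F X) = ennreal (exp (- \<beta> * gas_energy (c * real n) {..<n} X))"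
        unfolding F_def by (simp only: ennreal_mult[symmetric] exp_ge_zero exp_add[symmetric])
    qed
    finally have FZ: "(\<integral>\<^sup>+X. ennreal (F X) \<partial>gibbs \<beta> n) * ?Z = gp" .
    have "ennreal (exp (LINT X|gibbs \<beta> n. - (\<beta> * (c - 1) * real n / 2) * second_moment n X)) \<le> (\<integral>\<^sup>+X. ennreal (F X) \<partial>gibbs \<beta> n)"
      unfolding F_def
      by (rule jensen_exp[OF prob_space_gibbs[OF \<beta>]]) (intro integrable_mult_right integrable_gibbs_moment \<beta> n)
    moreover have "(LINT X|gibbs \<beta> n. - (\<beta> * (c - 1) * real n / 2) * second_moment n X) = - (K * (c - 1))"
      unfolding integral_mult_right_zero m2_def[symmetric] by (simp add: K_def)
    ultimately have "ennreal (exp (- (K * (c - 1)))) * (ennreal (c powr e) * ennreal g) \<le> ennreal g"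
      using FZ Zs g by (metis mult_right_mono zero_le)
    then have "exp (- (K * (c - 1))) * (c powr e * g) \<le> g"
      using g by (simp add: ennreal_mult[symmetric])
    then have "exp (- (K * (c - 1))) * c powr e \<le> 1" using g(2) by (simp add: mult.assoc[symmetric])
    moreover have "c powr e = exp (e * ln c)" using c by (simp add: powr_def)
    ultimately have "exp (- (K * (c - 1)) + e * ln c) \<le> 1" by (simp only: exp_add)
    then show ?thesis by simp
  qed
  have "((\<lambda>c. K * (c - 1) - e * ln c) has_real_derivative K - e) (at 1)"
    by (auto intro!: derivative_eq_intros)
  then have "K - e = 0"
  proof (rule DERIV_local_min[where d=1])
    show "\<forall>c. \<bar>1 - c\<bar> < 1 \<longrightarrow> K * (1 - 1) - e * ln 1 \<le> K * (c - 1) - e * ln c"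
      using ineq by (auto simp: abs_less_iff)
  qed simp
  then show ?thesis by (simp add: K_def e_def m2_def)
qed

lemma nn_integral_gauss: "(\<integral>\<^sup>+x. ennreal (exp (- (norm (x::real^2))\<^sup>2)) \<partial>lborel) = ennreal pi"
proof -
  have "(\<integral>\<^sup>+s. ennreal (exp (- s)) * indicator {0..} s \<partial>lborel) = ennreal (0 - - exp (- 0))"
  proof (rule nn_integral_FTC_atLeast)
    have "((\<lambda>s::real. exp (- s)) \<longlongrightarrow> 0) at_top"
      by (rule filterlim_compose[OF exp_at_bot filterlim_uminus_at_bot_at_top])
    from tendsto_minus[OF this] show "((\<lambda>s::real. - exp (- s)) \<longlongrightarrow> 0) at_top" by simp
  qed (auto intro!: derivative_eq_intros)
  then show ?thesis using nn_integral_radial[of "\<lambda>s. ennreal (exp (- s))"] by simp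
qed

text \<open>The Gibbs variational principle: the relative entropy of the Gibbs measure with
  respect to the Gaussian measure with density \<open>exp (- second_moment n X) / pi ^ n\<close> is
  nonnegative. The lower bound for the partition function turns this into an upper bound for
  the mean energy.\<close>
lemma gibbs_energy_upper_bound:
  assumes \<beta>: "0 < \<beta>" and n: "1 \<le> n"
  shows "\<beta> * (LINT X|gibbs \<beta> n. energy n X) \<le> (LINT X|gibbs \<beta> n. second_moment n X) + \<beta> * (3/8 * (real n)\<^sup>2)"
proof -
  interpret prob_space "gibbs \<beta> n" by (rule prob_space_gibbs[OF \<beta>])
  let ?Z = "partition_fun \<beta> n"
  have "?Z \<noteq> 0" "?Z < top" using partition_fun_pos partition_fun_finite[OF \<beta>] by auto
  then obtain z where z: "?Z = ennreal z" "0 < z"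
    by (cases ?Z) (auto simp: ennreal_eq_0_iff not_le top_unique)
  \<comment> \<open>the logarithm of the Gaussian density divided by the Gibbs density\<close>
  define Y where "Y X = \<beta> * energy n X - second_moment n X + (ln z - real n * ln pi)" for X
  have iY: "integrable (gibbs \<beta> n) Y"
    unfolding Y_def[abs_def]
    by (intro Bochner_Integration.integrable_add Bochner_Integration.integrable_diff integrable_mult_right
        integrable_gibbs_energy integrable_gibbs_moment \<beta> n) auto
  have "(\<integral>\<^sup>+X. ennreal (exp (Y X)) \<partial>gibbs \<beta> n) * ?Z
    = (\<integral>\<^sup>+X. ennreal (exp (- \<beta> * gas_energy (real n) {..<n} X)) * ennreal (exp (Y X)) \<partial>configs {..<n})"
    unfolding Y_def by (rule nn_integral_gibbs[OF \<beta>]) measurable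
  also have "\<dots> = (\<integral>\<^sup>+X. ennreal (z / pi ^ n) * (\<Prod>i<n. ennreal (exp (- (norm (X i))\<^sup>2))) \<partial>configs {..<n})"
  proof (intro nn_integral_cong)
    fix X :: "nat \<Rightarrow> real^2"
    have "exp (- \<beta> * energy n X) * exp (Y X) = exp (- second_moment n X + (ln z - real n * ln pi))"
      by (simp add: Y_def mult_exp_exp)
    also have "\<dots> = exp (- second_moment n X) * (z / pi ^ n)"
    proof -
      have "exp (ln z - real n * ln pi) = z / pi ^ n"
        using z(2) by (simp add: exp_diff exp_of_nat_mult)
      then show ?thesis by (simp only: exp_add)
    qed
    also have "exp (- second_moment n X) = (\<Prod>i<n. exp (- (norm (X i))\<^sup>2))"
      by (simp add: second_moment_def sum_negf[symmetric] exp_sum)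
    finally show "ennreal (exp (- \<beta> * gas_energy (real n) {..<n} X)) * ennreal (exp (Y X))
       = ennreal (z / pi ^ n) * (\<Prod>i<n. ennreal (exp (- (norm (X i))\<^sup>2)))"
      using z unfolding energy_eq_gas_energy[symmetric]
      by (simp add: prod_ennreal ennreal_mult[symmetric] prod_nonneg mult.commute)
  qed
  also have "\<dots> = ennreal (z / pi ^ n) * (\<integral>\<^sup>+X. (\<Prod>i<n. ennreal (exp (- (norm (X i))\<^sup>2))) \<partial>configs {..<n})"
  proof (rule nn_integral_cmult, intro borel_measurable_prod_ennreal)
    fix i assume "i \<in> {..<n}"
    then have [measurable]: "(\<lambda>X. X i) \<in> borel_measurable (configs {..<n})" by (rule component_measurable)
    show "(\<lambda>X. ennreal (exp (- (norm (X i))\<^sup>2))) \<in> borel_measurable (configs {..<n})" by measurable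
  qed
  also have "(\<integral>\<^sup>+X. (\<Prod>i<n. ennreal (exp (- (norm (X i))\<^sup>2))) \<partial>configs {..<n}) = (\<Prod>i<n. ennreal pi)"
  proof -
    interpret L: product_sigma_finite "\<lambda>_::nat. lborel :: (real^2) measure" ..
    have "(\<integral>\<^sup>+X. (\<Prod>i<n. ennreal (exp (- (norm (X i))\<^sup>2))) \<partial>configs {..<n}) = (\<Prod>i<n. (\<integral>\<^sup>+x. ennreal (exp (- (norm (x::real^2))\<^sup>2)) \<partial>lborel))"
      by (rule L.product_nn_integral_prod) auto
    then show ?thesis by (simp add: nn_integral_gauss)
  qed
  also have "ennreal (z / pi ^ n) * (\<Prod>i<n. ennreal pi) = ?Z"
    using z by (simp add: ennreal_power ennreal_mult[symmetric])
  finally have "(\<integral>\<^sup>+X. ennreal (exp (Y X)) \<partial>gibbs \<beta> n) * ennreal z = 1 * ennreal z" using z by simp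
  then have "ennreal z * (\<integral>\<^sup>+X. ennreal (exp (Y X)) \<partial>gibbs \<beta> n) = ennreal z * 1"
    by (simp only: mult.commute)
  then have "(\<integral>\<^sup>+X. ennreal (exp (Y X)) \<partial>gibbs \<beta> n) = 1"
    using z(2) by (subst (asm) ennreal_mult_cancel_left) auto
  with jensen_exp[OF prob_space_gibbs[OF \<beta>] iY] have "ennreal (exp (LINT X|gibbs \<beta> n. Y X)) \<le> ennreal 1" by simp
  then have "(LINT X|gibbs \<beta> n. Y X) \<le> 0" by (subst (asm) ennreal_le_iff) auto
  moreover have "(LINT X|gibbs \<beta> n. Y X) = \<beta> * (LINT X|gibbs \<beta> n. energy n X) - (LINT X|gibbs \<beta> n. second_moment n X) + (ln z - real n * ln pi)"
    unfolding Y_def using integrable_gibbs_energy[OF \<beta> n] integrable_gibbs_moment[OF \<beta> n] by (simp add: prob_space)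
  moreover have "real n * ln pi - \<beta> * (3/8 * (real n)\<^sup>2) \<le> ln z"
  proof -
    have "pi ^ n * exp (- \<beta> * (3/8 * (real n)\<^sup>2)) \<le> z"
      using partition_fun_lower_bound[OF \<beta>, of n] z by (simp add: ennreal_le_iff)
    then have "ln (pi ^ n * exp (- \<beta> * (3/8 * (real n)\<^sup>2))) \<le> ln z" using z(2) by (subst ln_le_cancel_iff) auto
    then show ?thesis by (simp add: ln_mult ln_realpow)
  qed
  ultimately show ?thesis by linarith
qed

lemma gibbs_energy_lower_bound:
  assumes \<beta>: "0 < \<beta>" and n: "1 \<le> n"
  shows "3/8 * (real n)\<^sup>2 - real n * ln (real n) - 3 * real n \<le> (LINT X|gibbs \<beta> n. energy n X)"
proof -
  interpret prob_space "gibbs \<beta> n" by (rule prob_space_gibbs[OF \<beta>])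
  have "(LINT X|gibbs \<beta> n. 3/8 * (real n)\<^sup>2 - real n * ln (real n) - 3 * real n) \<le> (LINT X|gibbs \<beta> n. energy n X)"
  proof (rule integral_mono_AE[OF _ integrable_gibbs_energy[OF \<beta> n]])
    show "AE X in gibbs \<beta> n. 3/8 * (real n)\<^sup>2 - real n * ln (real n) - 3 * real n \<le> energy n X"
      using AE_gibbs_distinct by eventually_elim (rule energy_lower_bound_precise[OF n])
  qed simp
  then show ?thesis by (simp add: prob_space)
qed

lemma mean_second_moment:
  assumes \<beta>: "0 < \<beta>" and n: "1 \<le> n"
  shows "(LINT X|gibbs \<beta> n. second_moment n X) \<le> real n * (2 / \<beta> + 1/2)"
    and "(LINT X|gibbs \<beta> n. second_moment n X) = 2 / \<beta> + (real n - 1) / 2"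
proof -
  show e: "(LINT X|gibbs \<beta> n. second_moment n X) = 2 / \<beta> + (real n - 1) / 2"
  proof -
    define m where "m = (LINT X|gibbs \<beta> n. second_moment n X)"
    have "real n * (\<beta> * m / 2) = real n * (1 + \<beta> * (real n - 1) / 4)"
      using virial_identity[OF \<beta> n] by (simp add: scaling_exponent_def m_def field_simps)
    then have "\<beta> * m / 2 = 1 + \<beta> * (real n - 1) / 4" using n by simp
    then show ?thesis unfolding m_def[symmetric] using \<beta> by (simp add: field_simps)
  qed
  have "2 / \<beta> * 1 \<le> 2 / \<beta> * real n" using \<beta> n by (intro mult_left_mono) auto
  then show "(LINT X|gibbs \<beta> n. second_moment n X) \<le> real n * (2 / \<beta> + 1/2)"
    unfolding e by (simp add: distrib_left diff_divide_distrib mult.commute)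
qed

section \<open>Ratios of partition functions\<close>

text \<open>Every pair is counted by both of its particles, the confinement once by each.\<close>
lemma sum_added_energy:
  "(\<Sum>i<n. added_energy (real n) ({..<n} - {i}) X (X i)) = 2 * energy n X - real n * second_moment n X / 2"
proof -
  have "(\<Sum>i<n. added_energy (real n) ({..<n} - {i}) X (X i))
    = (\<Sum>i<n. \<Sum>j\<in>{..<n} - {i}. - ln (norm (X i - X j))) + real n * (\<Sum>i<n. (norm (X i))\<^sup>2 / 2)"
    unfolding added_energy_def sum.distrib by (simp only: sum_distrib_left)
  also have "(\<Sum>i<n. (norm (X i))\<^sup>2 / 2) = second_moment n X / 2"
    by (simp add: second_moment_def sum_divide_distrib[symmetric])
  finally show ?thesis
    by (simp add: energy_moment pair_energy_def)
qed

text \<open>Jensen's inequality for the choice of a particle uniformly at random.\<close>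
lemma exp_mean_le:
  fixes b :: "nat \<Rightarrow> real"
  assumes n: "1 \<le> n"
  shows "real n * exp ((\<Sum>i<n. b i) / real n) \<le> (\<Sum>i<n. exp (b i))"
proof -
  define m where "m = (\<Sum>i<n. b i) / real n"
  have nm: "(\<Sum>i<n. b i) = real n * m" using n by (simp add: m_def)
  have "(\<Sum>i<n. exp m * (1 + (b i - m))) \<le> (\<Sum>i<n. exp (b i))"
  proof (rule sum_mono)
    fix i
    have "exp m * (1 + (b i - m)) \<le> exp m * exp (b i - m)"
      by (intro mult_left_mono exp_ge_add_one_self) simp
    then show "exp m * (1 + (b i - m)) \<le> exp (b i)" by (simp add: mult_exp_exp)
  qed
  moreover have "(\<Sum>i<n. exp m * (1 + (b i - m))) = real n * exp m"
    unfolding sum_distrib_left[symmetric] by (simp add: sum.distrib sum_subtractf nm)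
  ultimately show ?thesis by (simp add: m_def)
qed

text \<open>By symmetry of the energy the result does not depend on which particle is removed.\<close>
lemma gibbs_remove_particle:
  assumes \<beta>: "0 < \<beta>" and i: "i < n" and g: "g \<in> borel_measurable borel"
  shows "(\<integral>\<^sup>+X. ennreal (exp (\<beta> * added_energy (real n) ({..<n} - {i}) X (X i))) * g (X i) \<partial>gibbs \<beta> n) * partition_fun \<beta> n
    = (\<integral>\<^sup>+x. g x \<partial>lborel) * gas_partition \<beta> (real n) {..<n - 1}"
proof -
  define I where "I = {..<n} - {i}"
  have I: "finite I" "i \<notin> I" "insert i I = {..<n}" "card I = n - 1" using i by (auto simp: I_def)
  have [measurable]: "(\<lambda>X. X i) \<in> borel_measurable (configs {..<n})" using i by (intro component_measurable) simp
  note [measurable] = g added_energy_pair_measurable[OF I(1), of "real n" i, unfolded I(3)]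
  have "(\<integral>\<^sup>+X. ennreal (exp (\<beta> * added_energy (real n) I X (X i))) * g (X i) \<partial>gibbs \<beta> n) * partition_fun \<beta> n
    = (\<integral>\<^sup>+X. ennreal (exp (- \<beta> * gas_energy (real n) {..<n} X)) * (ennreal (exp (\<beta> * added_energy (real n) I X (X i))) * g (X i)) \<partial>configs {..<n})"
    by (rule nn_integral_gibbs[OF \<beta>]) measurable
  also have "\<dots> = (\<integral>\<^sup>+x. g x \<partial>lborel) * gas_partition \<beta> (real n) I"
    using gas_partition_remove[OF I(1,2) g, of \<beta> "real n"] unfolding I(3) .
  also have "gas_partition \<beta> (real n) I = gas_partition \<beta> (real n) {..<n - 1}"
    using I by (intro gas_partition_card) auto
  finally show ?thesis by (simp add: I_def)
qed

lemma nn_integral_added_energy_measurable: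
  "(\<lambda>X. \<integral>\<^sup>+x. ennreal (exp (- \<beta> * added_energy a {..<n} X x)) \<partial>lborel) \<in> borel_measurable (configs {..<n})"
proof -
  have "(\<lambda>(X, x). ennreal (exp (- \<beta> * added_energy a {..<n} X x))) \<in> borel_measurable (configs {..<n} \<Otimes>\<^sub>M lborel)"
    unfolding added_energy_def case_prod_beta
    by (intro borel_measurable_times borel_measurable_add borel_measurable_sum borel_measurable_const borel_measurable_uminus
        borel_measurable_ln borel_measurable_norm borel_measurable_diff measurable_compose[OF measurable_fst component_measurable]
        borel_measurable_divide borel_measurable_power borel_measurable_exp measurable_compose[OF _ measurable_ennreal]
        measurable_compose[OF measurable_snd]) auto
  then show ?thesis by (rule lborel.borel_measurable_nn_integral)
qed

lemma gibbs_insert_particle: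
  assumes \<beta>: "0 < \<beta>"
  shows "(\<integral>\<^sup>+X. (\<integral>\<^sup>+x. ennreal (exp (- \<beta> * added_energy (real n) {..<n} X x)) \<partial>lborel) \<partial>gibbs \<beta> n) * partition_fun \<beta> n
    = gas_partition \<beta> (real n) {..<Suc n}"
proof -
  have "gas_partition \<beta> (real n) (insert n {..<n}) = (\<integral>\<^sup>+X. ennreal (exp (- \<beta> * gas_energy (real n) {..<n} X))
      * (\<integral>\<^sup>+x. ennreal (exp (- \<beta> * added_energy (real n) {..<n} X x)) \<partial>lborel) \<partial>configs {..<n})"
    by (rule gas_partition_insert) auto
  then show ?thesis
    using nn_integral_gibbs[OF \<beta> nn_integral_added_energy_measurable] by (simp add: lessThan_Suc)
qed

text \<open>Jensen's inequality is applied to the choice of the removed particle and to the Gibbs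
  measure. The exponent then consists of the mean energy, bounded below up to \<open>n * ln n\<close>,
  and of the mean second moment, known exactly; after division by \<open>n\<close> they give \<open>\<beta> * n / 2\<close>
  up to a multiple of \<open>ln n\<close>. The Gaussian weight makes the integral over the position of
  the removed particle finite.\<close>
lemma removal_lower_bound:
  assumes \<beta>: "0 < \<beta>" and n: "1 \<le> n"
  shows "ennreal (exp (\<beta> * real n / 2 - 2 * \<beta> * ln (real n) - (6 * \<beta> + 2 + 2 / \<beta>))) * partition_fun \<beta> n
    \<le> ennreal pi * gas_partition \<beta> (real n) {..<n - 1}"
proof -
  interpret prob_space "gibbs \<beta> n" by (rule prob_space_gibbs[OF \<beta>])
  define m2 where "m2 = (LINT X|gibbs \<beta> n. second_moment n X)"
  define EH where "EH = (LINT X|gibbs \<beta> n. energy n X)"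
  let ?gp = "gas_partition \<beta> (real n) {..<n - 1}"
  let ?Z = "partition_fun \<beta> n"
  let ?b = "\<lambda>i X. \<beta> * added_energy (real n) ({..<n} - {i}) X (X i) - (norm (X i))\<^sup>2"
  define T where "T X = (\<Sum>i<n. ?b i X) / real n" for X
  have T_eq: "T X = (2 * \<beta> / real n) * energy n X - (\<beta> / 2 + 1 / real n) * second_moment n X" for X
  proof -
    have "(\<Sum>i<n. ?b i X) = \<beta> * (2 * energy n X - real n * second_moment n X / 2) - second_moment n X"
      unfolding sum_added_energy[symmetric] by (simp only: second_moment_def sum_subtractf sum_distrib_left)
    then show ?thesis using n by (simp add: T_def field_simps)
  qed
  have iT: "integrable (gibbs \<beta> n) T"
    unfolding T_eq[abs_def]
    by (intro Bochner_Integration.integrable_diff integrable_mult_right integrable_gibbs_energy integrable_gibbs_moment \<beta> n)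
  have ET: "(LINT X|gibbs \<beta> n. T X) = (2 * \<beta> / real n) * EH - (\<beta> / 2 + 1 / real n) * m2"
    unfolding T_eq EH_def m2_def using integrable_gibbs_energy[OF \<beta> n] integrable_gibbs_moment[OF \<beta> n] by simp
  have low: "\<beta> * real n / 2 - 2 * \<beta> * ln (real n) - (6 * \<beta> + 2 + 2 / \<beta>) \<le> (LINT X|gibbs \<beta> n. T X)"
  proof -
    have "(2 * \<beta> / real n) * (3/8 * (real n)\<^sup>2 - real n * ln (real n) - 3 * real n) \<le> (2 * \<beta> / real n) * EH"
      using gibbs_energy_lower_bound[OF \<beta> n] \<beta> n by (intro mult_left_mono) (auto simp: EH_def)
    moreover have "(2 * \<beta> / real n) * (3/8 * (real n)\<^sup>2 - real n * ln (real n) - 3 * real n) = 3/4 * \<beta> * real n - 2 * \<beta> * ln (real n) - 6 * \<beta>"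
      using n by (simp add: field_simps power2_eq_square)
    moreover have "\<beta> / 2 * m2 = 1 + \<beta> * (real n - 1) / 4"
      unfolding m2_def mean_second_moment(2)[OF \<beta> n] using \<beta> by (simp add: field_simps)
    moreover have "1 / real n * m2 \<le> 2 / \<beta> + 1/2"
      using mean_second_moment(1)[OF \<beta> n] n by (simp add: m2_def field_simps)
    moreover have "(\<beta> / 2 + 1 / real n) * m2 = \<beta> / 2 * m2 + 1 / real n * m2" by (rule distrib_right)
    moreover have "\<beta> * (real n - 1) / 4 = \<beta> * real n / 4 - \<beta> / 4" by (simp add: field_simps)
    moreover have "3/4 * \<beta> * real n = 3 * (\<beta> * real n / 4)" "\<beta> * real n / 2 = 2 * (\<beta> * real n / 4)" by simp_all
    ultimately show ?thesis unfolding ET using \<beta> by linarith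
  qed
  have "ennreal (exp (\<beta> * real n / 2 - 2 * \<beta> * ln (real n) - (6 * \<beta> + 2 + 2 / \<beta>))) \<le> ennreal (exp (LINT X|gibbs \<beta> n. T X))"
    using low by (intro ennreal_leI) simp
  also have "\<dots> \<le> (\<integral>\<^sup>+X. ennreal (exp (T X)) \<partial>gibbs \<beta> n)"
    by (rule jensen_exp[OF prob_space_gibbs[OF \<beta>] iT])
  finally have "ennreal (real n) * ennreal (exp (\<beta> * real n / 2 - 2 * \<beta> * ln (real n) - (6 * \<beta> + 2 + 2 / \<beta>)))
    \<le> ennreal (real n) * (\<integral>\<^sup>+X. ennreal (exp (T X)) \<partial>gibbs \<beta> n)"
    by (rule mult_left_mono) simp
  also have "\<dots> = (\<integral>\<^sup>+X. ennreal (real n) * ennreal (exp (T X)) \<partial>gibbs \<beta> n)"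
    using iT by (intro nn_integral_cmult[symmetric]) auto
  also have "\<dots> \<le> (\<integral>\<^sup>+X. (\<Sum>i<n. ennreal (exp (\<beta> * added_energy (real n) ({..<n} - {i}) X (X i))) * ennreal (exp (- (norm (X i))\<^sup>2))) \<partial>gibbs \<beta> n)"
  proof (rule nn_integral_mono)
    fix X :: "nat \<Rightarrow> real^2"
    have "real n * exp (T X) \<le> (\<Sum>i<n. exp (?b i X))"
      unfolding T_def by (rule exp_mean_le[OF n])
    then have "ennreal (real n * exp (T X)) \<le> ennreal (\<Sum>i<n. exp (?b i X))" by (rule ennreal_leI)
    also have "\<dots> = (\<Sum>i<n. ennreal (exp (\<beta> * added_energy (real n) ({..<n} - {i}) X (X i))) * ennreal (exp (- (norm (X i))\<^sup>2)))"
      by (subst sum_ennreal[symmetric]) (auto simp: ennreal_mult[symmetric] mult_exp_exp)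
    finally show "ennreal (real n) * ennreal (exp (T X)) \<le> (\<Sum>i<n. ennreal (exp (\<beta> * added_energy (real n) ({..<n} - {i}) X (X i))) * ennreal (exp (- (norm (X i))\<^sup>2)))"
      by (simp add: ennreal_mult)
  qed
  also have "\<dots> = (\<Sum>i<n. (\<integral>\<^sup>+X. ennreal (exp (\<beta> * added_energy (real n) ({..<n} - {i}) X (X i))) * ennreal (exp (- (norm (X i))\<^sup>2)) \<partial>gibbs \<beta> n))"
  proof (rule nn_integral_sum)
    fix i assume i: "i \<in> {..<n}"
    then have [measurable]: "(\<lambda>X. X i) \<in> borel_measurable (configs {..<n})" by (rule component_measurable)
    have "insert i ({..<n} - {i}) = {..<n}" using i by auto
    then have [measurable]: "(\<lambda>X. added_energy (real n) ({..<n} - {i}) X (X i)) \<in> borel_measurable (configs {..<n})"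
      using added_energy_pair_measurable[of "{..<n} - {i}" "real n" i] by simp
    show "(\<lambda>X. ennreal (exp (\<beta> * added_energy (real n) ({..<n} - {i}) X (X i))) * ennreal (exp (- (norm (X i))\<^sup>2))) \<in> borel_measurable (gibbs \<beta> n)"
      by measurable
  qed
  finally have "ennreal (real n) * ennreal (exp (\<beta> * real n / 2 - 2 * \<beta> * ln (real n) - (6 * \<beta> + 2 + 2 / \<beta>))) * ?Z
    \<le> (\<Sum>i<n. (\<integral>\<^sup>+X. ennreal (exp (\<beta> * added_energy (real n) ({..<n} - {i}) X (X i))) * ennreal (exp (- (norm (X i))\<^sup>2)) \<partial>gibbs \<beta> n)) * ?Z"
    by (rule mult_right_mono) simp
  also have "\<dots> = (\<Sum>i<n. ennreal pi * ?gp)"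
    unfolding sum_distrib_right
  proof (intro sum.cong refl)
    fix i assume "i \<in> {..<n}"
    then show "(\<integral>\<^sup>+X. ennreal (exp (\<beta> * added_energy (real n) ({..<n} - {i}) X (X i))) * ennreal (exp (- (norm (X i))\<^sup>2)) \<partial>gibbs \<beta> n) * ?Z = ennreal pi * ?gp"
      using gibbs_remove_particle[OF \<beta>, of i n "\<lambda>x. ennreal (exp (- (norm x)\<^sup>2))"] by (simp add: nn_integral_gauss)
  qed
  also have "\<dots> = ennreal (real n) * (ennreal pi * ?gp)" by (simp add: ennreal_of_nat_eq_real_of_nat)
  finally have "ennreal (real n) * (ennreal (exp (\<beta> * real n / 2 - 2 * \<beta> * ln (real n) - (6 * \<beta> + 2 + 2 / \<beta>))) * ?Z) \<le> ennreal (real n) * (ennreal pi * ?gp)"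
    by (simp only: mult.assoc)
  then have "ennreal (1 / real n) * (ennreal (real n) * (ennreal (exp (\<beta> * real n / 2 - 2 * \<beta> * ln (real n) - (6 * \<beta> + 2 + 2 / \<beta>))) * ?Z)) \<le> ennreal (1 / real n) * (ennreal (real n) * (ennreal pi * ?gp))"
    by (rule mult_left_mono) simp
  moreover have "ennreal (1 / real n) * (ennreal (real n) * A) = A" for A
    using n by (simp add: mult.assoc[symmetric] ennreal_mult[symmetric])
  ultimately show ?thesis by simp
qed

text \<open>Jensen's inequality is applied to a uniform position of the new particle in the disc
  and to the Gibbs measure. The exponent contains the mean of the sum of \<open>disc_potential\<close>
  over the particles, which \<open>pair_energy_lower_bound\<close> bounds from below in terms of the mean
  energy.\<close>
lemma insertion_lower_bound:
  assumes \<beta>: "0 < \<beta>" and n: "1 \<le> n"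
  shows "ennreal (exp (- \<beta> * real n / 2 - \<beta> * ln (real n) - (4 * \<beta> + 2 / \<beta> + 1))) * partition_fun \<beta> n
    \<le> gas_partition \<beta> (real n) {..<Suc n}"
proof -
  interpret prob_space "gibbs \<beta> n" by (rule prob_space_gibbs[OF \<beta>])
  interpret m: prob_space m0 by (rule prob_space_m0)
  define m2 where "m2 = (LINT X|gibbs \<beta> n. second_moment n X)"
  define EH where "EH = (LINT X|gibbs \<beta> n. energy n X)"
  let ?Z = "partition_fun \<beta> n"
  define S where "S X = (\<Sum>j<n. disc_potential (X j))" for X
  have Sm [measurable]: "S \<in> borel_measurable (configs {..<n})"
    unfolding S_def[abs_def]
    by (intro borel_measurable_sum measurable_compose[OF component_measurable disc_potential_measurable])
  have Sb: "\<bar>S X\<bar> \<le> real n + second_moment n X" for X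
  proof -
    have "\<bar>S X\<bar> \<le> (\<Sum>j<n. \<bar>disc_potential (X j)\<bar>)" unfolding S_def by (rule sum_abs)
    also have "\<dots> \<le> (\<Sum>j<n. 1 + (norm (X j))\<^sup>2)"
    proof (rule sum_mono)
      fix j
      show "\<bar>disc_potential (X j)\<bar> \<le> 1 + (norm (X j))\<^sup>2"
        using disc_potential_le[of "X j"] disc_potential_ge[of "X j"] zero_le_power2[of "norm (X j)"]
        by (intro abs_leI) (simp_all add: field_simps)
    qed
    finally show ?thesis by (simp add: sum.distrib second_moment_def)
  qed
  have iS: "integrable (gibbs \<beta> n) S"
  proof (rule Bochner_Integration.integrable_bound)
    show "integrable (gibbs \<beta> n) (\<lambda>X. real n + second_moment n X)"
      by (intro Bochner_Integration.integrable_add integrable_gibbs_moment \<beta> n) simp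
    show "AE X in gibbs \<beta> n. norm (S X) \<le> norm (real n + second_moment n X)"
      using Sb second_moment_nonneg[of n] by (intro AE_I2) simp
  qed measurable
  \<comment> \<open>the lower bound for \<open>S\<close> obtained by solving \<open>pair_energy_lower_bound\<close> for the sum of
    potentials\<close>
  define W where "W = (\<lambda>X. - (1 / real n) * energy n X + second_moment n X / 2 + (- ln (real n) - real n / 8 - 3))"
  have iW: "integrable (gibbs \<beta> n) W"
    unfolding W_def
    by (intro Bochner_Integration.integrable_add integrable_mult_right Bochner_Integration.integrable_divide
        integrable_gibbs_energy integrable_gibbs_moment \<beta> n) simp
  have "AE X in gibbs \<beta> n. W X \<le> S X"
    using AE_gibbs_distinct
  proof eventually_elim
    case (elim X)
    have "2 * real n * W X = - 2 * energy n X + real n * second_moment n X - 2 * (real n * ln (real n)) - (real n)\<^sup>2 / 4 - 6 * real n"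
      using n by (simp add: W_def field_simps power2_eq_square)
    also have "\<dots> = - 2 * pair_energy {..<n} X - 2 * (real n * ln (real n)) - (real n)\<^sup>2 / 4 - 6 * real n"
      by (simp add: energy_moment)
    also have "\<dots> \<le> 2 * real n * S X"
      using pair_energy_lower_bound[OF n elim] by (simp add: S_def)
    finally show ?case using n by simp
  qed
  then have WS: "(LINT X|gibbs \<beta> n. W X) \<le> (LINT X|gibbs \<beta> n. S X)"
    by (rule integral_mono_AE[OF iW iS])
  have EW: "(LINT X|gibbs \<beta> n. W X) = - (1 / real n) * EH + m2 / 2 + (- ln (real n) - real n / 8 - 3)"
    unfolding W_def EH_def m2_def using integrable_gibbs_energy[OF \<beta> n] integrable_gibbs_moment[OF \<beta> n] by (simp add: prob_space)
  have low: "- \<beta> * real n / 2 - \<beta> * ln (real n) - (4 * \<beta> + 2 / \<beta> + 1) \<le> \<beta> * (LINT X|gibbs \<beta> n. S X) - \<beta> * real n / 4"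
  proof -
    have "\<beta> * EH / real n \<le> (m2 + \<beta> * (3/8 * (real n)\<^sup>2)) / real n"
      using gibbs_energy_upper_bound[OF \<beta> n] by (intro divide_right_mono) (auto simp: EH_def m2_def)
    also have "\<dots> = m2 / real n + 3/8 * \<beta> * real n" using n by (simp add: field_simps power2_eq_square)
    also have "m2 / real n \<le> 2 / \<beta> + 1/2"
      using mean_second_moment(1)[OF \<beta> n] n by (simp add: m2_def field_simps)
    finally have 1: "\<beta> * EH / real n \<le> 2 / \<beta> + 1/2 + 3/8 * \<beta> * real n" by simp
    have 2: "\<beta> * (m2 / 2) = 1 + \<beta> * real n / 4 - \<beta> / 4"
      unfolding m2_def mean_second_moment(2)[OF \<beta> n] using \<beta> by (simp add: field_simps)
    have "\<beta> * (LINT X|gibbs \<beta> n. W X) \<le> \<beta> * (LINT X|gibbs \<beta> n. S X)"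
      using WS \<beta> by (intro mult_left_mono) auto
    moreover have "\<beta> * (LINT X|gibbs \<beta> n. W X) = - (\<beta> * EH / real n) + \<beta> * (m2 / 2) - \<beta> * ln (real n) - \<beta> * real n / 8 - 3 * \<beta>"
      unfolding EW by (simp add: algebra_simps)
    moreover have "3/8 * \<beta> * real n = 3 * (\<beta> * real n / 8)" "\<beta> * real n / 4 = 2 * (\<beta> * real n / 8)" "- \<beta> * real n / 2 = - 4 * (\<beta> * real n / 8)" by simp_all
    ultimately show ?thesis using 1 2 \<beta> by linarith
  qed
  have inner: "ennreal (exp (\<beta> * S X - \<beta> * real n / 4)) \<le> (\<integral>\<^sup>+x. ennreal (exp (- \<beta> * added_energy (real n) {..<n} X x)) \<partial>lborel)" for X
  proof -
    have il: "integrable m0 (\<lambda>x. - ln (norm (x - X j)))" for j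
      using integrable_m0_ln[of "X j"] by (simp add: norm_minus_commute)
    have iq: "integrable m0 (\<lambda>x. (norm x)\<^sup>2 / 2)" by (intro integrable_m0_continuous continuous_intros) auto
    have ia: "integrable m0 (added_energy (real n) {..<n} X)"
      unfolding added_energy_def[abs_def]
      by (intro Bochner_Integration.integrable_add integrable_mult_right Bochner_Integration.integrable_sum il iq)
    have "(LINT x|m0. added_energy (real n) {..<n} X x) = (\<Sum>j<n. (LINT x|m0. - ln (norm (x - X j)))) + real n * (LINT x|m0. (norm x)\<^sup>2 / 2)"
      unfolding added_energy_def
      by (subst Bochner_Integration.integral_add[OF Bochner_Integration.integrable_sum[OF il] integrable_mult_right[OF iq]])
         (simp only: Bochner_Integration.integral_sum[OF il] integral_mult_right_zero)
    also have "(\<Sum>j<n. (LINT x|m0. - ln (norm (x - X j)))) = - S X"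
      by (simp add: S_def disc_potential_def sum_negf norm_minus_commute)
    also have "(LINT x|m0. (norm x)\<^sup>2 / 2) = 1/4" using integral_m0_norm_sq by simp
    finally have E: "(LINT x|m0. added_energy (real n) {..<n} X x) = - S X + real n * (1/4)" .
    have "(LINT x|m0. - \<beta> * added_energy (real n) {..<n} X x) = \<beta> * S X - \<beta> * real n / 4"
      unfolding integral_mult_right_zero E by (simp add: algebra_simps)
    then have "ennreal (exp (\<beta> * S X - \<beta> * real n / 4)) \<le> (\<integral>\<^sup>+x. ennreal (exp (- \<beta> * added_energy (real n) {..<n} X x)) \<partial>m0)"
      using jensen_exp[OF prob_space_m0, of "\<lambda>x. - \<beta> * added_energy (real n) {..<n} X x"] ia by simp
    also have "\<dots> = (\<integral>\<^sup>+x. ennreal (indicator (cball 0 1) x / pi) * ennreal (exp (- \<beta> * added_energy (real n) {..<n} X x)) \<partial>lborel)"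
      by (rule nn_integral_m0) measurable
    also have "\<dots> \<le> (\<integral>\<^sup>+x. 1 * ennreal (exp (- \<beta> * added_energy (real n) {..<n} X x)) \<partial>lborel)"
    proof (intro nn_integral_mono mult_right_mono)
      fix x :: "real^2"
      have "indicator (cball 0 1) x / pi \<le> 1" using pi_gt3 by (auto split: split_indicator)
      then show "ennreal (indicator (cball 0 1) x / pi) \<le> 1" using ennreal_leI by fastforce
    qed simp
    finally show ?thesis by simp
  qed
  have "ennreal (exp (- \<beta> * real n / 2 - \<beta> * ln (real n) - (4 * \<beta> + 2 / \<beta> + 1))) \<le> ennreal (exp (LINT X|gibbs \<beta> n. \<beta> * S X - \<beta> * real n / 4))"
    using low iS by (intro ennreal_leI) (simp add: prob_space)
  also have "\<dots> \<le> (\<integral>\<^sup>+X. ennreal (exp (\<beta> * S X - \<beta> * real n / 4)) \<partial>gibbs \<beta> n)"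
    using iS by (intro jensen_exp[OF prob_space_gibbs[OF \<beta>]]) simp
  also have "\<dots> \<le> (\<integral>\<^sup>+X. (\<integral>\<^sup>+x. ennreal (exp (- \<beta> * added_energy (real n) {..<n} X x)) \<partial>lborel) \<partial>gibbs \<beta> n)"
    by (intro nn_integral_mono inner)
  finally have "ennreal (exp (- \<beta> * real n / 2 - \<beta> * ln (real n) - (4 * \<beta> + 2 / \<beta> + 1))) * ?Z
    \<le> (\<integral>\<^sup>+X. (\<integral>\<^sup>+x. ennreal (exp (- \<beta> * added_energy (real n) {..<n} X x)) \<partial>lborel) \<partial>gibbs \<beta> n) * ?Z"
    by (rule mult_right_mono) simp
  then show ?thesis by (simp only: gibbs_insert_particle[OF \<beta>])
qed

lemma ln_ge_half: "2 \<le> N \<Longrightarrow> 1/2 \<le> ln (real N)"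
proof -
  assume "2 \<le> N"
  then have "ln 2 \<le> ln (real N)" by (subst ln_le_cancel_iff) auto
  moreover have "(1/2::real) \<le> ln 2" using ln2_ge_two_thirds by simp
  ultimately show ?thesis by simp
qed

text \<open>The price for correcting the confinement between \<open>n\<close> and \<open>n + 1\<close> in a ratio of
  partition functions for \<open>n\<close> and \<open>n + 1\<close> particles.\<close>
lemma ratio_powr_le:
  assumes n: "1 \<le> n" and \<beta>: "0 < \<beta>"
  shows "(real (Suc n) / real n) powr (scaling_exponent \<beta> (Suc n) - scaling_exponent \<beta> n) \<le> exp (1 + \<beta> / 2)"
proof -
  have e: "scaling_exponent \<beta> (Suc n) - scaling_exponent \<beta> n = 1 + \<beta> * real n / 2"
    by (simp add: scaling_exponent_def field_simps)
  have "ln (real (Suc n) / real n) \<le> 1 / real n"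
    using ln_add_one_self_le_self[of "1 / real n"] n by (simp add: field_simps)
  then have "(1 + \<beta> * real n / 2) * ln (real (Suc n) / real n) \<le> (1 + \<beta> * real n / 2) * (1 / real n)"
    using \<beta> by (intro mult_left_mono) auto
  also have "\<dots> = 1 / real n + \<beta> / 2" using n by (simp add: field_simps)
  also have "\<dots> \<le> 1 + \<beta> / 2" using n by simp
  finally show ?thesis using n unfolding e by (simp add: powr_def)
qed

text \<open>The lower bound for the removal of one of \<open>N + 1\<close> particles, read as an upper bound
  for the insertion into \<open>N\<close> particles; the scaling relation changes the confinement from
  \<open>N + 1\<close> to \<open>N\<close>.\<close>
lemma insertion_ratio:
  assumes \<beta>: "0 < \<beta>"
  obtains A where "0 \<le> A" "\<And>N. 2 \<le> N \<Longrightarrow>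
    gas_partition \<beta> (real N) {..<Suc N} * ennreal (exp (\<beta> * real N / 2)) \<le> ennreal (real N powr A) * partition_fun \<beta> N"
proof
  define C where "C = 6 * \<beta> + 2 + 2 / \<beta>"
  define A where "A = 4 * \<beta> + 2 * (C + 3 + \<beta> / 2)"
  show "0 \<le> A" using \<beta> by (simp add: A_def C_def)
  fix N :: nat assume N: "2 \<le> N"
  define c where "c = real (Suc N) / real N"
  have c: "0 < c" "c * real N = real (Suc N)" using N by (auto simp: c_def)
  define e e' where "e = scaling_exponent \<beta> N" and "e' = scaling_exponent \<beta> (Suc N)"
  define P Q where "P = partition_fun \<beta> (Suc N)" and "Q = gas_partition \<beta> (real (Suc N)) {..<N}"
  define R where "R = \<beta> * real (Suc N) / 2 - 2 * \<beta> * ln (real (Suc N)) - C"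
  have l: "1/2 \<le> ln (real N)" using ln_ge_half[OF N] .
  have 1: "gas_partition \<beta> (real N) {..<Suc N} = ennreal (c powr e') * P"
    unfolding P_def e'_def partition_fun_eq c(2)[symmetric] by (rule gas_partition_scale[OF _ c(1), of "{..<Suc N}", unfolded card_lessThan]) simp
  have 2: "partition_fun \<beta> N = ennreal (c powr e) * Q"
    unfolding Q_def e_def partition_fun_eq c(2)[symmetric] by (rule gas_partition_scale[OF _ c(1), of "{..<N}", unfolded card_lessThan]) simp
  have "ennreal (exp R) * P \<le> ennreal pi * Q"
    using removal_lower_bound[OF \<beta>, of "Suc N"] by (simp add: R_def C_def P_def Q_def)
  then have "ennreal (exp (- R)) * (ennreal (exp R) * P) \<le> ennreal (exp (- R)) * (ennreal pi * Q)"
    by (rule mult_left_mono) simp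
  then have PQ: "P \<le> ennreal (exp (- R) * pi) * Q"
    by (simp add: mult.assoc[symmetric] ennreal_mult[symmetric] mult_exp_exp)
  have num: "c powr e' * exp (\<beta> * real N / 2) * (exp (- R) * pi) \<le> real N powr A * c powr e"
  proof -
    have "c powr (e' - e) \<le> exp (1 + \<beta> / 2)" unfolding c_def e_def e'_def using N \<beta> by (intro ratio_powr_le) auto
    moreover have "exp (\<beta> * real N / 2) * exp (- R) \<le> exp (4 * \<beta> * ln (real N) + C)"
    proof -
      have "ln (real (Suc N)) \<le> ln ((real N)\<^sup>2)"
      proof (subst ln_le_cancel_iff)
        have "real N + 1 \<le> real N * 2" using N by simp
        also have "\<dots> \<le> real N * real N" using N by (intro mult_left_mono) auto
        finally show "real (Suc N) \<le> (real N)\<^sup>2" by (simp add: power2_eq_square)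
      qed (use N in auto)
      then have "ln (real (Suc N)) \<le> 2 * ln (real N)" using N by (simp add: ln_realpow)
      then have "2 * \<beta> * ln (real (Suc N)) \<le> 2 * \<beta> * (2 * ln (real N))" using \<beta> by (intro mult_left_mono) auto
      moreover have "\<beta> * real N / 2 \<le> \<beta> * real (Suc N) / 2" using \<beta> by simp
      ultimately have "\<beta> * real N / 2 - R \<le> 4 * \<beta> * ln (real N) + C" unfolding R_def by (simp add: mult.assoc)
      then show ?thesis by (simp add: mult_exp_exp)
    qed
    moreover have "pi \<le> exp 2" using exp_ge_add_one_self[of "1::real"] pi_less_4 mult_mono[of 2 "exp 1" 2 "exp (1::real)"]
      by (simp add: mult_exp_exp)
    ultimately have "c powr (e' - e) * (exp (\<beta> * real N / 2) * exp (- R)) * pi \<le> exp (1 + \<beta> / 2) * exp (4 * \<beta> * ln (real N) + C) * exp 2"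
      by (intro mult_mono) auto
    also have "\<dots> = exp ((C + 3 + \<beta> / 2) * 1 + 4 * \<beta> * ln (real N))" by (simp add: mult_exp_exp algebra_simps)
    also have "\<dots> \<le> exp ((C + 3 + \<beta> / 2) * (2 * ln (real N)) + 4 * \<beta> * ln (real N))"
      using l \<beta> by (subst exp_le_cancel_iff, intro add_mono mult_left_mono) (auto simp: C_def)
    also have "\<dots> = real N powr A" using N by (simp add: powr_def A_def algebra_simps)
    finally have "c powr (e' - e) * (exp (\<beta> * real N / 2) * exp (- R)) * pi * c powr e \<le> real N powr A * c powr e"
      by (rule mult_right_mono) simp
    moreover have "c powr e' = c powr (e' - e) * c powr e" using c by (simp add: powr_add[symmetric])
    ultimately show ?thesis by (simp add: mult_ac)
  qed
  have "gas_partition \<beta> (real N) {..<Suc N} * ennreal (exp (\<beta> * real N / 2)) = ennreal (c powr e' * exp (\<beta> * real N / 2)) * P"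
    unfolding 1 by (simp add: ennreal_mult mult_ac)
  also have "\<dots> \<le> ennreal (c powr e' * exp (\<beta> * real N / 2)) * (ennreal (exp (- R) * pi) * Q)"
    by (rule mult_left_mono[OF PQ]) simp
  also have "\<dots> = ennreal (c powr e' * exp (\<beta> * real N / 2) * (exp (- R) * pi)) * Q"
    by (simp add: ennreal_mult mult.assoc)
  also have "\<dots> \<le> ennreal (real N powr A * c powr e) * Q"
    by (intro mult_right_mono ennreal_leI num) simp
  also have "\<dots> = ennreal (real N powr A) * partition_fun \<beta> N"
    unfolding 2 by (simp add: ennreal_mult mult.assoc)
  finally show "gas_partition \<beta> (real N) {..<Suc N} * ennreal (exp (\<beta> * real N / 2)) \<le> ennreal (real N powr A) * partition_fun \<beta> N" .
qed

text \<open>Conversely, the lower bound for the insertion into \<open>N - 1\<close> particles is an upper bound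
  for the removal of one of \<open>N\<close> particles.\<close>
lemma removal_ratio:
  assumes \<beta>: "0 < \<beta>"
  obtains A where "0 \<le> A" "\<And>N. 2 \<le> N \<Longrightarrow>
    gas_partition \<beta> (real N) {..<N - 1} * ennreal (exp (- \<beta> * real N / 2)) \<le> ennreal (real N powr A) * partition_fun \<beta> N"
proof
  define C where "C = 4 * \<beta> + 2 / \<beta> + 1"
  define A where "A = \<beta> + 2 * (C + 1 + \<beta> / 2)"
  show "0 \<le> A" using \<beta> by (simp add: A_def C_def)
  fix N :: nat assume N: "2 \<le> N"
  define n where "n = N - 1"
  have n: "1 \<le> n" "N = Suc n" using N by (auto simp: n_def)
  define c where "c = real N / real n"
  have c: "0 < c" "c * real n = real N" using n by (auto simp: c_def)
  define e e' where "e = scaling_exponent \<beta> n" and "e' = scaling_exponent \<beta> N"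
  define G where "G = gas_partition \<beta> (real N) {..<n}"
  define R where "R = - \<beta> * real n / 2 - \<beta> * ln (real n) - C"
  have l: "1/2 \<le> ln (real N)" using ln_ge_half[OF N] .
  have 1: "gas_partition \<beta> (real n) {..<N} = ennreal (c powr e') * partition_fun \<beta> N"
    unfolding e'_def partition_fun_eq c(2)[symmetric] by (rule gas_partition_scale[OF _ c(1), of "{..<N}", unfolded card_lessThan]) simp
  have 2: "partition_fun \<beta> n = ennreal (c powr e) * G"
    unfolding G_def e_def partition_fun_eq c(2)[symmetric] by (rule gas_partition_scale[OF _ c(1), of "{..<n}", unfolded card_lessThan]) simp
  have "ennreal (exp R) * (ennreal (c powr e) * G) \<le> ennreal (c powr e') * partition_fun \<beta> N"
    using insertion_lower_bound[OF \<beta> n(1)]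
    unfolding n(2)[symmetric] 1[symmetric] 2[symmetric] R_def C_def .
  then have "ennreal (exp (- R) * c powr (- e)) * (ennreal (exp R) * (ennreal (c powr e) * G)) \<le> ennreal (exp (- R) * c powr (- e)) * (ennreal (c powr e') * partition_fun \<beta> N)"
    by (rule mult_left_mono) simp
  moreover have "ennreal (exp (- R) * c powr (- e)) * (ennreal (exp R) * (ennreal (c powr e) * G)) = G"
  proof -
    have "exp (- R) * c powr (- e) * (exp R * c powr e) = (exp (- R) * exp R) * (c powr (- e) * c powr e)" by (simp only: mult_ac)
    also have "\<dots> = 1" using c by (simp add: powr_add[symmetric] mult_exp_exp)
    finally have x: "exp (- R) * c powr (- e) * (exp R * c powr e) = 1" .
    have "ennreal (exp (- R) * c powr (- e)) * (ennreal (exp R) * (ennreal (c powr e) * G)) = ennreal (exp (- R) * c powr (- e) * (exp R * c powr e)) * G"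
      by (simp add: ennreal_mult mult.assoc)
    then show ?thesis unfolding x by simp
  qed
  moreover have "ennreal (exp (- R) * c powr (- e)) * (ennreal (c powr e') * partition_fun \<beta> N) = ennreal (exp (- R) * c powr (e' - e)) * partition_fun \<beta> N"
  proof -
    have "exp (- R) * c powr (e' - e) = exp (- R) * c powr (- e) * c powr e'" using c by (simp add: powr_add[symmetric] mult.assoc)
    then show ?thesis by (simp add: ennreal_mult mult.assoc)
  qed
  ultimately have GZ: "G \<le> ennreal (exp (- R) * c powr (e' - e)) * partition_fun \<beta> N" by simp
  have num: "exp (- \<beta> * real N / 2) * (exp (- R) * c powr (e' - e)) \<le> real N powr A"
  proof -
    have "c powr (e' - e) \<le> exp (1 + \<beta> / 2)" unfolding c_def e_def e'_def n(2) using n \<beta> by (intro ratio_powr_le) auto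
    moreover have "exp (- \<beta> * real N / 2) * exp (- R) \<le> exp (\<beta> * ln (real N) + C)"
    proof -
      have "ln (real n) \<le> ln (real N)" using n by (subst ln_le_cancel_iff) auto
      then have "\<beta> * ln (real n) \<le> \<beta> * ln (real N)" using \<beta> by (intro mult_left_mono) auto
      moreover have "\<beta> * real n / 2 \<le> \<beta> * real N / 2" using \<beta> n by simp
      ultimately have "- \<beta> * real N / 2 - R \<le> \<beta> * ln (real N) + C" unfolding R_def by simp
      then show ?thesis by (simp add: mult_exp_exp)
    qed
    ultimately have "exp (- \<beta> * real N / 2) * exp (- R) * c powr (e' - e) \<le> exp (\<beta> * ln (real N) + C) * exp (1 + \<beta> / 2)"
      by (intro mult_mono) auto
    also have "\<dots> = exp ((C + 1 + \<beta> / 2) * 1 + \<beta> * ln (real N))" by (simp add: mult_exp_exp algebra_simps)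
    also have "\<dots> \<le> exp ((C + 1 + \<beta> / 2) * (2 * ln (real N)) + \<beta> * ln (real N))"
      using l \<beta> by (subst exp_le_cancel_iff, intro add_mono mult_left_mono) (auto simp: C_def)
    also have "\<dots> = real N powr A" using N by (simp add: powr_def A_def algebra_simps)
    finally show ?thesis by (simp add: mult.assoc)
  qed
  have "G * ennreal (exp (- \<beta> * real N / 2)) \<le> ennreal (exp (- R) * c powr (e' - e)) * partition_fun \<beta> N * ennreal (exp (- \<beta> * real N / 2))"
    by (rule mult_right_mono[OF GZ]) simp
  also have "\<dots> = ennreal (exp (- \<beta> * real N / 2) * (exp (- R) * c powr (e' - e))) * partition_fun \<beta> N"
    by (simp add: ennreal_mult mult_ac)
  also have "\<dots> \<le> ennreal (real N powr A) * partition_fun \<beta> N"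
    by (intro mult_right_mono ennreal_leI num) simp
  finally show "gas_partition \<beta> (real N) {..<N - 1} * ennreal (exp (- \<beta> * real N / 2)) \<le> ennreal (real N powr A) * partition_fun \<beta> N"
    by (simp add: G_def n_def)
qed

section \<open>A maximum principle for the smoothed potential\<close>

lemma second_derivative_test:
  fixes f f' :: "real \<Rightarrow> real"
  assumes e: "0 < e"
    and d1: "\<And>s. \<bar>s\<bar> < e \<Longrightarrow> (f has_real_derivative f' s) (at s)"
    and d2: "(f' has_real_derivative c) (at 0)"
    and mx: "\<And>s. \<bar>s\<bar> < e \<Longrightarrow> f s \<le> f 0"
  shows "c \<le> 0"
proof (rule ccontr)
  assume "\<not> c \<le> 0"
  then have c: "0 < c" by simp
  have z: "f' 0 = 0"
    by (rule DERIV_local_max[OF d1[of 0] e]) (use e mx in auto)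
  from DERIV_pos_inc_right[OF d2 c] obtain d where d: "0 < d" "\<And>h. 0 < h \<Longrightarrow> h < d \<Longrightarrow> 0 < f' h"
    unfolding z by auto
  define s where "s = min d e / 2"
  have s: "0 < s" "s < d" "s < e" using d(1) e by (simp_all add: s_def min_def field_simps)
  obtain t where t: "0 < t" "t < s" "f s - f 0 = (s - 0) * f' t"
    using MVT2[of 0 s f f'] s d1 by auto
  have "0 < s * f' t" using d(2)[of t] t s by simp
  then show False using t mx[of s] s by simp
qed

lemma norm_along_axis:
  fixes v :: "real^2"
  shows "(norm (v + s *\<^sub>R axis a 1))\<^sup>2 = (norm v)\<^sup>2 + 2 * (v $ a) * s + s\<^sup>2"
proof -
  have 1: "axis a (1::real) \<bullet> axis a 1 = 1" and 2: "v \<bullet> axis a 1 = v $ a"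
    by (simp_all add: inner_axis)
  show ?thesis
    unfolding power2_norm_eq_inner inner_add_left inner_add_right inner_scaleR_left inner_scaleR_right
      1 2 inner_commute[of "axis a 1" v]
    by (simp add: power2_eq_square distrib_left)
qed

text \<open>At a maximum the Laplacian is nonpositive. The logarithms are harmonic away from the
  points \<open>x j\<close>, so that only the radial function contributes; the Laplacian of
  \<open>\<Phi> ((norm z)\<^sup>2)\<close> is \<open>4 * (s * \<Phi>'' s + \<Phi>' s)\<close> at \<open>s = (norm z)\<^sup>2\<close>.\<close>
lemma laplacian_test:
  fixes N :: nat and y :: "real^2" and x :: "nat \<Rightarrow> real^2" and \<Phi> \<Phi>' :: "real \<Rightarrow> real"
  defines "H \<equiv> \<lambda>z. (\<Sum>j<N. - ln (norm (z - x j))) + real N * \<Phi> ((norm z)\<^sup>2)"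
  assumes N: "0 < N" and e: "0 < e"
    and mx: "\<And>z. norm (z - y) < e \<Longrightarrow> H z \<le> H y"
    and far: "\<And>j. j < N \<Longrightarrow> e \<le> norm (y - x j)"
    and d: "0 < d" "\<And>t. \<bar>t - (norm y)\<^sup>2\<bar> < d \<Longrightarrow> (\<Phi> has_real_derivative \<Phi>' t) (at t)"
    and d2: "(\<Phi>' has_real_derivative \<Phi>2) (at ((norm y)\<^sup>2))"
  shows "(norm y)\<^sup>2 * \<Phi>2 + \<Phi>' ((norm y)\<^sup>2) \<le> 0"
proof -
  define S where "S = (norm y)\<^sup>2"
  define D where "D j = (norm (y - x j))\<^sup>2" for j
  have Dp: "0 < D j" if "j < N" for j using far[OF that] e by (auto simp: D_def)
  define e' where "e' = Min {e, 1, d / (2 * norm y + 1)}"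
  have np: "0 < 2 * norm y + 1" by (simp add: add_nonneg_pos)
  have e': "0 < e'" "e' \<le> e" "e' \<le> 1" "e' * (2 * norm y + 1) \<le> d"
  proof -
    show "0 < e'" "e' \<le> e" "e' \<le> 1" using e d np by (auto simp: e'_def)
    have "e' \<le> d / (2 * norm y + 1)" by (auto simp: e'_def)
    then show "e' * (2 * norm y + 1) \<le> d" using np by (simp add: pos_le_divide_eq)
  qed
  have dir: "(\<Sum>j<N. - 1 / D j + 2 * ((y - x j) $ a)\<^sup>2 / (D j)\<^sup>2) + real N * (\<Phi>2 * (2 * y $ a) * (2 * y $ a) + 2 * \<Phi>' S) \<le> 0" for a
  proof (rule second_derivative_test[OF e'(1)])
    define p where "p j = (y - x j) $ a" for j
    have sq: "(norm (y + s *\<^sub>R axis a 1 - x j))\<^sup>2 = D j + 2 * p j * s + s\<^sup>2" for s j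
      using norm_along_axis[of "y - x j" s a] by (simp add: D_def p_def algebra_simps)
    have sqy: "(norm (y + s *\<^sub>R axis a 1))\<^sup>2 = S + 2 * (y $ a) * s + s\<^sup>2" for s
      using norm_along_axis[of y s a] by (simp add: S_def)
    have ln_eq: "ln (norm v) = ln ((norm v)\<^sup>2) / 2" for v :: "real^2"
      by (cases "v = 0") (auto simp: ln_realpow)
    define f where "f s = (\<Sum>j<N. - (ln (D j + 2 * p j * s + s\<^sup>2) / 2)) + real N * \<Phi> (S + 2 * (y $ a) * s + s\<^sup>2)" for s
    have Hf: "H (y + s *\<^sub>R axis a 1) = f s" for s
      unfolding H_def f_def by (subst ln_eq) (simp add: sq sqy)
    define f' where "f' s = (\<Sum>j<N. - ((p j + s) / (D j + 2 * p j * s + s\<^sup>2))) + real N * (\<Phi>' (S + 2 * (y $ a) * s + s\<^sup>2) * (2 * (y $ a) + 2 * s))" for s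
    have pos: "0 < D j + 2 * p j * s + s\<^sup>2" if "\<bar>s\<bar> < e'" "j < N" for s j
    proof -
      have "norm (y - x j) \<le> norm (y + s *\<^sub>R axis a 1 - x j) + norm (s *\<^sub>R axis a (1::real))"
        using norm_triangle_ineq4[of "y + s *\<^sub>R axis a 1 - x j" "s *\<^sub>R axis a 1"] by simp
      then have "0 < norm (y + s *\<^sub>R axis a 1 - x j)"
        using far[OF that(2)] that(1) e' norm_scaleR[of s "axis a (1::real) :: real^2"]
        unfolding norm_axis_1 by linarith
      then show ?thesis unfolding sq[symmetric] by simp
    qed
    show "(f has_real_derivative f' s) (at s)" if s: "\<bar>s\<bar> < e'" for s
    proof -
      have "\<bar>2 * (y $ a) * s + s\<^sup>2\<bar> < d"
      proof -
        have "\<bar>2 * (y $ a) * s + s\<^sup>2\<bar> = \<bar>s\<bar> * \<bar>2 * (y $ a) + s\<bar>"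
          by (simp add: abs_mult[symmetric] power2_eq_square algebra_simps)
        also have "\<dots> \<le> \<bar>s\<bar> * (2 * norm y + 1)"
          using component_le_norm_cart[of y a] s e' by (intro mult_left_mono) auto
        also have "\<dots> < e' * (2 * norm y + 1)"
          using s np by (intro mult_strict_right_mono) auto
        finally show ?thesis using e' by simp
      qed
      then have \<Phi>d: "(\<Phi> has_real_derivative \<Phi>' (S + 2 * (y $ a) * s + s\<^sup>2)) (at (S + 2 * (y $ a) * s + s\<^sup>2))"
        by (intro d(2)) (simp add: S_def)
      have c: "((\<lambda>s. \<Phi> (S + 2 * (y $ a) * s + s\<^sup>2)) has_real_derivative (\<Phi>' (S + 2 * (y $ a) * s + s\<^sup>2) * (2 * (y $ a) + 2 * s))) (at s)"
        by (rule DERIV_chain2[where f=\<Phi> and g="\<lambda>s. S + 2 * (y $ a) * s + s\<^sup>2", OF \<Phi>d]) (auto intro!: derivative_eq_intros)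
      have l: "((\<lambda>s. - (ln (D j + 2 * p j * s + s\<^sup>2) / 2)) has_real_derivative (- ((p j + s) / (D j + 2 * p j * s + s\<^sup>2)))) (at s)"
        if "j \<in> {..<N}" for j
        using pos[OF s, of j] that by (auto intro!: derivative_eq_intros simp: field_simps)
      show ?thesis unfolding f_def[abs_def] f'_def
        by (intro DERIV_add DERIV_sum DERIV_cmult c l)
    qed
    have \<Phi>d2: "(\<Phi>' has_real_derivative \<Phi>2) (at (S + 2 * (y $ a) * 0 + 0\<^sup>2))"
      using d2 by (simp add: S_def)
    have c: "((\<lambda>s. \<Phi>' (S + 2 * (y $ a) * s + s\<^sup>2)) has_real_derivative (\<Phi>2 * (2 * (y $ a)))) (at 0)"
      by (rule DERIV_chain2[where f=\<Phi>' and g="\<lambda>s. S + 2 * (y $ a) * s + s\<^sup>2", OF \<Phi>d2]) (auto intro!: derivative_eq_intros)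
    have c2: "((\<lambda>s. \<Phi>' (S + 2 * (y $ a) * s + s\<^sup>2) * (2 * (y $ a) + 2 * s)) has_real_derivative (\<Phi>2 * (2 * y $ a) * (2 * y $ a) + 2 * \<Phi>' S)) (at 0)"
      by (rule DERIV_cong[OF DERIV_mult[OF c]]) (auto intro!: derivative_eq_intros)
    have l: "((\<lambda>s. - ((p j + s) / (D j + 2 * p j * s + s\<^sup>2))) has_real_derivative (- 1 / D j + 2 * ((y - x j) $ a)\<^sup>2 / (D j)\<^sup>2)) (at 0)"
      if "j \<in> {..<N}" for j
      using Dp[of j] that by (auto intro!: derivative_eq_intros simp: p_def field_simps power2_eq_square)
    show "(f' has_real_derivative (\<Sum>j<N. - 1 / D j + 2 * ((y - x j) $ a)\<^sup>2 / (D j)\<^sup>2) + real N * (\<Phi>2 * (2 * y $ a) * (2 * y $ a) + 2 * \<Phi>' S)) (at 0)"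
      unfolding f'_def[abs_def] by (intro DERIV_add DERIV_sum DERIV_cmult c2 l)
    show "f s \<le> f 0" if "\<bar>s\<bar> < e'" for s
      using mx[of "y + s *\<^sub>R axis a 1"] that e' Hf[of s] Hf[of 0] by (simp add: norm_axis_1)
  qed
  have nsq: "(norm v)\<^sup>2 = (v $ 1)\<^sup>2 + (v $ 2)\<^sup>2" for v :: "real^2"
    by (simp add: norm_vec_def L2_set_def sum_2)
  have "(\<Sum>j<N. - 1 / D j + 2 * ((y - x j) $ 1)\<^sup>2 / (D j)\<^sup>2) + (\<Sum>j<N. - 1 / D j + 2 * ((y - x j) $ 2)\<^sup>2 / (D j)\<^sup>2) = 0"
    unfolding sum.distrib[symmetric]
  proof (rule sum.neutral, rule ballI)
    fix j assume "j \<in> {..<N}"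
    then have "0 < D j" using Dp by simp
    moreover have "((y - x j) $ 1)\<^sup>2 + ((y - x j) $ 2)\<^sup>2 = D j" by (simp add: D_def nsq)
    then have "2 * ((y - x j) $ 1)\<^sup>2 / (D j)\<^sup>2 + 2 * ((y - x j) $ 2)\<^sup>2 / (D j)\<^sup>2 = 2 * D j / (D j)\<^sup>2"
      by (simp only: add_divide_distrib[symmetric] distrib_left[symmetric])
    moreover have "2 * D j / (D j)\<^sup>2 = 1 / D j + 1 / D j" "- 1 / D j = - (1 / D j)"
      by (simp_all add: power2_eq_square)
    ultimately show "- 1 / D j + 2 * ((y - x j) $ 1)\<^sup>2 / (D j)\<^sup>2 + (- 1 / D j + 2 * ((y - x j) $ 2)\<^sup>2 / (D j)\<^sup>2) = 0"
      by linarith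
  qed
  then have "real N * ((\<Phi>2 * (2 * y $ 1) * (2 * y $ 1) + 2 * \<Phi>' S) + (\<Phi>2 * (2 * y $ 2) * (2 * y $ 2) + 2 * \<Phi>' S)) \<le> 0"
    using dir[of 1] dir[of 2] unfolding distrib_left[of "real N"] by linarith
  moreover have "(\<Phi>2 * (2 * y $ 1) * (2 * y $ 1) + 2 * \<Phi>' S) + (\<Phi>2 * (2 * y $ 2) * (2 * y $ 2) + 2 * \<Phi>' S) = 4 * (S * \<Phi>2 + \<Phi>' S)"
    unfolding S_def nsq[of y] by (simp add: power2_eq_square algebra_simps)
  ultimately show ?thesis using N by (simp add: S_def mult_le_0_iff)
qed

text \<open>As a function of \<open>s = (norm z)\<^sup>2\<close> this is strictly subharmonic in the plane without
  the origin, and it grows like the logarithmic potential of a charge \<open>(1 + \<rho>) / 2 < 1\<close>. The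
  coefficients are the ones for which value and derivative at \<open>s = \<rho>\<close> agree with those of
  \<open>(s - 1) / 2\<close>.\<close>
definition outer_barrier :: "real \<Rightarrow> real \<Rightarrow> real" where
  "outer_barrier \<rho> s = (1 + \<rho>) / 4 * ln (s / \<rho>) + \<rho> * (1 - \<rho>) / 4 * (1 / s - 1 / \<rho>) + (\<rho> - 1) / 2"

text \<open>Inside the disc of squared radius \<open>\<rho>\<close> this is the confining potential. Further out it
  is replaced by a smaller function that is still subharmonic, but whose growth is too slow
  to compete with the particles: their potential plus \<open>N\<close> times the barrier tends to minus
  infinity and has a maximum.\<close>
definition barrier :: "real \<Rightarrow> real \<Rightarrow> real" where
  "barrier \<rho> s = (if s \<le> \<rho> then (s - 1) / 2 else outer_barrier \<rho> s)"

lemma outer_barrier_deriv: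
  assumes "0 < s" "0 < \<rho>"
  shows "(outer_barrier \<rho> has_real_derivative ((1 + \<rho>) / (4 * s) - \<rho> * (1 - \<rho>) / (4 * s\<^sup>2))) (at s)"
    and "((\<lambda>s. (1 + \<rho>) / (4 * s) - \<rho> * (1 - \<rho>) / (4 * s\<^sup>2)) has_real_derivative
      (- (1 + \<rho>) / (4 * s\<^sup>2) + \<rho> * (1 - \<rho>) / (2 * s ^ 3))) (at s)"
  unfolding outer_barrier_def[abs_def]
  using assms by (auto intro!: derivative_eq_intros simp: field_simps power2_eq_square power3_eq_cube)

lemma outer_barrier_le:
  assumes \<rho>: "1/2 \<le> \<rho>" "\<rho> < 1" and s: "1/4 \<le> s"
  shows "outer_barrier \<rho> s \<le> (s - 1) / 2"
proof -
  define g where "g s = (s - 1) / 2 - outer_barrier \<rho> s" for s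
  \<comment> \<open>the second factor is nonnegative because \<open>1 - \<rho> \<le> 1/2 \<le> 2 * s\<close>, so \<open>g\<close> is least at \<open>\<rho>\<close>\<close>
  have dg: "(g has_real_derivative ((s - \<rho>) * (2 * s - (1 - \<rho>)) / (4 * s\<^sup>2))) (at s)" if "0 < s" for s
    unfolding g_def
    by (rule DERIV_cong[OF DERIV_diff[OF _ outer_barrier_deriv(1)]])
       (use that \<rho> in \<open>auto intro!: derivative_eq_intros simp: field_simps power2_eq_square\<close>)
  have g0: "g \<rho> = 0" using \<rho> by (simp add: g_def outer_barrier_def)
  have "0 \<le> g s"
  proof (cases "\<rho> \<le> s")
    case True
    have "g \<rho> \<le> g s"
    proof (rule DERIV_nonneg_imp_nondecreasing[OF True])
      fix x assume x: "\<rho> \<le> x" "x \<le> s"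
      then have "0 \<le> (x - \<rho>) * (2 * x - (1 - \<rho>)) / (4 * x\<^sup>2)" using \<rho> by (intro divide_nonneg_nonneg mult_nonneg_nonneg) auto
      then show "\<exists>y. (g has_real_derivative y) (at x) \<and> 0 \<le> y" using dg[of x] x \<rho> by auto
    qed
    then show ?thesis by (simp add: g0)
  next
    case False
    have "g s \<ge> g \<rho>"
    proof (rule DERIV_nonpos_imp_nonincreasing[of s \<rho> g])
      show "s \<le> \<rho>" using False by simp
      fix x assume x: "s \<le> x" "x \<le> \<rho>"
      then have "(x - \<rho>) * (2 * x - (1 - \<rho>)) / (4 * x\<^sup>2) \<le> 0" using \<rho> s by (intro divide_nonpos_nonneg mult_nonpos_nonneg) auto
      then show "\<exists>y. (g has_real_derivative y) (at x) \<and> y \<le> 0" using dg[of x] x s by auto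
    qed
    then show ?thesis by (simp add: g0)
  qed
  then show ?thesis by (simp add: g_def)
qed

lemma barrier_continuous:
  assumes "0 < \<rho>" shows "continuous_on UNIV (barrier \<rho>)"
proof -
  have "continuous_on ({..\<rho>} \<union> {\<rho>..}) (\<lambda>s. if s \<le> \<rho> then (s - 1) / 2 else outer_barrier \<rho> s)"
  proof (rule continuous_on_If)
    show "continuous_on {\<rho>..} (outer_barrier \<rho>)"
      unfolding outer_barrier_def[abs_def] using assms by (auto intro!: continuous_intros)
    fix s assume "s \<in> {\<rho>..}" "s \<le> \<rho>"
    then have "s = \<rho>" by simp
    then show "(s - 1) / 2 = outer_barrier \<rho> s" using assms by (simp add: outer_barrier_def)
  qed (auto intro!: continuous_intros)
  moreover have "{..\<rho>} \<union> {\<rho>..} = UNIV" by auto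
  ultimately show ?thesis by (simp add: barrier_def[abs_def])
qed

lemma barrier_le:
  assumes "1/2 \<le> \<rho>" "\<rho> < 1"
  shows "barrier \<rho> s \<le> (s - 1) / 2"
  using outer_barrier_le[OF assms, of s] assms by (auto simp: barrier_def)

text \<open>The smoothed potential \<open>F\<close> plus the barrier attains its maximum. If no particle were
  within \<open>\<eta>\<close> of the maximum point, \<open>F\<close> would be a sum of unsmoothed logarithms near it, and
  the sum would be strictly subharmonic there. The barrier equals the confining potential on
  the disc of squared radius \<open>\<rho>\<close> and is smaller elsewhere, which allows the conclusion to be
  stated without it.\<close>
lemma max_near_particle:
  fixes N :: nat and x :: "nat \<Rightarrow> real^2"
  assumes N: "0 < N" and \<rho>: "1/2 \<le> \<rho>" "\<rho> < 1" and \<eta>: "0 < \<eta>"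
  defines "F \<equiv> \<lambda>z. \<Sum>j<N. - ln (max (norm (z - x j)) \<eta>)"
  shows "\<exists>i<N. \<exists>y. norm (y - x i) \<le> \<eta> \<and>
    (\<forall>z. (norm z)\<^sup>2 \<le> \<rho> \<longrightarrow> F z + real N * ((norm z)\<^sup>2 - 1) / 2 \<le> F y + real N * ((norm y)\<^sup>2 - 1) / 2)"
proof -
  define G where "G z = F z + real N * barrier \<rho> ((norm z)\<^sup>2)" for z
  have contG: "continuous_on S G" for S
  proof -
    have "continuous_on S (\<lambda>z. barrier \<rho> ((norm z)\<^sup>2))"
      by (rule continuous_on_compose2[OF barrier_continuous]) (use \<rho> in \<open>auto intro!: continuous_intros\<close>)
    moreover have "max a \<eta> \<noteq> 0" for a using \<eta> by (simp add: max_def)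
    ultimately show ?thesis
      unfolding G_def F_def by (intro continuous_intros) auto
  qed
  obtain y where y: "\<And>z. G z \<le> G y"
  proof -
    define R where "R = (\<Sum>j<N. norm (x j))"
    have R: "norm (x j) \<le> R" if "j < N" for j
      unfolding R_def using that by (intro member_le_sum) auto
    have R0: "0 \<le> R" by (simp add: R_def sum_nonneg)
    \<comment> \<open>beyond this radius, solved from the last inequality of the estimate below, \<open>G z\<close> does
      not exceed \<open>G 0\<close>\<close>
    define L where "L = 2 * R + 1 + exp (2 * (ln 2 - (1 + \<rho>) / 4 * ln \<rho> - G 0 / N) / (1 - \<rho>))"
    have out: "G z \<le> G 0" if z: "L \<le> norm z" for z
    proof -
      have z1: "2 * R \<le> norm z" "1 \<le> norm z" "exp (2 * (ln 2 - (1 + \<rho>) / 4 * ln \<rho> - G 0 / N) / (1 - \<rho>)) \<le> norm z"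
        using z R0 by (auto simp: L_def intro: order_trans[rotated] add_nonneg_nonneg)
      have lnz: "2 * (ln 2 - (1 + \<rho>) / 4 * ln \<rho> - G 0 / N) / (1 - \<rho>) \<le> ln (norm z)"
        using z1 by (subst ln_ge_iff) auto
      have sz: "\<rho> \<le> (norm z)\<^sup>2" "1 \<le> (norm z)\<^sup>2" using z1(2) \<rho> by (auto intro: order_trans[of _ 1])
      have Fz: "F z \<le> (\<Sum>j<N. - ln (norm z / 2))"
        unfolding F_def
      proof (rule sum_mono)
        fix j assume j: "j \<in> {..<N}"
        have "norm z / 2 \<le> norm z - norm (x j)" using R[of j] j z1 by simp
        also have "\<dots> \<le> norm (z - x j)" by (rule norm_triangle_ineq2)
        finally have "norm z / 2 \<le> max (norm (z - x j)) \<eta>" by simp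
        then show "- ln (max (norm (z - x j)) \<eta>) \<le> - ln (norm z / 2)"
          using z1 \<eta> by (subst neg_le_iff_le, subst ln_le_cancel_iff) (auto simp: less_max_iff_disj)
      qed
      have "barrier \<rho> ((norm z)\<^sup>2) \<le> outer_barrier \<rho> ((norm z)\<^sup>2)"
        using sz \<rho> by (auto simp: barrier_def outer_barrier_def)
      also have "\<dots> \<le> (1 + \<rho>) / 4 * ln ((norm z)\<^sup>2 / \<rho>)"
      proof -
        have "1 / (norm z)\<^sup>2 - 1 / \<rho> \<le> 0" using sz \<rho> by (simp add: frac_le)
        then have b: "\<rho> * (1 - \<rho>) / 4 * (1 / (norm z)\<^sup>2 - 1 / \<rho>) \<le> 0" using \<rho> by (intro mult_nonneg_nonpos) auto
        have c: "(\<rho> - 1) / 2 \<le> 0" using \<rho> by simp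
        have "a + b + c \<le> a" if "b \<le> 0" "c \<le> 0" for a b c :: real using that by linarith
        from this[OF b c] show ?thesis unfolding outer_barrier_def .
      qed
      also have "\<dots> = (1 + \<rho>) / 2 * ln (norm z) - (1 + \<rho>) / 4 * ln \<rho>"
      proof -
        have "0 < norm z" using z1(2) by linarith
        then have "ln ((norm z)\<^sup>2 / \<rho>) = 2 * ln (norm z) - ln \<rho>"
          using \<rho> by (subst ln_div) (auto simp: ln_realpow)
        then show ?thesis by (simp only:) (simp add: field_simps)
      qed
      finally have Bz: "barrier \<rho> ((norm z)\<^sup>2) \<le> (1 + \<rho>) / 2 * ln (norm z) - (1 + \<rho>) / 4 * ln \<rho>" .
      have "G z \<le> real N * (ln 2 - ln (norm z)) + real N * ((1 + \<rho>) / 2 * ln (norm z) - (1 + \<rho>) / 4 * ln \<rho>)"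
      proof -
        have "0 < norm z" using z1(2) by linarith
        then have "ln (norm z / 2) = ln (norm z) - ln 2" by (subst ln_div) auto
        moreover have "F z \<le> real N * (- ln (norm z / 2))" using Fz by simp
        ultimately have "F z \<le> real N * (ln 2 - ln (norm z))" by (simp only: minus_diff_eq)
        then show ?thesis unfolding G_def using Bz by (intro add_mono mult_left_mono) auto
      qed
      also have "\<dots> = real N * ((ln 2 - (1 + \<rho>) / 4 * ln \<rho>) - (1 - \<rho>) / 2 * ln (norm z))"
        by (simp add: field_simps)
      also have "\<dots> \<le> real N * (G 0 / N)"
        using lnz \<rho> by (intro mult_left_mono) (auto simp: field_simps)
      finally show ?thesis using N by simp
    qed
    have "0 \<le> L" using R0 by (simp add: L_def add_nonneg_nonneg)
    then obtain y where y: "y \<in> cball 0 L" "\<And>z. z \<in> cball 0 L \<Longrightarrow> G z \<le> G y"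
      using continuous_attains_sup[OF compact_cball _ contG, of 0 L] by auto
    have "G z \<le> G y" for z
    proof (cases "norm z \<le> L")
      case True then show ?thesis using y by auto
    next
      case False
      then have "G z \<le> G 0" using out by simp
      also have "G 0 \<le> G y" using y \<open>0 \<le> L\<close> by auto
      finally show ?thesis .
    qed
    then show ?thesis using that by blast
  qed
  have near: "\<exists>i<N. norm (y - x i) \<le> \<eta>"
  proof (rule ccontr)
    assume "\<not> (\<exists>i<N. norm (y - x i) \<le> \<eta>)"
    then have far: "\<eta> < norm (y - x j)" if "j < N" for j using that by auto
    define e0 where "e0 = Min ((\<lambda>j. norm (y - x j) - \<eta>) ` {..<N})"
    have ne: "(\<lambda>j. norm (y - x j) - \<eta>) ` {..<N} \<noteq> {}" using N by auto
    have e0: "0 < e0" unfolding e0_def using ne far by (subst Min_gr_iff) auto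
    have e0': "e0 \<le> norm (y - x j) - \<eta>" if "j < N" for j
      unfolding e0_def using that by (intro Min_le) auto
    have Feq: "F z = (\<Sum>j<N. - ln (norm (z - x j)))" if "norm (z - y) < e0" for z
      unfolding F_def
    proof (intro sum.cong refl)
      fix j assume "j \<in> {..<N}"
      then have "norm (y - x j) - norm (z - y) > \<eta>" using e0'[of j] that by simp
      moreover have "norm (y - x j) \<le> norm (z - y) + norm (z - x j)"
        using norm_triangle_ineq[of "y - z" "z - x j"] by (simp add: norm_minus_commute)
      ultimately show "- ln (max (norm (z - x j)) \<eta>) = - ln (norm (z - x j))" by simp
    qed
    show False
    proof (cases "(norm y)\<^sup>2 < \<rho>")
      case True
      have "open {z::real^2. (norm z)\<^sup>2 < \<rho>}"
        by (intro open_Collect_less continuous_intros)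
      then obtain e1 where e1: "0 < e1" "\<And>z. norm (z - y) < e1 \<Longrightarrow> (norm z)\<^sup>2 < \<rho>"
        using True unfolding open_dist by (auto simp: dist_norm)
      have "(norm y)\<^sup>2 * 0 + 1/2 \<le> (0::real)"
      proof (rule laplacian_test[where x=x and N=N and e="min e0 e1" and d=1 and \<Phi>="\<lambda>s. (s - 1) / 2" and \<Phi>'="\<lambda>_. 1/2"])
        fix z assume z: "norm (z - y) < min e0 e1"
        have "(\<Sum>j<N. - ln (norm (z - x j))) + real N * (((norm z)\<^sup>2 - 1) / 2) = G z"
          using z e1(2)[of z] Feq[of z] by (simp add: G_def barrier_def)
        also have "G z \<le> G y" by (rule y)
        also have "G y = (\<Sum>j<N. - ln (norm (y - x j))) + real N * (((norm y)\<^sup>2 - 1) / 2)"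
          using True Feq[of y] e0 by (simp add: G_def barrier_def)
        finally show "(\<Sum>j<N. - ln (norm (z - x j))) + real N * (((norm z)\<^sup>2 - 1) / 2)
          \<le> (\<Sum>j<N. - ln (norm (y - x j))) + real N * (((norm y)\<^sup>2 - 1) / 2)" .
      next
        fix j assume "j < N"
        then show "min e0 e1 \<le> norm (y - x j)" using e0'[of j] \<eta> by simp
      qed (use N e0 e1 in \<open>auto intro!: derivative_eq_intros\<close>)
      then show False by simp
    next
      case False
      then have S: "\<rho> \<le> (norm y)\<^sup>2" "0 < (norm y)\<^sup>2" using \<rho> by auto
      have "open {z::real^2. 1/4 < (norm z)\<^sup>2}"
        by (intro open_Collect_less continuous_intros)
      moreover have "y \<in> {z::real^2. 1/4 < (norm z)\<^sup>2}" using S \<rho> by simp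
      ultimately obtain e1 where "0 < e1" "\<forall>z. dist z y < e1 \<longrightarrow> z \<in> {z. 1/4 < (norm z)\<^sup>2}"
        unfolding open_dist by blast
      then have e1: "0 < e1" "\<And>z. norm (z - y) < e1 \<Longrightarrow> 1/4 < (norm z)\<^sup>2"
        by (auto simp: dist_norm)
      \<comment> \<open>On the circle where its two pieces meet the barrier is not twice differentiable. The
        test is therefore applied to \<open>outer_barrier\<close>, which lies below the barrier near
        \<open>y\<close> and touches it at \<open>y\<close>.\<close>
      have "(norm y)\<^sup>2 * (- (1 + \<rho>) / (4 * ((norm y)\<^sup>2)\<^sup>2) + \<rho> * (1 - \<rho>) / (2 * ((norm y)\<^sup>2) ^ 3))
          + ((1 + \<rho>) / (4 * (norm y)\<^sup>2) - \<rho> * (1 - \<rho>) / (4 * ((norm y)\<^sup>2)\<^sup>2)) \<le> 0"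
      proof (rule laplacian_test[where x=x and N=N and e="min e0 e1" and d="(norm y)\<^sup>2" and \<Phi>="outer_barrier \<rho>"
            and \<Phi>'="\<lambda>s. (1 + \<rho>) / (4 * s) - \<rho> * (1 - \<rho>) / (4 * s\<^sup>2)"])
        fix z assume z: "norm (z - y) < min e0 e1"
        have "outer_barrier \<rho> ((norm z)\<^sup>2) \<le> barrier \<rho> ((norm z)\<^sup>2)"
          using outer_barrier_le[OF \<rho>, of "(norm z)\<^sup>2"] e1(2)[of z] z by (auto simp: barrier_def)
        then have "(\<Sum>j<N. - ln (norm (z - x j))) + real N * outer_barrier \<rho> ((norm z)\<^sup>2) \<le> G z"
          using z Feq[of z] by (simp add: G_def mult_left_mono)
        also have "G z \<le> G y" by (rule y)
        also have "G y = (\<Sum>j<N. - ln (norm (y - x j))) + real N * outer_barrier \<rho> ((norm y)\<^sup>2)"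
          using S Feq[of y] e0 \<rho> by (auto simp: G_def barrier_def outer_barrier_def)
        finally show "(\<Sum>j<N. - ln (norm (z - x j))) + real N * outer_barrier \<rho> ((norm z)\<^sup>2)
          \<le> (\<Sum>j<N. - ln (norm (y - x j))) + real N * outer_barrier \<rho> ((norm y)\<^sup>2)" .
      next
        fix j assume "j < N"
        then show "min e0 e1 \<le> norm (y - x j)" using e0'[of j] \<eta> by simp
      next
        fix t assume "\<bar>t - (norm y)\<^sup>2\<bar> < (norm y)\<^sup>2"
        then have "0 < t" by (simp add: abs_if split: if_splits)
        then show "(outer_barrier \<rho> has_real_derivative (1 + \<rho>) / (4 * t) - \<rho> * (1 - \<rho>) / (4 * t\<^sup>2)) (at t)"
          using \<rho> by (intro outer_barrier_deriv) auto
      next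
        show "((\<lambda>s. (1 + \<rho>) / (4 * s) - \<rho> * (1 - \<rho>) / (4 * s\<^sup>2)) has_real_derivative
           - (1 + \<rho>) / (4 * ((norm y)\<^sup>2)\<^sup>2) + \<rho> * (1 - \<rho>) / (2 * ((norm y)\<^sup>2) ^ 3)) (at ((norm y)\<^sup>2))"
          using S \<rho> by (intro outer_barrier_deriv) auto
      qed (use N e0 e1 S in auto)
      moreover define T where "T = (norm y)\<^sup>2"
      ultimately have "T * (- (1 + \<rho>) / (4 * T\<^sup>2) + \<rho> * (1 - \<rho>) / (2 * T ^ 3)) + ((1 + \<rho>) / (4 * T) - \<rho> * (1 - \<rho>) / (4 * T\<^sup>2)) \<le> 0"
        by simp
      moreover have "0 < T" using S by (simp add: T_def)
      then have "T * (- (1 + \<rho>) / (4 * T\<^sup>2) + \<rho> * (1 - \<rho>) / (2 * T ^ 3)) + ((1 + \<rho>) / (4 * T) - \<rho> * (1 - \<rho>) / (4 * T\<^sup>2))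
        = \<rho> * (1 - \<rho>) / (4 * T\<^sup>2)"
        by (simp add: field_simps power2_eq_square power3_eq_cube)
      moreover have "0 < \<rho> * (1 - \<rho>) / (4 * T\<^sup>2)" using \<rho> \<open>0 < T\<close> by simp
      ultimately show False by linarith
    qed
  qed
  then obtain i where i: "i < N" "norm (y - x i) \<le> \<eta>" by blast
  moreover have "F z + real N * ((norm z)\<^sup>2 - 1) / 2 \<le> F y + real N * ((norm y)\<^sup>2 - 1) / 2" if "(norm z)\<^sup>2 \<le> \<rho>" for z
  proof -
    have "F z + real N * ((norm z)\<^sup>2 - 1) / 2 = G z" using that by (simp add: G_def barrier_def)
    also have "\<dots> \<le> G y" by (rule y)
    also have "\<dots> \<le> F y + real N * ((norm y)\<^sup>2 - 1) / 2"
      using mult_left_mono[OF barrier_le[OF \<rho>, of "(norm y)\<^sup>2"], of "real N"] by (simp add: G_def)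
    finally show ?thesis .
  qed
  ultimately show ?thesis by blast
qed

section \<open>Green's representation formula\<close>

lemma partial_derivI:
  assumes "(g has_derivative g') (at x)"
  shows "partial_deriv i g x = g' (axis i 1)"
  using frechet_derivative_at[OF assms] by (simp add: partial_deriv_def)

lemma partial_deriv_along_line:
  assumes "\<And>x. g differentiable (at x)"
  shows "((\<lambda>s. g (y + s *\<^sub>R axis i 1)) has_real_derivative partial_deriv i g (y + s *\<^sub>R axis i 1)) (at s)"
proof -
  have g: "(g has_derivative frechet_derivative g (at (y + s *\<^sub>R axis i 1))) (at (y + s *\<^sub>R axis i 1))"
    using assms frechet_derivative_works by blast
  have l: "linear (frechet_derivative g (at (y + s *\<^sub>R axis i 1)))"
    using g by (rule has_derivative_linear)
  have "((\<lambda>s. y + s *\<^sub>R axis i 1) has_derivative (\<lambda>h. h *\<^sub>R axis i 1)) (at s)"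
    by (auto intro!: derivative_eq_intros)
  from has_derivative_compose[OF this, of g, OF g]
  have "((\<lambda>s. g (y + s *\<^sub>R axis i 1)) has_derivative
     (\<lambda>h. frechet_derivative g (at (y + s *\<^sub>R axis i 1)) (h *\<^sub>R axis i 1))) (at s)" .
  moreover have "frechet_derivative g (at (y + s *\<^sub>R axis i 1)) (h *\<^sub>R axis i 1) = partial_deriv i g (y + s *\<^sub>R axis i 1) * h" for h
    by (simp add: linear_cmul[OF l] partial_deriv_def)
  ultimately show ?thesis
    by (simp add: has_field_derivative_def)
qed

lemma integrable_compact_support:
  fixes g :: "real^2 \<Rightarrow> real"
  assumes c: "continuous_on UNIV g" and z: "\<And>y. r < norm y \<Longrightarrow> g y = 0"
  shows "integrable lborel g"
proof -
  have "set_integrable lborel (cball 0 r) g"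
    unfolding set_integrable_def by (intro borel_integrable_compact continuous_on_subset[OF c]) auto
  moreover have "indicator (cball 0 r) y *\<^sub>R g y = g y" for y
    using z[of y] by (auto split: split_indicator)
  ultimately show ?thesis by (simp only: set_integrable_def)
qed

text \<open>By translation invariance the difference quotients have integral zero; they are
  dominated by the bound of the derivative on a compact set.\<close>
lemma integral_partial_deriv_zero:
  fixes g :: "real^2 \<Rightarrow> real"
  assumes d: "\<And>x. g differentiable (at x)" and c: "continuous_on UNIV (partial_deriv i g)"
    and z: "\<And>y. r < norm y \<Longrightarrow> g y = 0"
  shows "(LINT y|lborel. partial_deriv i g y) = 0"
proof -
  define e :: "real^2" where "e = axis i 1"
  have ne: "norm e = 1" by (simp add: e_def norm_axis_1)
  have cg: "continuous_on UNIV g"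
    using d by (auto simp: continuous_on_eq_continuous_at differentiable_imp_continuous_within)
  have [measurable]: "g \<in> borel_measurable borel" using cg by (rule borel_measurable_continuous_onI)
  have pm: "partial_deriv i g \<in> borel_measurable borel" using c by (rule borel_measurable_continuous_onI)
  have ig: "integrable lborel g" by (rule integrable_compact_support[OF cg z])
  obtain K where K: "\<And>y. y \<in> cball 0 (r + 2) \<Longrightarrow> \<bar>partial_deriv i g y\<bar> \<le> K"
  proof -
    have "bounded (partial_deriv i g ` cball 0 (r + 2))"
      by (intro compact_imp_bounded compact_continuous_image continuous_on_subset[OF c]) auto
    then show ?thesis using that unfolding bounded_iff by (metis imageI real_norm_def)
  qed
  define t where "t n = 1 / real (Suc n)" for n
  have t: "0 < t n" "t n \<le> 1" for n by (auto simp: t_def)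
  define q where "q n y = (g (y + t n *\<^sub>R e) - g y) / t n" for n y
  have q0: "(LINT y|lborel. q n y) = 0" for n
  proof -
    have tr: "lborel = distr lborel borel (\<lambda>y. t n *\<^sub>R e + y)" by (rule lborel_distr_plus[symmetric])
    have i2: "integrable lborel (\<lambda>y. g (t n *\<^sub>R e + y))"
      using integrable_distr_eq[of "\<lambda>y. t n *\<^sub>R e + y" lborel borel g] ig unfolding tr[symmetric] by simp
    have "(LINT y|lborel. g y) = (LINT y|lborel. g (t n *\<^sub>R e + y))"
      using integral_distr[of "\<lambda>y. t n *\<^sub>R e + y" lborel borel g] unfolding tr[symmetric] by simp
    then show ?thesis using i2 ig by (simp add: q_def add.commute)
  qed
  have bnd: "\<bar>q n y\<bar> \<le> indicator (cball 0 (r + 1)) y * K" for n y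
  proof (cases "norm y \<le> r + 1")
    case True
    obtain s where s: "0 < s" "s < t n" "g (y + t n *\<^sub>R e) - g (y + 0 *\<^sub>R e) = (t n - 0) * partial_deriv i g (y + s *\<^sub>R e)"
      using MVT2[of 0 "t n" "\<lambda>s. g (y + s *\<^sub>R e)" "\<lambda>s. partial_deriv i g (y + s *\<^sub>R e)"] t(1)[of n]
        partial_deriv_along_line[OF d, of y i] unfolding e_def by blast
    then have "q n y = partial_deriv i g (y + s *\<^sub>R e)" using t(1)[of n] by (simp add: q_def)
    moreover have "norm (y + s *\<^sub>R e) \<le> r + 2"
      using norm_triangle_ineq[of y "s *\<^sub>R e"] s t(2)[of n] True by (simp add: ne)
    ultimately show ?thesis using K True by simp
  next
    case False
    have "norm y \<le> norm (y + t n *\<^sub>R e) + norm (t n *\<^sub>R e)"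
      using norm_triangle_ineq4[of "y + t n *\<^sub>R e" "t n *\<^sub>R e"] by simp
    then have "r < norm (y + t n *\<^sub>R e)" using False t[of n] by (simp add: ne)
    then show ?thesis using z[of y] z[of "y + t n *\<^sub>R e"] False by (simp add: q_def)
  qed
  have "(\<lambda>n. LINT y|lborel. q n y) \<longlonglongrightarrow> (LINT y|lborel. partial_deriv i g y)"
  proof (rule integral_dominated_convergence)
    show "integrable lborel (\<lambda>y::real^2. indicator (cball 0 (r + 1)) y * K :: real)"
      by (intro integrable_mult_left integrable_real_indicator) (use emeasure_bounded_finite[OF bounded_cball[of "0::real^2" "r + 1"]] in auto)
    show "AE y in lborel. (\<lambda>n. q n y) \<longlonglongrightarrow> partial_deriv i g y"
    proof (rule AE_I2)
      fix y :: "real^2"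
      have "((\<lambda>s. (g (y + s *\<^sub>R e) - g y) / s) \<longlongrightarrow> partial_deriv i g y) (at 0)"
        using partial_deriv_along_line[OF d, of y i 0] by (simp add: DERIV_def e_def)
      moreover have "filterlim t (at 0) sequentially"
      proof (rule filterlim_atI)
        show "t \<longlonglongrightarrow> 0" unfolding t_def[abs_def] using LIMSEQ_inverse_real_of_nat by (simp add: inverse_eq_divide)
        show "\<forall>\<^sub>F n in sequentially. t n \<noteq> 0" using t(1) by (simp add: less_imp_neq[symmetric])
      qed
      ultimately show "(\<lambda>n. q n y) \<longlonglongrightarrow> partial_deriv i g y"
        unfolding q_def by (rule filterlim_compose)
    qed
    show "AE y in lborel. norm (q n y) \<le> indicator (cball 0 (r + 1)) y * K" for n
      using bnd by simp
    show "q n \<in> borel_measurable lborel" for n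
    proof -
      have "continuous_on UNIV (q n)"
        unfolding q_def[abs_def] using t(1)[of n]
        by (intro continuous_intros continuous_on_compose2[OF cg]) auto
      then show ?thesis by (simp add: borel_measurable_continuous_onI)
    qed
  qed (simp add: pm)
  then show ?thesis by (simp add: q0 LIMSEQ_const_iff)
qed

lemma partial_deriv_vanishes:
  assumes "open U" "y \<in> U" "\<And>y. y \<in> U \<Longrightarrow> h y = 0"
  shows "partial_deriv i h y = 0"
proof -
  have "((\<lambda>_. 0::real) has_derivative (\<lambda>_. 0)) (at y)" by simp
  then have "(h has_derivative (\<lambda>_. 0)) (at y)"
    by (rule has_derivative_transform_within_open[OF _ assms(1,2)]) (simp add: assms(3))
  from partial_derivI[OF this] show ?thesis .
qed

text \<open>The integrand of the difference is the derivative of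
  \<open>partial_deriv i f y * \<phi> y - f y * partial_deriv i \<phi> y\<close>, a function of compact support.\<close>
lemma second_green_partial:
  fixes f \<phi> :: "real^2 \<Rightarrow> real"
  assumes f: "\<And>x. f differentiable (at x)" "\<And>x. partial_deriv i f differentiable (at x)"
      "continuous_on UNIV (partial_deriv i (partial_deriv i f))"
    and \<phi>: "\<And>x. \<phi> differentiable (at x)" "\<And>x. partial_deriv i \<phi> differentiable (at x)"
      "continuous_on UNIV (partial_deriv i (partial_deriv i \<phi>))"
    and z: "\<And>y. r < norm y \<Longrightarrow> f y = 0"
  shows "(LINT y|lborel. partial_deriv i (partial_deriv i f) y * \<phi> y)
    = (LINT y|lborel. f y * partial_deriv i (partial_deriv i \<phi>) y)"
proof -
  define g where "g y = partial_deriv i f y * \<phi> y - f y * partial_deriv i \<phi> y" for y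
  have loc: "partial_deriv i h y = 0" if "\<And>y. r < norm y \<Longrightarrow> h y = 0" "r < norm y" for h :: "real^2 \<Rightarrow> real" and y
    by (rule partial_deriv_vanishes[of "{y. r < norm y}"])
       (use that in \<open>auto intro!: open_Collect_less continuous_intros\<close>)
  have z1: "partial_deriv i f y = 0" if "r < norm y" for y by (rule loc[OF z that])
  have z2: "partial_deriv i (partial_deriv i f) y = 0" if "r < norm y" for y by (rule loc[OF z1 that])
  have fw: "(h has_derivative frechet_derivative h (at x)) (at x)" if "h differentiable (at x)" for h :: "real^2 \<Rightarrow> real" and x
    using that frechet_derivative_works by blast
  have dg: "(g has_derivative (\<lambda>h.
      (partial_deriv i f y * frechet_derivative \<phi> (at y) h + frechet_derivative (partial_deriv i f) (at y) h * \<phi> y)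
      - (f y * frechet_derivative (partial_deriv i \<phi>) (at y) h + frechet_derivative f (at y) h * partial_deriv i \<phi> y))) (at y)" for y
    unfolding g_def[abs_def]
    by (intro has_derivative_diff has_derivative_mult fw f \<phi>)
  have pg: "partial_deriv i g y = partial_deriv i (partial_deriv i f) y * \<phi> y - f y * partial_deriv i (partial_deriv i \<phi>) y" for y
    using partial_derivI[OF dg, of i y] by (simp add: partial_deriv_def)
  have ct: "continuous_on UNIV h" if "\<And>x. h differentiable (at x)" for h :: "real^2 \<Rightarrow> real"
    using that by (auto simp: continuous_on_eq_continuous_at differentiable_imp_continuous_within)
  have c1: "continuous_on UNIV (\<lambda>y. partial_deriv i (partial_deriv i f) y * \<phi> y)"
    and c2: "continuous_on UNIV (\<lambda>y. f y * partial_deriv i (partial_deriv i \<phi>) y)"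
    by (intro continuous_intros f \<phi> ct)+
  have "(LINT y|lborel. partial_deriv i g y) = 0"
  proof (rule integral_partial_deriv_zero)
    show "g differentiable (at x)" for x using dg differentiable_def by blast
    show "continuous_on UNIV (partial_deriv i g)" unfolding pg[abs_def] by (intro continuous_on_diff c1 c2)
    show "g y = 0" if "r < norm y" for y using z[OF that] z1[OF that] by (simp add: g_def)
  qed
  moreover have "(LINT y|lborel. partial_deriv i g y) = (LINT y|lborel. partial_deriv i (partial_deriv i f) y * \<phi> y)
     - (LINT y|lborel. f y * partial_deriv i (partial_deriv i \<phi>) y)"
    unfolding pg
    by (intro Bochner_Integration.integral_diff integrable_compact_support[OF c1, of r] integrable_compact_support[OF c2, of r])
       (use z z2 in auto)
  ultimately show ?thesis by simp
qed

definition lapl :: "(real^2 \<Rightarrow> real) \<Rightarrow> real^2 \<Rightarrow> real" where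
  "lapl f y = partial_deriv 1 (partial_deriv 1 f) y + partial_deriv 2 (partial_deriv 2 f) y"

lemma class_C2_continuous: "class_C2 f \<Longrightarrow> continuous_on UNIV f"
  by (auto simp: class_C2_def continuous_on_eq_continuous_at differentiable_imp_continuous_within)

lemma lapl_continuous: "class_C2 f \<Longrightarrow> continuous_on UNIV (lapl f)"
  unfolding lapl_def[abs_def] class_C2_def by (auto intro!: continuous_intros)

lemma lapl_vanishes:
  assumes "open U" "y \<in> U" "\<And>y. y \<in> U \<Longrightarrow> h y = 0"
  shows "lapl h y = 0"
  unfolding lapl_def
  using partial_deriv_vanishes[OF assms(1,2), of "partial_deriv _ h"] partial_deriv_vanishes[OF assms(1) _ assms(3)]
  by simp

lemma second_green:
  fixes f \<phi> :: "real^2 \<Rightarrow> real"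
  assumes f: "class_C2 f" and \<phi>: "class_C2 \<phi>" and z: "\<And>y. r < norm y \<Longrightarrow> f y = 0"
  shows "(LINT y|lborel. lapl f y * \<phi> y) = (LINT y|lborel. f y * lapl \<phi> y)"
proof -
  have eq: "(LINT y|lborel. partial_deriv i (partial_deriv i f) y * \<phi> y)
    = (LINT y|lborel. f y * partial_deriv i (partial_deriv i \<phi>) y)" for i
    by (rule second_green_partial[where r=r]) (use f \<phi> z in \<open>auto simp: class_C2_def\<close>)
  have o: "open {y::real^2. r < norm y}" by (intro open_Collect_less continuous_intros)
  have z1: "partial_deriv i f y = 0" if "r < norm y" for i y
    by (rule partial_deriv_vanishes[OF o]) (use that z in auto)
  have z2: "partial_deriv i (partial_deriv i f) y = 0" if "r < norm y" for i y
    by (rule partial_deriv_vanishes[OF o]) (use that z1 in auto)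
  have i1: "integrable lborel (\<lambda>y. partial_deriv i (partial_deriv i f) y * \<phi> y)" for i
    by (rule integrable_compact_support[where r=r])
       (use f class_C2_continuous[OF \<phi>] z2 in \<open>auto simp: class_C2_def intro!: continuous_intros\<close>)
  have i2: "integrable lborel (\<lambda>y. f y * partial_deriv i (partial_deriv i \<phi>) y)" for i
    by (rule integrable_compact_support[where r=r])
       (use \<phi> class_C2_continuous[OF f] z in \<open>auto simp: class_C2_def intro!: continuous_intros\<close>)
  show ?thesis
    unfolding lapl_def distrib_left distrib_right
    by (simp add: Bochner_Integration.integral_add[OF i1 i1] Bochner_Integration.integral_add[OF i2 i2] eq)
qed

lemma has_derivative_norm_sq_shift:
  "((\<lambda>y::real^2. (norm (y - x))\<^sup>2) has_derivative (\<lambda>h. 2 * ((y - x) \<bullet> h))) (at y)"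
  unfolding power2_norm_eq_inner by (auto intro!: derivative_eq_intros simp: inner_commute)

lemma has_derivative_component: "((\<lambda>y::real^2. (y - x) $ i) has_derivative (\<lambda>h. h $ i)) (at y)"
  unfolding vector_minus_component
  by (auto intro!: derivative_eq_intros bounded_linear_imp_has_derivative bounded_linear_vec_nth)

lemma axis_component: "(axis i (1::real) :: real^2) $ j = (if i = j then 1 else 0)"
  by (simp add: axis_def)

lemma
  fixes x :: "real^2"
  assumes B: "0 < B"
  defines "\<phi> \<equiv> \<lambda>y. ln (B + (norm (y - x))\<^sup>2) / 2"
  shows reg_log_C2: "class_C2 \<phi>"
    and lapl_reg_log: "lapl \<phi> y = 2 * B / (B + (norm (y - x))\<^sup>2)\<^sup>2"
proof -
  have pos: "0 < B + (norm (y - x))\<^sup>2" for y :: "real^2"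
    using B by (simp add: add_pos_nonneg)
  define Q where "Q y = B + (norm (y - x))\<^sup>2" for y
  have dQ: "(Q has_derivative (\<lambda>h. 2 * ((y - x) \<bullet> h))) (at y)" for y
    unfolding Q_def[abs_def] using has_derivative_add[OF has_derivative_const has_derivative_norm_sq_shift] by simp
  have Qpos: "0 < Q y" for y using pos by (simp add: Q_def)
  have d1: "(\<phi> has_derivative (\<lambda>h. ((y - x) \<bullet> h) / (B + (norm (y - x))\<^sup>2))) (at y)" for y
    unfolding \<phi>_def Q_def[symmetric] using Qpos[of y]
    by (auto intro!: derivative_eq_intros dQ simp: field_simps)
  have p1: "partial_deriv i \<phi> = (\<lambda>y. (y - x) $ i / (B + (norm (y - x))\<^sup>2))" for i
    by (rule ext) (simp add: partial_derivI[OF d1] inner_axis)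
  have d2: "((\<lambda>y. (y - x) $ i / (B + (norm (y - x))\<^sup>2)) has_derivative
      (\<lambda>h. h $ i / (B + (norm (y - x))\<^sup>2) - (y - x) $ i * (2 * ((y - x) \<bullet> h)) / (B + (norm (y - x))\<^sup>2)\<^sup>2)) (at y)" for i y
    unfolding Q_def[symmetric]
    by (rule has_derivative_eq_rhs[OF has_derivative_divide[OF has_derivative_component dQ]])
       (use Qpos[of y] in \<open>auto simp: field_simps power2_eq_square fun_eq_iff\<close>)
  have p2: "partial_deriv j (partial_deriv i \<phi>) = (\<lambda>y. (if j = i then 1 else 0) / (B + (norm (y - x))\<^sup>2)
      - 2 * ((y - x) $ i) * ((y - x) $ j) / (B + (norm (y - x))\<^sup>2)\<^sup>2)" for i j
    unfolding p1 by (rule ext, subst partial_derivI[OF d2]) (simp add: inner_axis axis_component algebra_simps)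
  show "class_C2 \<phi>"
    unfolding class_C2_def
  proof (intro conjI allI)
    show "\<phi> differentiable at y" for y using d1 differentiable_def by blast
    show "partial_deriv i \<phi> differentiable at y" for i y unfolding p1 using d2 differentiable_def by blast
    have "B + (norm (y - x))\<^sup>2 \<noteq> 0" for y using pos[of y] by simp
    then show "continuous_on UNIV (partial_deriv j (partial_deriv i \<phi>))" for i j
      unfolding p2 by (intro continuous_intros) auto
  qed
  define D where "D = B + (norm (y - x))\<^sup>2"
  have D: "0 < D" using pos by (simp add: D_def)
  have nsq: "((y - x) $ 1)\<^sup>2 + ((y - x) $ 2)\<^sup>2 = D - B"
    by (simp add: D_def norm_vec_def L2_set_def sum_2)
  have "lapl \<phi> y = 2 / D - 2 * (((y - x) $ 1)\<^sup>2 + ((y - x) $ 2)\<^sup>2) / D\<^sup>2"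
    unfolding lapl_def p2 D_def[symmetric] using D by (simp add: field_simps power2_eq_square)
  also have "\<dots> = 2 * B / D\<^sup>2"
    unfolding nsq using D by (simp add: field_simps power2_eq_square)
  finally show "lapl \<phi> y = 2 * B / (B + (norm (y - x))\<^sup>2)\<^sup>2" by (simp add: D_def)
qed

lemma
  shows norm_sq_C2: "class_C2 (\<lambda>y. (norm y)\<^sup>2)"
    and lapl_norm_sq: "lapl (\<lambda>y. (norm y)\<^sup>2) y = 4"
proof -
  have d1: "((\<lambda>y::real^2. (norm y)\<^sup>2) has_derivative (\<lambda>h. 2 * (y \<bullet> h))) (at y)" for y
    using has_derivative_norm_sq_shift[of 0 y] by simp
  have p1: "partial_deriv i (\<lambda>y. (norm y)\<^sup>2) = (\<lambda>y. 2 * y $ i)" for i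
    by (rule ext) (simp add: partial_derivI[OF d1] inner_axis)
  have d2: "((\<lambda>y::real^2. 2 * y $ i) has_derivative (\<lambda>h. 2 * h $ i)) (at y)" for i y
    using has_derivative_mult_right[OF has_derivative_component[of 0 i y], of 2] by simp
  have p2: "partial_deriv j (partial_deriv i (\<lambda>y. (norm y)\<^sup>2)) = (\<lambda>y. if j = i then 2 else 0)" for i j
    unfolding p1 by (rule ext) (simp add: partial_derivI[OF d2] axis_component)
  show "class_C2 (\<lambda>y. (norm y)\<^sup>2)"
    unfolding class_C2_def
  proof (intro conjI allI)
    show "(\<lambda>y. (norm y)\<^sup>2) differentiable at y" for y :: "real^2" using d1 differentiable_def by blast
    show "partial_deriv i (\<lambda>y. (norm y)\<^sup>2) differentiable at y" for i y unfolding p1 using d2 differentiable_def by blast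
    show "continuous_on UNIV (partial_deriv j (partial_deriv i (\<lambda>y. (norm y)\<^sup>2)))" for i j
      unfolding p2 by simp
  qed
  show "lapl (\<lambda>y. (norm y)\<^sup>2) y = 4" unfolding lapl_def p2 by simp
qed

lemma integrable_cauchy_kernel: "integrable lborel (\<lambda>w::real^2. 2 / (1 + (norm w)\<^sup>2)\<^sup>2)"
  and integral_cauchy_kernel: "(LINT w|lborel. 2 / (1 + (norm (w::real^2))\<^sup>2)\<^sup>2) = 2 * pi"
proof -
  have "(\<integral>\<^sup>+s. ennreal (2 / (1 + s)\<^sup>2) * indicator {0..} s \<partial>lborel) = ennreal (0 - - (2 / (1 + 0)))"
  proof (rule nn_integral_FTC_atLeast)
    show "((\<lambda>s. - (2 / (1 + s))) has_real_derivative 2 / (1 + s)\<^sup>2) (at s)" if "0 \<le> s" for s :: real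
      using that by (auto intro!: derivative_eq_intros simp: power2_eq_square)
    have "filterlim (\<lambda>s::real. 1 + s) at_top at_top"
      by (rule filterlim_tendsto_add_at_top[OF tendsto_const filterlim_ident])
    then have "((\<lambda>s::real. 2 / (1 + s)) \<longlongrightarrow> 0) at_top"
      by (intro tendsto_divide_0[OF tendsto_const filterlim_at_top_imp_at_infinity])
    then show "((\<lambda>s::real. - (2 / (1 + s))) \<longlongrightarrow> 0) at_top"
      using tendsto_minus by fastforce
  qed auto
  then have "(\<integral>\<^sup>+w. ennreal (2 / (1 + (norm (w::real^2))\<^sup>2)\<^sup>2) \<partial>lborel) = ennreal (2 * pi)"
    using nn_integral_radial[of "\<lambda>s. ennreal (2 / (1 + s)\<^sup>2)"] ennreal_mult[of pi 2] by (simp add: mult.commute)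
  then have "has_bochner_integral lborel (\<lambda>w::real^2. 2 / (1 + (norm w)\<^sup>2)\<^sup>2) (2 * pi)"
    by (intro has_bochner_integral_nn_integral) auto
  then show "integrable lborel (\<lambda>w::real^2. 2 / (1 + (norm w)\<^sup>2)\<^sup>2)"
    "(LINT w|lborel. 2 / (1 + (norm (w::real^2))\<^sup>2)\<^sup>2) = 2 * pi"
    by (auto simp: has_bochner_integral_iff)
qed

text \<open>The Laplacian of the smoothed logarithm is the dilation of a fixed integrable kernel.\<close>
lemma integral_reg_kernel:
  fixes f :: "real^2 \<Rightarrow> real"
  assumes f [measurable]: "f \<in> borel_measurable borel" and t: "0 < t"
  shows "(LINT y|lborel. f y * (2 * t\<^sup>2 / (t\<^sup>2 + (norm (y - x))\<^sup>2)\<^sup>2))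
    = (LINT w|lborel. f (x + t *\<^sub>R w) * (2 / (1 + (norm w)\<^sup>2)\<^sup>2))"
proof -
  define G where "G y = f y * (2 * t\<^sup>2 / (t\<^sup>2 + (norm (y - x))\<^sup>2)\<^sup>2)" for y
  have [measurable]: "G \<in> borel_measurable borel" unfolding G_def by measurable
  have "lborel = density (distr lborel borel (\<lambda>w. x + t *\<^sub>R w)) (\<lambda>_. ennreal (t ^ 2))"
    using lborel_affine[of t x] t by simp
  then have "(LINT y|lborel. G y) = (LINT y|density (distr lborel borel (\<lambda>w. x + t *\<^sub>R w)) (\<lambda>_. ennreal (t ^ 2)). G y)"
    by simp
  also have "\<dots> = (LINT w|lborel. t\<^sup>2 * G (x + t *\<^sub>R w))"
    by (subst integral_density) (auto simp: integral_distr)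
  also have "\<dots> = (LINT w|lborel. f (x + t *\<^sub>R w) * (2 / (1 + (norm w)\<^sup>2)\<^sup>2))"
  proof (intro Bochner_Integration.integral_cong refl)
    fix w :: "real^2"
    have "t\<^sup>2 * (2 * t\<^sup>2 / (t\<^sup>2 + (norm (t *\<^sub>R w))\<^sup>2)\<^sup>2) = 2 / (1 + (norm w)\<^sup>2)\<^sup>2"
    proof -
      have "t\<^sup>2 + (norm (t *\<^sub>R w))\<^sup>2 = t\<^sup>2 * (1 + (norm w)\<^sup>2)" by (simp add: power_mult_distrib algebra_simps)
      moreover have "(1 + (norm w)\<^sup>2) \<noteq> 0" by (metis add_pos_nonneg less_irrefl zero_le_power2 zero_less_one)
      ultimately show ?thesis using t by (simp add: power_mult_distrib power2_eq_square)
    qed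
    moreover have "t\<^sup>2 * G (x + t *\<^sub>R w) = f (x + t *\<^sub>R w) * (t\<^sup>2 * (2 * t\<^sup>2 / (t\<^sup>2 + (norm (t *\<^sub>R w))\<^sup>2)\<^sup>2))"
      unfolding G_def add_diff_cancel_left' by (rule mult.left_commute)
    ultimately show "t\<^sup>2 * G (x + t *\<^sub>R w) = f (x + t *\<^sub>R w) * (2 / (1 + (norm w)\<^sup>2)\<^sup>2)"
      by simp
  qed
  finally show ?thesis by (simp add: G_def)
qed

lemma integrable_lapl_ln:
  assumes f: "class_C2 f" and z: "\<And>y. r < norm y \<Longrightarrow> f y = 0"
  shows "integrable lborel (\<lambda>y. lapl f y * ln (norm (y - x)))"
proof -
  define R where "R = \<bar>r\<bar> + 1"
  have o: "open {y::real^2. r < norm y}" by (intro open_Collect_less continuous_intros)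
  have lz: "lapl f y = 0" if "r < norm y" for y
    by (rule lapl_vanishes[OF o]) (use that z in auto)
  have cl: "continuous_on UNIV (lapl f)" by (rule lapl_continuous[OF f])
  have [measurable]: "lapl f \<in> borel_measurable borel" using cl by (rule borel_measurable_continuous_onI)
  obtain K where K: "\<And>y. y \<in> cball 0 R \<Longrightarrow> \<bar>lapl f y\<bar> \<le> K"
  proof -
    have "bounded (lapl f ` cball 0 R)"
      by (intro compact_imp_bounded compact_continuous_image continuous_on_subset[OF cl]) auto
    then show ?thesis using that unfolding bounded_iff by (metis imageI real_norm_def)
  qed
  have "integrable lborel (\<lambda>y. K * (indicator (cball 0 R) y *\<^sub>R ln (norm (y - x))))"
    using integrable_cball_ln[of R 0 x] by (simp add: set_integrable_def R_def)
  then show ?thesis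
  proof (rule Bochner_Integration.integrable_bound)
    have "norm (lapl f y * ln (norm (y - x))) \<le> norm (K * (indicator (cball 0 R) y *\<^sub>R ln (norm (y - x))))" for y
    proof (cases "y \<in> cball 0 R")
      case True
      then have "\<bar>lapl f y\<bar> \<le> \<bar>K\<bar>" using K[OF True] by simp
      then show ?thesis using True by (simp add: abs_mult mult_right_mono)
    next
      case False
      then show ?thesis using lz[of y] by (simp add: R_def)
    qed
    then show "AE y in lborel. norm (lapl f y * ln (norm (y - x))) \<le> norm (K * (indicator (cball 0 R) y *\<^sub>R ln (norm (y - x))))"
      by simp
  qed measurable
qed

text \<open>The logarithm is smoothed to \<open>ln (t\<^sup>2 + (norm (y - x))\<^sup>2) / 2\<close>. Two integrations by
  parts move the Laplacian onto it, where it becomes an approximate identity of mass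
  \<open>2 * pi\<close> as \<open>t\<close> tends to \<open>0\<close>.\<close>
lemma green_representation:
  assumes f: "class_C2 f" and z: "\<And>y. r < norm y \<Longrightarrow> f y = 0"
  shows "(LINT y|lborel. lapl f y * ln (norm (y - x))) = 2 * pi * f x"
proof -
  define t where "t n = 1 / real (Suc n)" for n
  have t: "0 < t n" "t n \<le> 1" for n by (auto simp: t_def)
  have t0: "t \<longlonglongrightarrow> 0" unfolding t_def[abs_def] using LIMSEQ_inverse_real_of_nat by (simp add: inverse_eq_divide)
  have cf: "continuous_on UNIV f" by (rule class_C2_continuous[OF f])
  have fm [measurable]: "f \<in> borel_measurable borel" using cf by (rule borel_measurable_continuous_onI)
  have cl: "continuous_on UNIV (lapl f)" by (rule lapl_continuous[OF f])
  have lm [measurable]: "lapl f \<in> borel_measurable borel" using cl by (rule borel_measurable_continuous_onI)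
  have o: "open {y::real^2. r < norm y}" by (intro open_Collect_less continuous_intros)
  have lz: "lapl f y = 0" if "r < norm y" for y
    by (rule lapl_vanishes[OF o]) (use that z in auto)
  define A where "A n = (LINT y|lborel. lapl f y * (ln ((t n)\<^sup>2 + (norm (y - x))\<^sup>2) / 2))" for n
  have A_eq: "A n = (LINT w|lborel. f (x + t n *\<^sub>R w) * (2 / (1 + (norm w)\<^sup>2)\<^sup>2))" for n
  proof -
    have p: "0 < (t n)\<^sup>2" using t(1)[of n] by simp
    have "A n = (LINT y|lborel. f y * lapl (\<lambda>y. ln ((t n)\<^sup>2 + (norm (y - x))\<^sup>2) / 2) y)"
      unfolding A_def by (rule second_green[OF f reg_log_C2[OF p] z])
    then show ?thesis
      unfolding lapl_reg_log[OF p] using integral_reg_kernel[OF fm t(1)] by simp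
  qed
  obtain K where K: "\<And>y. \<bar>f y\<bar> \<le> K"
  proof -
    have "bounded (f ` cball 0 r)"
      by (intro compact_imp_bounded compact_continuous_image continuous_on_subset[OF cf]) auto
    then obtain K where "\<And>y. y \<in> cball 0 r \<Longrightarrow> \<bar>f y\<bar> \<le> K"
      unfolding bounded_iff by (metis imageI real_norm_def)
    then have "\<bar>f y\<bar> \<le> max K 0" for y using z[of y] by (cases "norm y \<le> r") force+
    then show ?thesis using that by blast
  qed
  have "A \<longlonglongrightarrow> (LINT w|lborel. f x * (2 / (1 + (norm (w::real^2))\<^sup>2)\<^sup>2))"
    unfolding A_eq[abs_def]
  proof (rule integral_dominated_convergence)
    show "integrable lborel (\<lambda>w::real^2. K * (2 / (1 + (norm w)\<^sup>2)\<^sup>2))"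
      by (rule integrable_mult_right[OF integrable_cauchy_kernel])
    show "AE w in lborel. (\<lambda>n. f (x + t n *\<^sub>R w) * (2 / (1 + (norm w)\<^sup>2)\<^sup>2)) \<longlonglongrightarrow> f x * (2 / (1 + (norm w)\<^sup>2)\<^sup>2)"
    proof (rule AE_I2)
      fix w :: "real^2"
      have "(\<lambda>n. x + t n *\<^sub>R w) \<longlonglongrightarrow> x + 0 *\<^sub>R w" by (intro tendsto_intros t0)
      then have "(\<lambda>n. f (x + t n *\<^sub>R w)) \<longlonglongrightarrow> f x"
        using continuous_on_tendsto_compose[OF cf] by simp
      then show "(\<lambda>n. f (x + t n *\<^sub>R w) * (2 / (1 + (norm w)\<^sup>2)\<^sup>2)) \<longlonglongrightarrow> f x * (2 / (1 + (norm w)\<^sup>2)\<^sup>2)"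
        by (intro tendsto_mult tendsto_const)
    qed
    show "AE w in lborel. norm (f (x + t n *\<^sub>R w) * (2 / (1 + (norm w)\<^sup>2)\<^sup>2)) \<le> K * (2 / (1 + (norm w)\<^sup>2)\<^sup>2)" for n
      using K by (intro AE_I2) (simp add: abs_mult mult_right_mono divide_right_mono)
    have "(\<lambda>w. f (x + t n *\<^sub>R w)) \<in> borel_measurable borel" for n
      by (intro borel_measurable_continuous_onI continuous_on_compose2[OF cf] continuous_intros) auto
    then show "(\<lambda>w. f (x + t n *\<^sub>R w) * (2 / (1 + (norm w)\<^sup>2)\<^sup>2)) \<in> borel_measurable lborel" for n
      by simp
  qed simp
  moreover have "A \<longlonglongrightarrow> (LINT y|lborel. lapl f y * ln (norm (y - x)))"
    unfolding A_def
  proof (rule integral_dominated_convergence)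
    have c2: "continuous_on UNIV (\<lambda>y. \<bar>lapl f y\<bar> * ln (1 + (norm (y - x))\<^sup>2))"
    proof -
      have "1 + (norm (y - x))\<^sup>2 \<noteq> 0" for y by (metis add_pos_nonneg less_irrefl zero_le_power2 zero_less_one)
      then show ?thesis by (intro continuous_intros cl) auto
    qed
    have i2: "integrable lborel (\<lambda>y. \<bar>lapl f y\<bar> * ln (1 + (norm (y - x))\<^sup>2))"
      by (rule integrable_compact_support[OF c2, of r]) (simp add: lz)
    show "integrable lborel (\<lambda>y. \<bar>lapl f y * ln (norm (y - x))\<bar> + \<bar>lapl f y\<bar> * ln (1 + (norm (y - x))\<^sup>2))"
      by (rule Bochner_Integration.integrable_add[OF integrable_abs[OF integrable_lapl_ln[OF f z]] i2])
    show "AE y in lborel. (\<lambda>n. lapl f y * (ln ((t n)\<^sup>2 + (norm (y - x))\<^sup>2) / 2)) \<longlonglongrightarrow> lapl f y * ln (norm (y - x))"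
      using AE_lborel_singleton[of x]
    proof eventually_elim
      case (elim y)
      have "(\<lambda>n. ln ((t n)\<^sup>2 + (norm (y - x))\<^sup>2) / 2) \<longlonglongrightarrow> ln (0\<^sup>2 + (norm (y - x))\<^sup>2) / 2"
        using elim by (intro tendsto_intros t0) auto
      moreover have "ln (0\<^sup>2 + (norm (y - x))\<^sup>2) / 2 = ln (norm (y - x))"
        using elim by (simp add: ln_realpow)
      ultimately show ?case by (intro tendsto_mult tendsto_const) simp
    qed
    show "AE y in lborel. norm (lapl f y * (ln ((t n)\<^sup>2 + (norm (y - x))\<^sup>2) / 2))
       \<le> \<bar>lapl f y * ln (norm (y - x))\<bar> + \<bar>lapl f y\<bar> * ln (1 + (norm (y - x))\<^sup>2)" for n
      using AE_lborel_singleton[of x]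
    proof eventually_elim
      case (elim y)
      define d where "d = norm (y - x)"
      have d: "0 < d" using elim by (simp add: d_def)
      have t1: "(t n)\<^sup>2 \<le> 1" using t[of n] by (simp add: power_le_one)
      have p: "0 < (t n)\<^sup>2 + d\<^sup>2" using d by (simp add: add_nonneg_pos)
      have "ln (d\<^sup>2) \<le> ln ((t n)\<^sup>2 + d\<^sup>2)" using d p by (subst ln_le_cancel_iff) auto
      then have l: "ln d \<le> ln ((t n)\<^sup>2 + d\<^sup>2) / 2" using d by (simp add: ln_realpow)
      have u: "ln ((t n)\<^sup>2 + d\<^sup>2) \<le> ln (1 + d\<^sup>2)" using t1 p by (subst ln_le_cancel_iff) (auto intro: add_pos_nonneg)
      have "0 \<le> ln (1 + d\<^sup>2)" by simp
      then have "\<bar>ln ((t n)\<^sup>2 + d\<^sup>2) / 2\<bar> \<le> \<bar>ln d\<bar> + ln (1 + d\<^sup>2)" using l u by linarith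
      then have "\<bar>lapl f y\<bar> * \<bar>ln ((t n)\<^sup>2 + d\<^sup>2) / 2\<bar> \<le> \<bar>lapl f y\<bar> * (\<bar>ln d\<bar> + ln (1 + d\<^sup>2))"
        by (rule mult_left_mono) simp
      then show ?case unfolding d_def[symmetric] by (simp add: abs_mult distrib_left)
    qed
  qed (use lm in simp_all)
  ultimately have "(LINT y|lborel. lapl f y * ln (norm (y - x))) = (LINT w|lborel. f x * (2 / (1 + (norm (w::real^2))\<^sup>2)\<^sup>2))"
    using LIMSEQ_unique by blast
  also have "\<dots> = f x * (LINT w|lborel. 2 / (1 + (norm (w::real^2))\<^sup>2)\<^sup>2)"
    by (rule integral_mult_right_zero)
  finally show ?thesis by (simp add: integral_cauchy_kernel)
qed

lemma integral_lapl_norm_sq: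
  assumes f: "class_C2 f" and z: "\<And>y. r < norm y \<Longrightarrow> f y = 0"
  shows "(LINT y|lborel. lapl f y * (norm y)\<^sup>2) = 4 * (LINT y|lborel. f y)"
  using second_green[OF f norm_sq_C2 z] by (simp add: lapl_norm_sq)

lemma integral_lapl:
  assumes f: "class_C2 f" and z: "\<And>y. r < norm y \<Longrightarrow> f y = 0"
  shows "(LINT y|lborel. lapl f y) = 0"
proof -
  have p0: "partial_deriv i (\<lambda>_. c) = (\<lambda>_. 0)" for i and c :: real
    by (rule ext) (simp add: partial_derivI[OF has_derivative_const])
  have "class_C2 (\<lambda>_. 1)" by (simp add: class_C2_def p0)
  from second_green[OF f this z] show ?thesis by (simp add: lapl_def p0)
qed

section \<open>Configurations with moderate potential\<close>

text \<open>The potential generated by the particles minus the one generated by \<open>N\<close> times the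
  uniform measure on the disc; outside the disc the latter is continued by its quadratic
  expression. Up to the constant \<open>N / 2\<close> it is the energy needed to add a particle at \<open>x\<close>.\<close>
definition local_potential :: "nat \<Rightarrow> (nat \<Rightarrow> real^2) \<Rightarrow> real^2 \<Rightarrow> real" where
  "local_potential N X x = (\<Sum>j<N. - ln (norm (x - X j))) + real N * ((norm x)\<^sup>2 - 1) / 2"

text \<open>The potential that acts on the particle \<open>i\<close>: its interaction with itself is left out.\<close>
definition reduced_potential :: "nat \<Rightarrow> (nat \<Rightarrow> real^2) \<Rightarrow> nat \<Rightarrow> real" where
  "reduced_potential N X i = (\<Sum>j\<in>{..<N} - {i}. - ln (norm (X i - X j))) + real N * ((norm (X i))\<^sup>2 - 1) / 2"

text \<open>These bounds suffice for all fluctuations at once. The weight \<open>1 / (1 + (norm x)\<^sup>2)\<^sup>2\<close>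
  has a finite integral, as the removal of a particle requires, and decays only
  polynomially; since the second moment is bounded by a power of \<open>N\<close>, dividing by the weight
  costs another power of \<open>N\<close>.\<close>
definition good_config :: "real \<Rightarrow> real \<Rightarrow> nat \<Rightarrow> (nat \<Rightarrow> real^2) \<Rightarrow> bool" where
  "good_config \<beta> B N X \<longleftrightarrow> inj_on X {..<N}
     \<and> (\<integral>\<^sup>+x. ennreal (exp (- \<beta> * local_potential N X x)) \<partial>lborel) \<le> ennreal (real N powr B)
     \<and> (\<forall>i<N. exp (\<beta> * reduced_potential N X i) / (1 + (norm (X i))\<^sup>2)\<^sup>2 \<le> real N powr B)
     \<and> second_moment N X \<le> real N powr B"

lemma ln_ge_one: "3 \<le> N \<Longrightarrow> 1 \<le> ln (real N)"
  using exp_le by (subst ln_ge_iff) auto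

lemma local_potential_measurable [measurable]: "local_potential N X \<in> borel_measurable borel"
  unfolding local_potential_def[abs_def] by measurable

lemma local_potential_integrable:
  assumes R: "0 < R" and D: "D \<in> sets borel" "D \<subseteq> cball z R"
  shows "set_integrable lborel D (local_potential N X)"
proof -
  have "set_integrable lborel (cball z R) (\<lambda>x. real N * ((norm x)\<^sup>2 - 1) / 2)"
    unfolding set_integrable_def by (intro borel_integrable_compact continuous_intros) auto
  moreover have "set_integrable lborel (cball z R) (\<lambda>x. \<Sum>j<N. - ln (norm (x - X j)))"
    unfolding set_integrable_def scaleR_sum_right
    using integrable_cball_ln[OF R, of z] by (intro Bochner_Integration.integrable_sum) (simp add: set_integrable_def)
  ultimately have "set_integrable lborel (cball z R) (local_potential N X)"
    unfolding local_potential_def[abs_def] by (intro set_integral_add(1))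
  then show ?thesis by (rule set_integrable_subset) (use D in auto)
qed

lemma good_reduced_potential_le:
  assumes \<beta>: "0 < \<beta>" and B: "1 \<le> B" and N: "3 \<le> N" and good: "good_config \<beta> B N X" and i: "i < N"
  shows "reduced_potential N X i \<le> (3 * B + 2) / \<beta> * ln (real N)"
proof -
  define l where "l = ln (real N)"
  have l: "1 \<le> l" using ln_ge_one[OF N] by (simp add: l_def)
  have NB: "1 \<le> real N powr B" using N B by (intro ge_one_powr_ge_zero) auto
  have "(norm (X i))\<^sup>2 \<le> second_moment N X"
    unfolding second_moment_def using i by (intro member_le_sum) auto
  also have "\<dots> \<le> real N powr B" using good by (simp add: good_config_def)
  finally have "1 + (norm (X i))\<^sup>2 \<le> 2 * real N powr B" using NB by simp
  then have "(1 + (norm (X i))\<^sup>2)\<^sup>2 \<le> (2 * real N powr B)\<^sup>2" by (intro power_mono) auto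
  moreover have "exp (\<beta> * reduced_potential N X i) \<le> real N powr B * (1 + (norm (X i))\<^sup>2)\<^sup>2"
  proof -
    have "0 < (1 + (norm (X i))\<^sup>2)\<^sup>2" by (intro zero_less_power add_pos_nonneg) auto
    moreover have "exp (\<beta> * reduced_potential N X i) / (1 + (norm (X i))\<^sup>2)\<^sup>2 \<le> real N powr B"
      using good i by (simp add: good_config_def)
    ultimately show ?thesis by (subst (asm) pos_divide_le_eq)
  qed
  ultimately have "exp (\<beta> * reduced_potential N X i) \<le> real N powr B * (2 * real N powr B)\<^sup>2"
    by (meson mult_left_mono order_trans powr_ge_zero)
  also have "\<dots> = 4 * exp (3 * B * l)"
    using N by (simp add: powr_def l_def power_mult_distrib power2_eq_square mult_exp_exp algebra_simps)
  also have "\<dots> \<le> exp (2 * l) * exp (3 * B * l)"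
  proof (rule mult_right_mono)
    have "2 \<le> exp l" using exp_ge_add_one_self[of l] l by linarith
    then have "2 * 2 \<le> exp l * exp l" by (intro mult_mono) auto
    then show "4 \<le> exp (2 * l)" by (simp add: mult_exp_exp)
  qed simp
  finally have "exp (\<beta> * reduced_potential N X i) \<le> exp (2 * l + 3 * B * l)" by (simp add: exp_add)
  then have "\<beta> * reduced_potential N X i \<le> (3 * B + 2) * l" by (simp add: algebra_simps)
  then show ?thesis using \<beta> by (simp add: l_def field_simps)
qed

text \<open>The exponential integral controls the negative part on every set through
  \<open>y \<le> t + exp (y - t)\<close>; \<open>t\<close> will be a multiple of \<open>ln N\<close> that makes the second term at most
  comparable to the area of the set.\<close>
lemma good_negative_part:
  assumes \<beta>: "0 < \<beta>" and good: "good_config \<beta> B N X" and t: "0 \<le> t"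
    and R: "0 < R" and D: "D \<in> sets borel" "D \<subseteq> cball z R"
  shows "\<beta> * (LINT x:D|lborel. max (- local_potential N X x) 0) \<le> t * measure lborel D + exp (- t) * real N powr B"
    and "set_integrable lborel D (\<lambda>x. max (- local_potential N X x) 0)"
proof -
  let ?h = "local_potential N X"
  have nn: "(\<integral>\<^sup>+x. ennreal (exp (- \<beta> * ?h x)) \<partial>lborel) \<le> ennreal (real N powr B)"
    using good by (simp add: good_config_def)
  have ie: "integrable lborel (\<lambda>x. exp (- \<beta> * ?h x))"
    using nn by (intro integrableI_nonneg) (auto intro: le_less_trans)
  have el: "(LINT x|lborel. exp (- \<beta> * ?h x)) \<le> real N powr B"
    using nn by (subst (asm) nn_integral_eq_integral[OF ie]) auto
  have ih: "integrable lborel (\<lambda>x. indicator D x *\<^sub>R ?h x)"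
    using local_potential_integrable[OF R D] by (simp add: set_integrable_def)
  have im: "integrable lborel (\<lambda>x. indicator D x *\<^sub>R max (- ?h x) 0)"
  proof (rule Bochner_Integration.integrable_bound[OF ih])
    show "(\<lambda>x. indicator D x *\<^sub>R max (- ?h x) 0) \<in> borel_measurable lborel"
      using D by measurable
  qed (auto split: split_indicator)
  then show "set_integrable lborel D (\<lambda>x. max (- ?h x) 0)" by (simp add: set_integrable_def)
  have fin: "emeasure lborel D < \<infinity>"
    using emeasure_mono[OF D(2), of lborel] emeasure_bounded_finite[OF bounded_cball[of z R]] by (auto intro: le_less_trans)
  have iD: "integrable lborel (\<lambda>x. indicator D x * t)"
    using D fin by (intro integrable_mult_left integrable_real_indicator) auto
  have "(LINT x|lborel. \<beta> * (indicator D x *\<^sub>R max (- ?h x) 0)) \<le> (LINT x|lborel. indicator D x * t + exp (- t) * exp (- \<beta> * ?h x))"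
  proof (rule integral_mono)
    show "integrable lborel (\<lambda>x. \<beta> * (indicator D x *\<^sub>R max (- ?h x) 0))" using im by (rule integrable_mult_right)
    show "integrable lborel (\<lambda>x. indicator D x * t + exp (- t) * exp (- \<beta> * ?h x))"
      by (intro Bochner_Integration.integrable_add iD integrable_mult_right ie)
    fix x :: "real^2"
    have "\<beta> * max (- ?h x) 0 \<le> t + exp (- \<beta> * ?h x - t)"
    proof (cases "0 \<le> - ?h x")
      case True
      then have "\<beta> * max (- ?h x) 0 = - \<beta> * ?h x" by simp
      then show ?thesis using exp_ge_add_one_self[of "- \<beta> * ?h x - t"] by linarith
    next
      case False
      then have "max (- ?h x) 0 = 0" by simp
      then show ?thesis using t by (simp add: add_nonneg_nonneg)
    qed
    also have "exp (- \<beta> * ?h x - t) = exp (- t) * exp (- \<beta> * ?h x)" by (simp add: mult_exp_exp)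
    finally show "\<beta> * (indicator D x *\<^sub>R max (- ?h x) 0) \<le> indicator D x * t + exp (- t) * exp (- \<beta> * ?h x)"
      by (auto split: split_indicator)
  qed
  also have "\<dots> = t * measure lborel D + exp (- t) * (LINT x|lborel. exp (- \<beta> * ?h x))"
  proof -
    have "(LINT x|lborel. indicator D x * t) = t * measure lborel D"
      using D fin by (simp add: mult.commute)
    then show ?thesis
      by (subst Bochner_Integration.integral_add[OF iD integrable_mult_right[OF ie]]) (simp only: integral_mult_right_zero)
  qed
  also have "\<dots> \<le> t * measure lborel D + exp (- t) * real N powr B"
    using el by (intro add_left_mono mult_left_mono) auto
  finally show "\<beta> * (LINT x:D|lborel. max (- ?h x) 0) \<le> t * measure lborel D + exp (- t) * real N powr B"
    unfolding set_lebesgue_integral_def integral_mult_right_zero .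
qed

lemma measure_cball2: "0 \<le> R \<Longrightarrow> measure lborel (cball (z::real^2) R) = pi * R\<^sup>2"
  using content_cball[of R z] by (simp add: unit_ball_vol_2)

text \<open>Superharmonicity of \<open>- ln\<close>, with a gain for points near the centre: the left-hand side
  is the mean of \<open>- ln\<close> of the distance to a point at distance \<open>d\<close> from the centre, over a
  disc of radius \<open>R\<close>.\<close>
lemma disc_log_mean_ge:
  fixes d R \<delta> l :: real
  assumes d: "0 < d" and R: "0 < R" and l: "0 \<le> l" and \<delta>: "ln \<delta> = ln R - 2 * l" "0 < \<delta>"
  shows "- (if R \<le> d then ln d else ln R - 1/2 + d\<^sup>2 / (2 * R\<^sup>2)) \<le> - ln d - (if d < \<delta> then 2 * l - 1/2 else 0)"
proof -
  have \<delta>R: "\<delta> \<le> R"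
  proof -
    have "ln \<delta> \<le> ln R" using \<delta> l by simp
    then show ?thesis using \<delta>(2) R by (subst (asm) ln_le_cancel_iff)
  qed
  consider "R \<le> d" | "d < R" "d < \<delta>" | "d < R" "\<delta> \<le> d" by linarith
  then show ?thesis
  proof cases
    case 1
    then show ?thesis using \<delta>R by simp
  next
    case 2
    then have "ln d \<le> ln \<delta>" using d \<delta>(2) by (subst ln_le_cancel_iff) auto
    moreover have "0 \<le> d\<^sup>2 / (2 * R\<^sup>2)" by simp
    moreover have "\<not> R \<le> d" using 2 by simp
    ultimately show ?thesis using 2(2) \<delta>(1) by (simp only: if_True if_False)
  next
    case 3
    have "ln ((d / R)\<^sup>2) \<le> (d / R)\<^sup>2 - 1" using d R by (intro ln_le_minus_one) auto
    moreover have "ln ((d / R)\<^sup>2) = 2 * (ln d - ln R)" using d R by (simp add: ln_realpow ln_div)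
    ultimately have "2 * (ln d - ln R) \<le> d\<^sup>2 / R\<^sup>2 - 1" by (simp add: power_divide)
    then have "ln d \<le> ln R - 1/2 + d\<^sup>2 / (2 * R\<^sup>2)" by (simp add: field_simps)
    then show ?thesis using 3 by simp
  qed
qed

lemma good_norm_le:
  assumes B: "1 \<le> B" and N: "3 \<le> N" and good: "good_config \<beta> B N X" and i: "i < N"
  shows "norm (X i) \<le> real N powr B"
proof -
  have NB: "1 \<le> real N powr B" using N B by (intro ge_one_powr_ge_zero) auto
  have "(norm (X i))\<^sup>2 \<le> second_moment N X"
    unfolding second_moment_def using i by (intro member_le_sum) auto
  also have "\<dots> \<le> real N powr B" using good by (simp add: good_config_def)
  also have "\<dots> \<le> real N powr B * real N powr B" using mult_left_mono[OF NB, of "real N powr B"] by simp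
  finally have "(norm (X i))\<^sup>2 \<le> (real N powr B)\<^sup>2" by (simp add: power2_eq_square)
  then show ?thesis by (rule power2_le_imp_le) simp
qed

text \<open>If many particles were close to the particle \<open>i\<close>, the mean of the potential over a
  larger, but still tiny, disc around it would, up to a fixed multiple of \<open>ln N\<close>, fall below
  the potential acting on \<open>i\<close> by about \<open>2 * ln N\<close> for each of them. As the latter is at most
  of order \<open>ln N\<close>, the mean would become more negative than \<open>good_negative_part\<close> allows,
  unless the number of close particles is bounded.\<close>
lemma good_cluster_bound:
  assumes \<beta>: "0 < \<beta>" and B: "1 \<le> B" and N: "3 \<le> N" and good: "good_config \<beta> B N X" and i: "i < N"
  shows "real (card {j \<in> {..<N} - {i}. norm (X i - X j) < real N powr (- (B + 3))})
    \<le> (3 * B + 2) / \<beta> + (B + 3) + (3 * B + 3) / \<beta>"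
proof -
  define l where "l = ln (real N)"
  have l: "1 \<le> l" using ln_ge_one[OF N] by (simp add: l_def)
  \<comment> \<open>the radius of the disc is chosen such that \<open>N * norm (X i) * R \<le> 1\<close>, so that the
    confinement is constant on it up to a bounded error, and \<open>\<delta> = R / N\<^sup>2\<close> produces the
    gain \<open>2 * ln N\<close>\<close>
  define R where "R = real N powr (- (B + 1))"
  define \<delta> where "\<delta> = real N powr (- (B + 3))"
  have R: "0 < R" "ln R = - (B + 1) * l" using N by (auto simp: R_def l_def ln_powr)
  have \<delta>: "0 < \<delta>" "ln \<delta> = ln R - 2 * l" using N by (auto simp: \<delta>_def R_def l_def ln_powr algebra_simps)
  define k where "k = real (card {j \<in> {..<N} - {i}. norm (X i - X j) < \<delta>})"
  let ?D = "cball (X i) R"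
  let ?h = "local_potential N X"
  define V where "V j = (if R \<le> norm (X j - X i) then ln (norm (X j - X i)) else ln R - 1/2 + (norm (X j - X i))\<^sup>2 / (2 * R\<^sup>2))" for j
  define q where "q = real N * ((norm (X i) + R)\<^sup>2 - 1) / 2"
  have inj: "inj_on X {..<N}" using good by (simp add: good_config_def)
  have mD: "measure lborel ?D = pi * R\<^sup>2" using R by (simp add: measure_cball2)
  have iln: "set_integrable lborel ?D (\<lambda>x. - ln (norm (x - X j)))" for j
    using integrable_cball_ln[OF R(1), of "X i" "X j"] by (simp add: set_integrable_def)
  have isum: "set_integrable lborel ?D (\<lambda>x. \<Sum>j<N. - ln (norm (x - X j)))"
    unfolding set_integrable_def scaleR_sum_right
    using iln by (intro Bochner_Integration.integrable_sum) (simp add: set_integrable_def)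
  have iq: "set_integrable lborel ?D (\<lambda>_. q)"
    unfolding set_integrable_def by (intro borel_integrable_compact continuous_intros) auto
  have up1: "(LINT x:?D|lborel. ?h x) \<le> (LINT x:?D|lborel. (\<Sum>j<N. - ln (norm (x - X j))) + q)"
  proof (rule set_integral_mono)
    show "set_integrable lborel ?D ?h" by (rule local_potential_integrable[OF R(1)]) auto
    show "set_integrable lborel ?D (\<lambda>x. (\<Sum>j<N. - ln (norm (x - X j))) + q)"
      by (intro set_integral_add(1) isum iq)
    fix x assume "x \<in> ?D"
    then have "norm x \<le> norm (X i) + R" using norm_triangle_sub[of x "X i"] by (simp add: dist_norm norm_minus_commute)
    then have "(norm x)\<^sup>2 \<le> (norm (X i) + R)\<^sup>2" by (intro power_mono) auto
    then have "real N * ((norm x)\<^sup>2 - 1) \<le> real N * ((norm (X i) + R)\<^sup>2 - 1)" by (intro mult_left_mono) auto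
    then show "?h x \<le> (\<Sum>j<N. - ln (norm (x - X j))) + q" by (simp add: local_potential_def q_def divide_right_mono)
  qed
  have val: "(LINT x:?D|lborel. (\<Sum>j<N. - ln (norm (x - X j))) + q) = pi * R\<^sup>2 * ((\<Sum>j<N. - V j) + q)"
  proof -
    have "(LINT x:?D|lborel. (\<Sum>j<N. - ln (norm (x - X j))) + q)
      = (LINT x:?D|lborel. (\<Sum>j<N. - ln (norm (x - X j)))) + (LINT x:?D|lborel. q)"
      by (rule set_integral_add(2)[OF isum iq])
    also have "(LINT x:?D|lborel. (\<Sum>j<N. - ln (norm (x - X j)))) = (\<Sum>j<N. (LINT x:?D|lborel. - ln (norm (x - X j))))"
      unfolding set_lebesgue_integral_def scaleR_sum_right
      by (rule Bochner_Integration.integral_sum) (use iln in \<open>simp add: set_integrable_def\<close>)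
    also have "\<dots> = (\<Sum>j<N. pi * R\<^sup>2 * - V j)"
    proof (intro sum.cong refl)
      fix j
      have "(LINT x:?D|lborel. - ln (norm (x - X j))) = - (LINT x:?D|lborel. ln (norm (x - X j)))"
        by (simp add: set_lebesgue_integral_def)
      then show "(LINT x:?D|lborel. - ln (norm (x - X j))) = pi * R\<^sup>2 * - V j"
        using integral_cball_ln[OF R(1), of "X i" "X j"] by (simp add: V_def)
    qed
    also have "(LINT x:?D|lborel. q) = pi * R\<^sup>2 * q"
      by (simp add: set_lebesgue_integral_def mD)
    finally show ?thesis by (simp add: sum_distrib_left distrib_left)
  qed
  have Vsum: "(\<Sum>j<N. - V j) \<le> (B + 1) * l + 1/2 + (\<Sum>j\<in>{..<N} - {i}. - ln (norm (X i - X j))) - k * (2 * l - 1/2)"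
  proof -
    have "(\<Sum>j<N. - V j) = - V i + (\<Sum>j\<in>{..<N} - {i}. - V j)"
      using i by (subst sum.remove[of _ i]) auto
    moreover have "- V i = (B + 1) * l + 1/2" using R by (simp add: V_def algebra_simps)
    moreover have "(\<Sum>j\<in>{..<N} - {i}. - V j) \<le> (\<Sum>j\<in>{..<N} - {i}. - ln (norm (X i - X j)) - (if norm (X i - X j) < \<delta> then 2 * l - 1/2 else 0))"
    proof (rule sum_mono)
      fix j assume j: "j \<in> {..<N} - {i}"
      then have "X j \<noteq> X i" using inj i by (auto dest: inj_onD)
      then have "0 < norm (X j - X i)" by simp
      from disc_log_mean_ge[OF this R(1) _ \<delta>(2,1)] l
      show "- V j \<le> - ln (norm (X i - X j)) - (if norm (X i - X j) < \<delta> then 2 * l - 1/2 else 0)"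
        by (simp add: V_def norm_minus_commute)
    qed
    moreover have "(\<Sum>j\<in>{..<N} - {i}. (if norm (X i - X j) < \<delta> then 2 * l - 1/2 else 0)) = k * (2 * l - 1/2)"
      by (simp add: k_def sum.inter_filter[symmetric])
    ultimately show ?thesis by (simp add: sum_subtractf)
  qed
  have q: "q \<le> real N * ((norm (X i))\<^sup>2 - 1) / 2 + 3/2"
  proof -
    have NB: "1 \<le> real N powr B" using N B by (intro ge_one_powr_ge_zero) auto
    have nx: "norm (X i) \<le> real N powr B" by (rule good_norm_le[OF B N good i])
    have NR: "real N * (real N powr B * R) = 1"
    proof -
      have "real N * (real N powr B * R) = real N powr 1 * real N powr B * real N powr (- (B + 1))" using N by (simp add: R_def)
      also have "\<dots> = real N powr (1 + B + - (B + 1))" by (simp only: powr_add)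
      finally show ?thesis using N by simp
    qed
    have "real N * (norm (X i) * R) \<le> real N * (real N powr B * R)" using nx R by (intro mult_left_mono mult_right_mono) auto
    then have a: "real N * (norm (X i) * R) \<le> 1" using NR by simp
    have R1: "R \<le> real N powr B * R" using mult_right_mono[OF NB, of R] R by simp
    have "real N * R \<le> real N * (real N powr B * R)" by (intro mult_left_mono R1) simp
    then have "real N * R \<le> 1" using NR by simp
    moreover have "R \<le> real N powr 0" unfolding R_def using N B by (intro powr_mono) auto
    then have "R \<le> 1" using N by simp
    ultimately have b: "real N * R\<^sup>2 \<le> 1" using R by (simp add: power2_eq_square mult.assoc[symmetric] mult_le_one)
    have "q = real N * ((norm (X i))\<^sup>2 - 1) / 2 + real N * (norm (X i) * R) + real N * R\<^sup>2 / 2"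
      by (simp add: q_def power2_eq_square field_simps)
    then show ?thesis using a b by linarith
  qed
  have upper: "(LINT x:?D|lborel. ?h x) \<le> pi * R\<^sup>2 * (reduced_potential N X i + (B + 1) * l + 2 - k * (2 * l - 1/2))"
  proof -
    have "(\<Sum>j<N. - V j) + q \<le> reduced_potential N X i + (B + 1) * l + 2 - k * (2 * l - 1/2)"
      using Vsum q by (simp add: reduced_potential_def)
    then have "pi * R\<^sup>2 * ((\<Sum>j<N. - V j) + q) \<le> pi * R\<^sup>2 * (reduced_potential N X i + (B + 1) * l + 2 - k * (2 * l - 1/2))"
      by (intro mult_left_mono) auto
    from order_trans[OF up1[unfolded val] this] show ?thesis .
  qed
  have lower: "- (((3 * B + 2) * l + 1) / \<beta>) * (pi * R\<^sup>2) \<le> (LINT x:?D|lborel. ?h x)"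
  proof -
    \<comment> \<open>makes \<open>exp (- t) * N powr B\<close> as small as \<open>R\<^sup>2\<close>, hence as the area of the disc\<close>
    define t where "t = (3 * B + 2) * l"
    have t: "0 \<le> t" using B l by (simp add: t_def)
    have et: "exp (- t) * real N powr B = R\<^sup>2"
      using N by (simp add: t_def R_def l_def powr_def power2_eq_square mult_exp_exp algebra_simps)
    note np = good_negative_part[OF \<beta> good t R(1), of ?D "X i"]
    have "\<beta> * (LINT x:?D|lborel. max (- ?h x) 0) \<le> t * (pi * R\<^sup>2) + R\<^sup>2"
      using np(1) by (simp add: et mD)
    also have "\<dots> \<le> (t + 1) * (pi * R\<^sup>2)"
    proof -
      have "1 * R\<^sup>2 \<le> pi * R\<^sup>2" using pi_gt3 by (intro mult_right_mono) auto
      then show ?thesis by (simp add: distrib_right)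
    qed
    finally have n: "(LINT x:?D|lborel. max (- ?h x) 0) \<le> ((t + 1) / \<beta>) * (pi * R\<^sup>2)" using \<beta> by (simp add: field_simps)
    have "(LINT x:?D|lborel. - max (- ?h x) 0) \<le> (LINT x:?D|lborel. ?h x)"
    proof (rule set_integral_mono)
      show "set_integrable lborel ?D (\<lambda>x. - max (- ?h x) 0)" using np(2) by (simp add: set_integrable_def)
      show "set_integrable lborel ?D ?h" by (rule local_potential_integrable[OF R(1)]) auto
    qed (simp add: max_def)
    moreover have "(LINT x:?D|lborel. - max (- ?h x) 0) = - (LINT x:?D|lborel. max (- ?h x) 0)"
      by (simp add: set_lebesgue_integral_def)
    ultimately show ?thesis using n by (simp add: t_def)
  qed
  have "pi * R\<^sup>2 * (- (((3 * B + 2) * l + 1) / \<beta>)) \<le> pi * R\<^sup>2 * (reduced_potential N X i + (B + 1) * l + 2 - k * (2 * l - 1/2))"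
    using order_trans[OF lower upper] by (simp only: mult.commute)
  then have "- (((3 * B + 2) * l + 1) / \<beta>) \<le> reduced_potential N X i + (B + 1) * l + 2 - k * (2 * l - 1/2)"
    using R by (subst (asm) mult_le_cancel_left_pos) auto
  moreover have "reduced_potential N X i \<le> (3 * B + 2) / \<beta> * l"
    unfolding l_def by (rule good_reduced_potential_le[OF \<beta> B N good i])
  moreover have "k * l \<le> k * (2 * l - 1/2)" using l by (intro mult_left_mono) (auto simp: k_def)
  moreover have "((3 * B + 2) * l + 1) / \<beta> \<le> (3 * B + 3) / \<beta> * l"
    using \<beta> l by (simp add: divide_simps algebra_simps)
  moreover have "2 \<le> 2 * l" using l by simp
  ultimately have "k * l \<le> ((3 * B + 2) / \<beta> + (B + 3) + (3 * B + 3) / \<beta>) * l"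
    by (simp only: distrib_right)
  then show ?thesis using l by (simp add: k_def \<delta>_def)
qed

definition potential_constant :: "real \<Rightarrow> real \<Rightarrow> real" where
  "potential_constant \<beta> B = (3 * B + 2) / \<beta> + (B + 5) + ((3 * B + 2) / \<beta> + (B + 3) + (3 * B + 3) / \<beta>) + 2"

text \<open>At the maximum point, which is within \<open>\<eta>\<close> of some particle \<open>i\<close>, the smoothed potential
  differs little from the potential acting on \<open>i\<close>: the contributions of the other particles
  grow by at most \<open>1 / N\<close> each, those of the boundedly many ones closer than \<open>\<delta> = \<eta> * N\<^sup>2\<close>
  by at most \<open>1\<close> more, and the particle \<open>i\<close> itself contributes \<open>- ln \<eta>\<close>.\<close>
lemma good_smoothed_potential_le:
  assumes \<beta>: "0 < \<beta>" and B: "1 \<le> B" and N: "3 \<le> N" and good: "good_config \<beta> B N X"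
    and \<rho>: "1/2 \<le> \<rho>" "\<rho> < 1" and z: "(norm z)\<^sup>2 \<le> \<rho>"
  shows "(\<Sum>j<N. - ln (max (norm (z - X j)) (real N powr (- (B + 5))))) + real N * ((norm z)\<^sup>2 - 1) / 2
    \<le> potential_constant \<beta> B * ln (real N)"
proof -
  define l where "l = ln (real N)"
  have l: "1 \<le> l" using ln_ge_one[OF N] by (simp add: l_def)
  define \<eta> where "\<eta> = real N powr (- (B + 5))"
  define \<delta> where "\<delta> = real N powr (- (B + 3))"
  have \<eta>: "0 < \<eta>" "ln \<eta> = - (B + 5) * l" using N by (auto simp: \<eta>_def l_def ln_powr)
  have \<delta>: "0 < \<delta>" using N by (simp add: \<delta>_def)
  have \<eta>\<delta>: "\<eta> * (real N)\<^sup>2 = \<delta>"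
  proof -
    have "\<eta> * (real N)\<^sup>2 = real N powr (- (B + 5)) * real N powr 2" using N by (simp add: \<eta>_def powr_numeral)
    also have "\<dots> = real N powr (- (B + 5) + 2)" by (simp only: powr_add)
    also have "- (B + 5) + 2 = - (B + 3)" by simp
    finally show ?thesis by (simp add: \<delta>_def)
  qed
  define F where "F z = (\<Sum>j<N. - ln (max (norm (z - X j)) \<eta>))" for z
  define K0 where "K0 = (3 * B + 2) / \<beta> + (B + 3) + (3 * B + 3) / \<beta>"
  obtain i y where i: "i < N" and y: "norm (y - X i) \<le> \<eta>"
    and mx: "F z + real N * ((norm z)\<^sup>2 - 1) / 2 \<le> F y + real N * ((norm y)\<^sup>2 - 1) / 2"
    using max_near_particle[of N \<rho> \<eta> X] N \<rho> \<eta>(1) z unfolding F_def by fastforce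
  have inj: "inj_on X {..<N}" using good by (simp add: good_config_def)
  define k where "k = real (card {j \<in> {..<N} - {i}. norm (X i - X j) < \<delta>})"
  have k: "k \<le> K0" unfolding k_def \<delta>_def K0_def by (rule good_cluster_bound[OF \<beta> B N good i])
  have Fy: "F y \<le> (B + 5) * l + (\<Sum>j\<in>{..<N} - {i}. - ln (norm (X i - X j))) + k + 1"
  proof -
    have "F y = - ln (max (norm (y - X i)) \<eta>) + (\<Sum>j\<in>{..<N} - {i}. - ln (max (norm (y - X j)) \<eta>))"
      unfolding F_def using i by (subst sum.remove[of _ i]) auto
    moreover have "- ln (max (norm (y - X i)) \<eta>) = (B + 5) * l" using y \<eta>(2) by (simp add: max_def algebra_simps)
    moreover have "(\<Sum>j\<in>{..<N} - {i}. - ln (max (norm (y - X j)) \<eta>))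
      \<le> (\<Sum>j\<in>{..<N} - {i}. - ln (norm (X i - X j)) + (if norm (X i - X j) < \<delta> then 1 else 0) + 1 / real N)"
    proof (rule sum_mono)
      fix j assume j: "j \<in> {..<N} - {i}"
      then have "X j \<noteq> X i" using inj i by (auto dest: inj_onD)
      then have d0: "0 < norm (X i - X j)" by simp
      define m where "m = max (norm (y - X j)) \<eta>"
      have m: "0 < m" "\<eta> \<le> m" "norm (y - X j) \<le> m" using \<eta> by (auto simp: m_def)
      have dm: "norm (X i - X j) \<le> \<eta> + m"
        using norm_triangle_ineq[of "X i - y" "y - X j"] y m by (simp add: norm_minus_commute)
      show "- ln m \<le> - ln (norm (X i - X j)) + (if norm (X i - X j) < \<delta> then 1 else 0) + 1 / real N"
      proof (cases "norm (X i - X j) < \<delta>")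
        case True
        have "norm (X i - X j) \<le> 2 * m" using dm m by simp
        then have "ln (norm (X i - X j)) \<le> ln (2 * m)" using d0 by (subst ln_le_cancel_iff) (use m in auto)
        also have "\<dots> = ln 2 + ln m" using m by (simp add: ln_mult)
        also have "\<dots> \<le> 1 + ln m" using ln_2_less_1 by simp
        finally have "- ln m \<le> - ln (norm (X i - X j)) + 1" by simp
        then show ?thesis using True by (simp add: add_increasing2)
      next
        case False
        have "\<eta> * (1 + 1 / real N) * real N \<le> \<delta>"
        proof -
          have "\<eta> * (1 + 1 / real N) * real N = \<eta> * (real N + 1)" using N by (simp add: field_simps)
          also have "\<dots> \<le> \<eta> * (real N)\<^sup>2"
          proof (rule mult_left_mono)
            have "real N + 1 \<le> real N * 2" using N by simp
            also have "\<dots> \<le> real N * real N" using N by (intro mult_left_mono) auto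
            finally show "real N + 1 \<le> (real N)\<^sup>2" by (simp add: power2_eq_square)
          qed (use \<eta> in simp)
          finally show ?thesis by (simp add: \<eta>\<delta>)
        qed
        then have "\<eta> * (1 + 1 / real N) \<le> \<delta> / real N" using N by (simp add: pos_le_divide_eq)
        also have "\<dots> \<le> norm (X i - X j) / real N" using False by (intro divide_right_mono) auto
        finally have s: "\<eta> * (1 + 1 / real N) \<le> norm (X i - X j) / real N" .
        have "norm (X i - X j) * (1 + 1 / real N) \<le> (\<eta> + m) * (1 + 1 / real N)"
          using dm by (intro mult_right_mono) auto
        moreover have "(\<eta> + m) * (1 + 1 / real N) = \<eta> * (1 + 1 / real N) + m * (1 + 1 / real N)"
          by (rule distrib_right)
        moreover have "norm (X i - X j) * (1 + 1 / real N) = norm (X i - X j) + norm (X i - X j) / real N"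
          by (simp add: distrib_left)
        ultimately have "norm (X i - X j) \<le> m * (1 + 1 / real N)" using s by linarith
        then have "ln (norm (X i - X j)) \<le> ln (m * (1 + 1 / real N))" using d0 by (subst ln_le_cancel_iff) (use m in \<open>auto simp: add_pos_nonneg\<close>)
        also have "\<dots> = ln m + ln (1 + 1 / real N)"
        proof -
          have "0 < 1 + 1 / real N" by (simp add: add_pos_nonneg)
          then show ?thesis using m by (simp add: ln_mult)
        qed
        also have "\<dots> \<le> ln m + 1 / real N" by (intro add_left_mono ln_add_one_self_le_self) simp
        finally show ?thesis using False by simp
      qed
    qed
    moreover have "(\<Sum>j\<in>{..<N} - {i}. - ln (norm (X i - X j)) + (if norm (X i - X j) < \<delta> then 1 else 0) + 1 / real N)
      \<le> (\<Sum>j\<in>{..<N} - {i}. - ln (norm (X i - X j))) + k + 1"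
    proof -
      have "(\<Sum>j\<in>{..<N} - {i}. (if norm (X i - X j) < \<delta> then 1 else 0 :: real)) = k"
        by (simp add: k_def sum.inter_filter[symmetric])
      moreover have "(\<Sum>j\<in>{..<N} - {i}. 1 / real N) \<le> 1"
      proof -
        have "(\<Sum>j\<in>{..<N} - {i}. 1 / real N) \<le> (\<Sum>j\<in>{..<N}. 1 / real N)" by (rule sum_mono2) auto
        then show ?thesis using N by simp
      qed
      ultimately show ?thesis unfolding sum.distrib by linarith
    qed
    ultimately show ?thesis by linarith
  qed
  have qy: "real N * ((norm y)\<^sup>2 - 1) / 2 \<le> real N * ((norm (X i))\<^sup>2 - 1) / 2 + 1"
  proof -
    have NB: "1 \<le> real N powr B" using N B by (intro ge_one_powr_ge_zero) auto
    have nx: "norm (X i) \<le> real N powr B" by (rule good_norm_le[OF B N good i])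
    have NE: "real N * (real N powr B * \<eta>) = real N powr (-4)"
    proof -
      have "real N * (real N powr B * \<eta>) = real N powr 1 * real N powr B * real N powr (- (B + 5))" using N by (simp add: \<eta>_def)
      also have "\<dots> = real N powr (1 + B + - (B + 5))" by (simp only: powr_add)
      finally show ?thesis by simp
    qed
    have N4: "real N powr (-4) \<le> 1/2"
    proof -
      have "real N powr (-4) \<le> real N powr (-1)" using N by (intro powr_mono) auto
      also have "\<dots> = 1 / real N" using N by (simp add: powr_minus_divide)
      also have "\<dots> \<le> 1/2" using N by (simp add: field_simps)
      finally show ?thesis .
    qed
    have a: "real N * (norm (X i) * \<eta>) \<le> 1/2"
    proof -
      have "real N * (norm (X i) * \<eta>) \<le> real N * (real N powr B * \<eta>)" using nx \<eta> by (intro mult_left_mono mult_right_mono) auto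
      then show ?thesis using NE N4 by simp
    qed
    have b: "real N * \<eta>\<^sup>2 \<le> 1"
    proof -
      have "\<eta> \<le> real N powr B * \<eta>" using mult_right_mono[OF NB, of \<eta>] \<eta> by simp
      then have "real N * \<eta> \<le> real N * (real N powr B * \<eta>)" by (intro mult_left_mono) auto
      then have n\<eta>: "real N * \<eta> \<le> 1/2" using NE N4 by simp
      have "1 * \<eta> \<le> real N * \<eta>" using N \<eta> by (intro mult_right_mono) auto
      then have "\<eta> \<le> 1" using n\<eta> by simp
      then have "real N * \<eta> * \<eta> \<le> 1 * 1" using n\<eta> \<eta> by (intro mult_mono) auto
      then show ?thesis by (simp add: power2_eq_square mult.assoc)
    qed
    have "norm y \<le> norm (X i) + \<eta>" using norm_triangle_sub[of y "X i"] y by simp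
    then have "(norm y)\<^sup>2 \<le> (norm (X i) + \<eta>)\<^sup>2" by (intro power_mono) auto
    then have "real N * (norm y)\<^sup>2 \<le> real N * (norm (X i) + \<eta>)\<^sup>2" by (intro mult_left_mono) auto
    also have "\<dots> = real N * (norm (X i))\<^sup>2 + 2 * (real N * (norm (X i) * \<eta>)) + real N * \<eta>\<^sup>2"
      by (simp add: power2_eq_square algebra_simps)
    finally have c: "real N * (norm y)\<^sup>2 \<le> real N * (norm (X i))\<^sup>2 + 2 * (real N * (norm (X i) * \<eta>)) + real N * \<eta>\<^sup>2" .
    have e: "real N * (u - 1) / 2 = real N * u / 2 - real N / 2" for u
      by (simp add: right_diff_distrib diff_divide_distrib)
    show ?thesis unfolding e using a b c by linarith
  qed
  have "F z + real N * ((norm z)\<^sup>2 - 1) / 2 \<le> (B + 5) * l + reduced_potential N X i + k + 2"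
    using mx Fy qy by (simp add: reduced_potential_def)
  also have "\<dots> \<le> (B + 5) * l + (3 * B + 2) / \<beta> * l + K0 * l + 2 * l"
  proof -
    have "K0 * 1 \<le> K0 * l" using l \<beta> B by (intro mult_left_mono) (auto simp: K0_def)
    then show ?thesis using k l good_reduced_potential_le[OF \<beta> B N good i] unfolding l_def[symmetric] by linarith
  qed
  also have "\<dots> = ((3 * B + 2) / \<beta> + (B + 5) + K0 + 2) * l" by (simp add: algebra_simps)
  finally show ?thesis by (simp add: F_def \<eta>_def l_def K0_def potential_constant_def)
qed

text \<open>What is lost of the logarithmic singularity when it is cut off at distance \<open>\<eta>\<close>.\<close>
lemma integral_log_excess:
  assumes \<eta>: "0 < \<eta>"
  shows "set_integrable lborel (cball z \<eta>) (\<lambda>x. ln \<eta> - ln (norm (x - z)))"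
    and "(LINT x:cball z \<eta>|lborel. ln \<eta> - ln (norm (x - (z::real^2)))) = pi * \<eta>\<^sup>2 / 2"
proof -
  have c: "set_integrable lborel (cball z \<eta>) (\<lambda>_. ln \<eta>)"
    unfolding set_integrable_def by (intro borel_integrable_compact continuous_intros) auto
  note i = integrable_cball_ln[OF \<eta>, of z z]
  show "set_integrable lborel (cball z \<eta>) (\<lambda>x. ln \<eta> - ln (norm (x - z)))"
    by (rule set_integral_diff(1)[OF c i])
  have "(LINT x:cball z \<eta>|lborel. ln \<eta> - ln (norm (x - z))) = (LINT x:cball z \<eta>|lborel. ln \<eta>) - (LINT x:cball z \<eta>|lborel. ln (norm (x - z)))"
    by (rule set_integral_diff(2)[OF c i])
  also have "(LINT x:cball z \<eta>|lborel. ln \<eta>) = pi * \<eta>\<^sup>2 * ln \<eta>"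
    using \<eta> by (simp add: set_lebesgue_integral_def measure_cball2)
  also have "(LINT x:cball z \<eta>|lborel. ln (norm (x - z))) = pi * \<eta>\<^sup>2 * (ln \<eta> - 1/2)"
    using integral_cball_ln[OF \<eta>, of z z] \<eta> by simp
  finally show "(LINT x:cball z \<eta>|lborel. ln \<eta> - ln (norm (x - z))) = pi * \<eta>\<^sup>2 / 2"
    by (simp add: algebra_simps)
qed

text \<open>The potential is at most its smoothed version plus the truncated singularities, whose
  total integral is of order \<open>N * \<eta>\<^sup>2\<close> and so negligible; the negative part has been bounded
  already. The estimate is sharp enough for sets down to the area \<open>1 / N\<close> occupied by one
  particle.\<close>
lemma good_abs_potential_integral:
  assumes \<beta>: "0 < \<beta>" and B: "1 \<le> B" and N: "3 \<le> N" and good: "good_config \<beta> B N X"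
    and \<rho>: "1/2 \<le> \<rho>" "\<rho> < 1" and D: "D \<in> sets borel" "\<And>x. x \<in> D \<Longrightarrow> (norm x)\<^sup>2 \<le> \<rho>"
    and m: "measure lborel D \<le> M" and M: "1 / real N \<le> M"
  shows "(LINT x:D|lborel. \<bar>local_potential N X x\<bar>) \<le> (potential_constant \<beta> B + 2 + (B + 2) / \<beta>) * ln (real N) * M"
proof -
  let ?h = "local_potential N X"
  define l where "l = ln (real N)"
  have l: "1 \<le> l" using ln_ge_one[OF N] by (simp add: l_def)
  define c where "c = potential_constant \<beta> B"
  have c: "0 \<le> c" using \<beta> B by (simp add: c_def potential_constant_def)
  define \<eta> where "\<eta> = real N powr (- (B + 5))"
  have \<eta>: "0 < \<eta>" using N by (simp add: \<eta>_def)
  have D1: "D \<subseteq> cball 0 1"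
  proof
    fix x assume "x \<in> D"
    then have "(norm x)\<^sup>2 \<le> 1\<^sup>2" using D(2)[of x] \<rho> by simp
    then have "norm x \<le> 1" by (rule power2_le_imp_le) simp
    then show "x \<in> cball 0 1" by simp
  qed
  have fin: "emeasure lborel D < \<infinity>"
    using emeasure_mono[OF D1, of lborel] emeasure_bounded_finite[OF bounded_cball[of "0::real^2" 1]] by (auto intro: le_less_trans)
  have M0: "0 \<le> M" using m measure_nonneg[of lborel D] by linarith
  define s where "s j x = indicator (cball (X j) \<eta>) x *\<^sub>R (ln \<eta> - ln (norm (x - X j)))" for j x
  have iS0: "integrable lborel (s j)" and es: "(LINT x|lborel. s j x) = pi * \<eta>\<^sup>2 / 2" for j
    using integral_log_excess[OF \<eta>, of "X j"] unfolding s_def[abs_def] by (auto simp: set_integrable_def set_lebesgue_integral_def)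
  have s0: "0 \<le> s j x" if "x \<noteq> X j" for j x
  proof (cases "x \<in> cball (X j) \<eta>")
    case True
    then have "ln (norm (x - X j)) \<le> ln \<eta>"
      using that \<eta> by (subst ln_le_cancel_iff) (auto simp: dist_norm norm_minus_commute)
    then show ?thesis by (simp add: s_def split: split_indicator)
  qed (simp add: s_def)
  have split_ln: "- ln (norm (x - X j)) = - ln (max (norm (x - X j)) \<eta>) + s j x" for j x
    using \<eta> by (cases "x \<in> cball (X j) \<eta>") (auto simp: s_def dist_norm norm_minus_commute max_def)
  \<comment> \<open>makes \<open>exp (- t) * N powr B\<close> equal to \<open>1 / N\<close>, the smallest area considered\<close>
  define t where "t = (B + 1) * l"
  have t: "0 \<le> t" using B l by (simp add: t_def)
  note np = good_negative_part[OF \<beta> good t zero_less_one D(1) D1]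
  have et: "exp (- t) * real N powr B = 1 / real N"
  proof -
    have "exp (- t) = real N powr (- (B + 1))" using N by (simp add: t_def l_def powr_def algebra_simps)
    then have "exp (- t) * real N powr B = real N powr (- (B + 1) + B)" by (simp only: powr_add)
    then show ?thesis using N by (simp add: powr_minus_divide)
  qed
  have iD: "integrable lborel (\<lambda>x. indicator D x * (c * l))"
    using D fin by (intro integrable_mult_left integrable_real_indicator) auto
  have iS: "integrable lborel (\<lambda>x. \<Sum>j<N. s j x)"
    by (intro Bochner_Integration.integrable_sum iS0)
  have im: "integrable lborel (\<lambda>x. indicator D x *\<^sub>R max (- ?h x) 0)"
    using np(2) by (simp add: set_integrable_def)
  have "(LINT x|lborel. indicator D x *\<^sub>R \<bar>?h x\<bar>)
     \<le> (LINT x|lborel. indicator D x * (c * l) + (\<Sum>j<N. s j x) + indicator D x *\<^sub>R max (- ?h x) 0)"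
  proof (rule integral_mono_AE)
    have "integrable lborel (\<lambda>x. \<bar>indicator D x *\<^sub>R ?h x\<bar>)"
      using local_potential_integrable[OF zero_less_one D(1) D1] by (intro integrable_abs) (simp add: set_integrable_def)
    then show "integrable lborel (\<lambda>x. indicator D x *\<^sub>R \<bar>?h x\<bar>)" by (simp add: abs_mult)
    show "integrable lborel (\<lambda>x. indicator D x * (c * l) + (\<Sum>j<N. s j x) + indicator D x *\<^sub>R max (- ?h x) 0)"
      by (intro Bochner_Integration.integrable_add iD iS im)
    have "AE x in lborel. \<forall>j\<in>{..<N}. x \<noteq> X j"
      by (rule AE_finite_allI) (auto intro: AE_lborel_singleton)
    then show "AE x in lborel. indicator D x *\<^sub>R \<bar>?h x\<bar> \<le> indicator D x * (c * l) + (\<Sum>j<N. s j x) + indicator D x *\<^sub>R max (- ?h x) 0"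
    proof eventually_elim
      case (elim x)
      have S: "0 \<le> (\<Sum>j<N. s j x)" using elim s0 by (intro sum_nonneg) auto
      show ?case
      proof (cases "x \<in> D")
        case True
        have "?h x = ((\<Sum>j<N. - ln (max (norm (x - X j)) \<eta>)) + real N * ((norm x)\<^sup>2 - 1) / 2) + (\<Sum>j<N. s j x)"
          unfolding local_potential_def split_ln sum.distrib by simp
        also have "\<dots> \<le> c * l + (\<Sum>j<N. s j x)"
          using good_smoothed_potential_le[OF \<beta> B N good \<rho> D(2)[OF True]]
          unfolding c_def l_def \<eta>_def by (intro add_right_mono)
        finally have up: "?h x \<le> c * l + (\<Sum>j<N. s j x)" .
        have "0 \<le> c * l" using c l by simp
        then have "\<bar>?h x\<bar> \<le> c * l + (\<Sum>j<N. s j x) + max (- ?h x) 0"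
          using up S by (cases "0 \<le> ?h x") auto
        then show ?thesis using True by simp
      next
        case False
        then show ?thesis using S by simp
      qed
    qed
  qed
  also have "\<dots> = measure lborel D * (c * l) + real N * (pi * \<eta>\<^sup>2 / 2) + (LINT x:D|lborel. max (- ?h x) 0)"
  proof -
    have "(LINT x|lborel. indicator D x * (c * l) + (\<Sum>j<N. s j x) + indicator D x *\<^sub>R max (- ?h x) 0)
      = (LINT x|lborel. indicator D x * (c * l)) + (LINT x|lborel. (\<Sum>j<N. s j x)) + (LINT x|lborel. indicator D x *\<^sub>R max (- ?h x) 0)"
      by (subst Bochner_Integration.integral_add[OF Bochner_Integration.integrable_add[OF iD iS] im])
         (subst Bochner_Integration.integral_add[OF iD iS], rule refl)
    moreover have "(LINT x|lborel. (\<Sum>j<N. s j x)) = real N * (pi * \<eta>\<^sup>2 / 2)"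
      by (subst Bochner_Integration.integral_sum[OF iS0]) (simp add: es)
    moreover have "(LINT x|lborel. indicator D x * (c * l)) = measure lborel D * (c * l)"
      using D fin by simp
    ultimately show ?thesis by (simp add: set_lebesgue_integral_def)
  qed
  also have "\<dots> \<le> M * (c * l) + 2 * M + ((B + 2) / \<beta> * l) * M"
  proof (intro add_mono)
    show "measure lborel D * (c * l) \<le> M * (c * l)" using m c l by (intro mult_right_mono) auto
    have "\<eta> \<le> real N powr (-1)" unfolding \<eta>_def using N B by (intro powr_mono) auto
    then have "\<eta> \<le> 1 / real N" using N by (simp add: powr_minus_divide)
    then have "real N * \<eta>\<^sup>2 \<le> real N * (1 / real N)\<^sup>2" using \<eta> by (intro mult_left_mono power_mono) auto
    also have "\<dots> = 1 / real N" using N by (simp add: power2_eq_square)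
    finally have "real N * \<eta>\<^sup>2 \<le> M" using M by simp
    moreover have "real N * (pi * \<eta>\<^sup>2 / 2) = (pi / 2) * (real N * \<eta>\<^sup>2)" by simp
    moreover have "(pi / 2) * (real N * \<eta>\<^sup>2) \<le> 2 * (real N * \<eta>\<^sup>2)" using pi_less_4 by (intro mult_right_mono) auto
    ultimately show "real N * (pi * \<eta>\<^sup>2 / 2) \<le> 2 * M" by linarith
    have "\<beta> * (LINT x:D|lborel. max (- ?h x) 0) \<le> t * measure lborel D + 1 / real N"
      using np(1) by (simp only: et)
    also have "\<dots> \<le> t * M + M" using m M t by (intro add_mono mult_left_mono) auto
    also have "\<dots> \<le> (B + 2) * l * M"
    proof -
      have "1 * M \<le> l * M" using l M0 by (intro mult_right_mono) auto
      then show ?thesis by (simp add: t_def algebra_simps)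
    qed
    finally show "(LINT x:D|lborel. max (- ?h x) 0) \<le> ((B + 2) / \<beta> * l) * M"
      using \<beta> by (simp add: field_simps)
  qed
  also have "\<dots> \<le> (c + 2 + (B + 2) / \<beta>) * l * M"
  proof -
    have "2 * (1 * M) \<le> 2 * (l * M)" using l M0 by (intro mult_left_mono mult_right_mono) auto
    then show ?thesis by (simp add: algebra_simps)
  qed
  finally show ?thesis by (simp add: set_lebesgue_integral_def c_def l_def)
qed

lemma test_function_lapl_bound:
  assumes f: "deriv2_norm f \<le> ereal b"
  shows "\<bar>lapl f x\<bar> \<le> 2 * b"
proof -
  have "\<bar>partial_deriv j (partial_deriv i f) x\<bar> \<le> b" for i j
  proof -
    have "ereal \<bar>partial_deriv j (partial_deriv i f) x\<bar> \<le> deriv2_norm f"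
      unfolding deriv2_norm_def
      by (rule SUP_upper2[of i], simp, rule SUP_upper2[of j], simp, rule SUP_upper) simp
    also have "\<dots> \<le> ereal b" by (rule f)
    finally show ?thesis by simp
  qed
  from this[of 1 1] this[of 2 2] show ?thesis unfolding lapl_def by linarith
qed

text \<open>Green's formula for each logarithm gives the sum over the particles, and the Laplacian
  \<open>2 * N\<close> of the quadratic term gives the uniform background, since \<open>f\<close> vanishes outside the
  disc.\<close>
lemma fluct_eq_integral_lapl_potential:
  assumes f: "class_C2 f" and r: "r < 1" and z: "\<And>y. r < norm y \<Longrightarrow> f y = 0"
  shows "integrable lborel (\<lambda>x. lapl f x * local_potential N X x)"
    and "(LINT x|lborel. lapl f x * local_potential N X x) = - 2 * pi * fluct N f X"
proof -
  have cf: "continuous_on UNIV f" by (rule class_C2_continuous[OF f])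
  have cl: "continuous_on UNIV (lapl f)" by (rule lapl_continuous[OF f])
  have o: "open {y::real^2. r < norm y}" by (intro open_Collect_less continuous_intros)
  have lz: "lapl f y = 0" if "r < norm y" for y
    by (rule lapl_vanishes[OF o]) (use that z in auto)
  have i1: "integrable lborel (\<lambda>x. lapl f x * ln (norm (x - X j)))" for j
    by (rule integrable_lapl_ln[OF f z])
  have i2: "integrable lborel (\<lambda>x. lapl f x * (norm x)\<^sup>2)"
    by (rule integrable_compact_support[where r=r]) (use lz in \<open>auto intro!: continuous_intros cl\<close>)
  have i3: "integrable lborel (lapl f)"
    by (rule integrable_compact_support[where r=r]) (use lz in \<open>auto intro!: cl\<close>)
  have e: "lapl f x * local_potential N X x
    = (\<Sum>j<N. (-1) * (lapl f x * ln (norm (x - X j)))) + (real N / 2) * (lapl f x * (norm x)\<^sup>2) + (- (real N / 2)) * lapl f x" for x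
    unfolding local_potential_def
    by (simp add: distrib_left sum_distrib_left right_diff_distrib diff_divide_distrib mult_ac)
  have iS: "integrable lborel (\<lambda>x. \<Sum>j<N. (-1) * (lapl f x * ln (norm (x - X j))))"
    by (intro Bochner_Integration.integrable_sum integrable_mult_right i1)
  show "integrable lborel (\<lambda>x. lapl f x * local_potential N X x)"
    unfolding e by (intro Bochner_Integration.integrable_add iS integrable_mult_right i2 i3)
  have "(LINT x|lborel. lapl f x * local_potential N X x)
    = (LINT x|lborel. (\<Sum>j<N. (-1) * (lapl f x * ln (norm (x - X j))))) + (real N / 2) * (LINT x|lborel. lapl f x * (norm x)\<^sup>2) + (- (real N / 2)) * (LINT x|lborel. lapl f x)"
    unfolding e
    by (subst Bochner_Integration.integral_add[OF Bochner_Integration.integrable_add[OF iS integrable_mult_right[OF i2]] integrable_mult_right[OF i3]],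
        subst Bochner_Integration.integral_add[OF iS integrable_mult_right[OF i2]]) (simp only: integral_mult_right_zero)
  also have "(LINT x|lborel. (\<Sum>j<N. (-1) * (lapl f x * ln (norm (x - X j))))) = (\<Sum>j<N. (-1) * (LINT x|lborel. lapl f x * ln (norm (x - X j))))"
    by (subst Bochner_Integration.integral_sum[OF integrable_mult_right[OF i1]]) (simp only: integral_mult_right_zero)
  also have "\<dots> = - 2 * pi * (\<Sum>j<N. f (X j))"
    by (simp add: green_representation[OF f z] sum_distrib_left sum_negf)
  also have "(LINT x|lborel. lapl f x * (norm x)\<^sup>2) = 4 * (LINT x|lborel. f x)"
    by (rule integral_lapl_norm_sq[OF f z])
  also have "(LINT x|lborel. lapl f x) = 0" by (rule integral_lapl[OF f z])
  finally have 1: "(LINT x|lborel. lapl f x * local_potential N X x) = - 2 * pi * (\<Sum>j<N. f (X j)) + 2 * real N * (LINT x|lborel. f x)"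
    by simp
  have "(LINT x:cball 0 1|m0. f x) = (LINT x|lborel. f x) / pi"
  proof -
    have e1: "indicator (cball 0 1) x *\<^sub>R f x = f x" for x
      using z[of x] r by (cases "norm x \<le> 1") (auto simp: not_le)
    have fm: "f \<in> borel_measurable borel" using cf by (rule borel_measurable_continuous_onI)
    have "(LINT x:cball 0 1|m0. f x) = (LINT x|m0. f x)"
      unfolding set_lebesgue_integral_def e1 ..
    also have "\<dots> = (LINT x:cball 0 1|lborel. f x) / pi" by (rule integral_m0[OF fm])
    also have "(LINT x:cball 0 1|lborel. f x) = (LINT x|lborel. f x)"
      unfolding set_lebesgue_integral_def e1 ..
    finally show ?thesis .
  qed
  then show "(LINT x|lborel. lapl f x * local_potential N X x) = - 2 * pi * fluct N f X"
    unfolding 1 fluct_def by (simp add: algebra_simps)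
qed

definition fluct_constant :: "real \<Rightarrow> real \<Rightarrow> real" where
  "fluct_constant \<beta> B = potential_constant \<beta> B + 2 + (B + 2) / \<beta>"

text \<open>The Laplacian of a test function supported in a disc of radius \<open>l\<close> is at most
  \<open>2 / l\<^sup>2\<close>, which compensates the area of the disc. The bound depends on \<open>f\<close> only through
  its support and its second derivatives, and therefore holds for all test functions on the
  same configurations.\<close>
lemma good_fluctuation_bound:
  assumes \<beta>: "0 < \<beta>" and B: "1 \<le> B" and N: "3 \<le> N" and good: "good_config \<beta> B N X"
    and r: "0 < r" "r < 1" and f: "f \<in> test_functions 1 r N"
  shows "\<bar>fluct N f X\<bar> \<le> fluct_constant \<beta> B * ln (real N)"
proof -
  let ?h = "local_potential N X"
  define K where "K = fluct_constant \<beta> B * ln (real N)"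
  obtain z l where C2: "class_C2 f" and sr: "supported_in f (cball 0 r)" and lN: "real N powr (-1/2) \<le> l"
    and sl: "supported_in f (cball z l)" and d2: "deriv2_norm f \<le> ereal (1 / l\<^sup>2)"
    using f by (auto simp: test_functions_def)
  have "0 < real N powr (-1/2)" using N by simp
  then have l: "0 < l" using lN by linarith
  have lsq: "1 / real N \<le> l\<^sup>2"
  proof -
    have "(real N powr (-1/2))\<^sup>2 = real N powr (-1/2 + -1/2)" by (simp only: power2_eq_square powr_add)
    also have "\<dots> = 1 / real N" using N by (simp add: powr_minus_divide)
    finally show ?thesis using power_mono[OF lN, of 2] by simp
  qed
  define D where "D = cball 0 r \<inter> cball z l"
  define S where "S = closure {x. f x \<noteq> 0}"
  have SD: "S \<subseteq> D" using sr sl by (auto simp: S_def D_def supported_in_def)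
  have fz: "f y = 0" if "y \<notin> S" for y using that closure_subset[of "{x. f x \<noteq> 0}"] by (auto simp: S_def)
  have z: "f y = 0" if "r < norm y" for y
    using that SD by (intro fz) (auto simp: D_def)
  have lz: "lapl f y = 0" if "y \<notin> D" for y
  proof (rule lapl_vanishes)
    show "open (- S)" unfolding S_def by (intro open_Compl closed_closure)
    show "y \<in> - S" using that SD by auto
    show "f y = 0" if "y \<in> - S" for y using fz that by auto
  qed
  have Db: "D \<in> sets borel" by (simp add: D_def)
  \<comment> \<open>the barrier of the maximum principle is available for \<open>\<rho> \<ge> 1/2\<close>\<close>
  define \<rho> where "\<rho> = max (r\<^sup>2) (1/2)"
  have r2: "r\<^sup>2 < 1" using r by (simp add: power_less_one_iff)
  have \<rho>: "1/2 \<le> \<rho>" "\<rho> < 1" using r2 by (auto simp: \<rho>_def)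
  have D\<rho>: "(norm x)\<^sup>2 \<le> \<rho>" if "x \<in> D" for x
  proof -
    have "(norm x)\<^sup>2 \<le> r\<^sup>2" using that by (intro power_mono) (auto simp: D_def)
    then show ?thesis by (simp add: \<rho>_def)
  qed
  have m: "measure lborel D \<le> pi * l\<^sup>2"
  proof -
    have "measure lborel D \<le> measure lborel (cball z l)"
    proof (rule measure_mono_fmeasurable)
      show "cball z l \<in> fmeasurable lborel" using emeasure_bounded_finite[OF bounded_cball[of z l]] by (simp add: fmeasurable_def)
    qed (use Db in \<open>auto simp: D_def\<close>)
    then show ?thesis using l by (simp add: measure_cball2)
  qed
  have M: "1 / real N \<le> pi * l\<^sup>2"
  proof -
    have "1 * l\<^sup>2 \<le> pi * l\<^sup>2" using pi_gt3 by (intro mult_right_mono) auto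
    then show ?thesis using lsq by simp
  qed
  have abs_int: "(LINT x:D|lborel. \<bar>?h x\<bar>) \<le> K * (pi * l\<^sup>2)"
    using good_abs_potential_integral[OF \<beta> B N good \<rho> Db D\<rho> m M] by (simp add: K_def fluct_constant_def)
  note Lh = fluct_eq_integral_lapl_potential[OF C2 r(2) z, where N=N and X=X]
  have ih: "integrable lborel (\<lambda>x. 2 * (1 / l\<^sup>2) * (indicator D x *\<^sub>R \<bar>?h x\<bar>))"
  proof (rule integrable_mult_right)
    have "set_integrable lborel D ?h"
      by (rule local_potential_integrable[OF l Db]) (auto simp: D_def)
    then show "integrable lborel (\<lambda>x. indicator D x *\<^sub>R \<bar>?h x\<bar>)"
      using set_integrable_abs by (simp add: set_integrable_def)
  qed
  have "\<bar>LINT x|lborel. lapl f x * ?h x\<bar> \<le> (LINT x|lborel. \<bar>lapl f x * ?h x\<bar>)"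
    by (rule integral_abs_bound)
  also have "\<dots> \<le> (LINT x|lborel. 2 * (1 / l\<^sup>2) * (indicator D x *\<^sub>R \<bar>?h x\<bar>))"
  proof (rule integral_mono[OF integrable_abs[OF Lh(1)] ih])
    fix x
    show "\<bar>lapl f x * ?h x\<bar> \<le> 2 * (1 / l\<^sup>2) * (indicator D x *\<^sub>R \<bar>?h x\<bar>)"
    proof (cases "x \<in> D")
      case True
      then show ?thesis
        using mult_right_mono[OF test_function_lapl_bound[OF d2, of x], of "\<bar>?h x\<bar>"] by (simp add: abs_mult)
    qed (simp add: lz)
  qed
  also have "\<dots> = 2 * (1 / l\<^sup>2) * (LINT x:D|lborel. \<bar>?h x\<bar>)"
    unfolding set_lebesgue_integral_def by (rule integral_mult_right_zero)
  also have "\<dots> \<le> 2 * (1 / l\<^sup>2) * (K * (pi * l\<^sup>2))"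
    using abs_int by (intro mult_left_mono) auto
  also have "\<dots> = 2 * pi * K" using l by simp
  finally have "\<bar>- 2 * pi * fluct N f X\<bar> \<le> 2 * pi * K"
    using Lh(2) by simp
  then have "2 * pi * \<bar>fluct N f X\<bar> \<le> 2 * pi * K"
    by (simp add: abs_mult)
  then show ?thesis by (simp add: K_def)
qed

section \<open>Concentration\<close>

lemma local_potential_added_energy:
  "local_potential N X x = added_energy (real N) {..<N} X x - real N / 2"
  by (simp add: local_potential_def added_energy_def right_diff_distrib diff_divide_distrib)

lemma reduced_potential_added_energy:
  "reduced_potential N X i = added_energy (real N) ({..<N} - {i}) X (X i) - real N / 2"
  by (simp add: reduced_potential_def added_energy_def right_diff_distrib diff_divide_distrib)

lemma nn_integral_weight: "(\<integral>\<^sup>+x. ennreal (1 / (1 + (norm (x::real^2))\<^sup>2)\<^sup>2) \<partial>lborel) = ennreal pi"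
proof -
  have "integrable lborel (\<lambda>x::real^2. 2 / (1 + (norm x)\<^sup>2)\<^sup>2 / 2)" "(LINT x|lborel. 2 / (1 + (norm (x::real^2))\<^sup>2)\<^sup>2 / 2) = pi"
    using integrable_cauchy_kernel integral_cauchy_kernel by (simp_all only: Bochner_Integration.integrable_divide integral_divide_zero)
  then show ?thesis
    using nn_integral_eq_integral[of lborel "\<lambda>x::real^2. 1 / (1 + (norm x)\<^sup>2)\<^sup>2"] by simp
qed

text \<open>The three quantities bounded in \<open>good_config\<close> are added, so that one application of
  Markov's inequality controls all of them.\<close>
definition badness :: "real \<Rightarrow> nat \<Rightarrow> (nat \<Rightarrow> real^2) \<Rightarrow> ennreal" where
  "badness \<beta> N X = (\<integral>\<^sup>+x. ennreal (exp (- \<beta> * local_potential N X x)) \<partial>lborel)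
     + (\<Sum>i<N. ennreal (exp (\<beta> * reduced_potential N X i) / (1 + (norm (X i))\<^sup>2)\<^sup>2))
     + ennreal (second_moment N X)"

lemma good_config_if_badness:
  assumes "inj_on X {..<N}" "badness \<beta> N X \<le> ennreal (real N powr B)"
  shows "good_config \<beta> B N X"
  unfolding good_config_def
proof (intro conjI allI impI)
  have le: "a \<le> a + b + c" "b \<le> a + b + c" "c \<le> a + b + c" for a b c :: ennreal
    by (simp_all add: add_increasing add_increasing2 add.assoc)
  note parts = le[THEN order_trans, OF assms(2)[unfolded badness_def]]
  show "inj_on X {..<N}" by fact
  show "(\<integral>\<^sup>+x. ennreal (exp (- \<beta> * local_potential N X x)) \<partial>lborel) \<le> ennreal (real N powr B)"
    by (rule parts(1))
  show "second_moment N X \<le> real N powr B"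
    using parts(3) by (subst (asm) ennreal_le_iff) auto
  fix i assume i: "i < N"
  have "ennreal (exp (\<beta> * reduced_potential N X i) / (1 + (norm (X i))\<^sup>2)\<^sup>2)
    \<le> (\<Sum>i<N. ennreal (exp (\<beta> * reduced_potential N X i) / (1 + (norm (X i))\<^sup>2)\<^sup>2))"
    using i by (intro member_le_sum) auto
  also have "\<dots> \<le> ennreal (real N powr B)" by (rule parts(2))
  finally show "exp (\<beta> * reduced_potential N X i) / (1 + (norm (X i))\<^sup>2)\<^sup>2 \<le> real N powr B"
    by (subst (asm) ennreal_le_iff) auto
qed

lemma
  assumes \<beta>: "0 < \<beta>"
  shows nn_integral_local_potential: "(\<integral>\<^sup>+X. (\<integral>\<^sup>+x. ennreal (exp (- \<beta> * local_potential N X x)) \<partial>lborel) \<partial>gibbs \<beta> N) * partition_fun \<beta> N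
      = gas_partition \<beta> (real N) {..<Suc N} * ennreal (exp (\<beta> * real N / 2))"
    and measurable_local_potential_integral: "(\<lambda>X. \<integral>\<^sup>+x. ennreal (exp (- \<beta> * local_potential N X x)) \<partial>lborel) \<in> borel_measurable (configs {..<N})"
proof -
  have e: "(\<integral>\<^sup>+x. ennreal (exp (- \<beta> * local_potential N X x)) \<partial>lborel)
    = ennreal (exp (\<beta> * real N / 2)) * (\<integral>\<^sup>+x. ennreal (exp (- \<beta> * added_energy (real N) {..<N} X x)) \<partial>lborel)" for X
  proof -
    have "ennreal (exp (- \<beta> * local_potential N X x)) = ennreal (exp (\<beta> * real N / 2)) * ennreal (exp (- \<beta> * added_energy (real N) {..<N} X x))" for x
      unfolding local_potential_added_energy by (simp add: ennreal_mult[symmetric] mult_exp_exp right_diff_distrib)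
    then show ?thesis by (simp add: nn_integral_cmult)
  qed
  note m = nn_integral_added_energy_measurable[of \<beta> "real N" N]
  show "(\<lambda>X. \<integral>\<^sup>+x. ennreal (exp (- \<beta> * local_potential N X x)) \<partial>lborel) \<in> borel_measurable (configs {..<N})"
    unfolding e using m by measurable
  have "(\<integral>\<^sup>+X. (\<integral>\<^sup>+x. ennreal (exp (- \<beta> * local_potential N X x)) \<partial>lborel) \<partial>gibbs \<beta> N)
    = ennreal (exp (\<beta> * real N / 2)) * (\<integral>\<^sup>+X. (\<integral>\<^sup>+x. ennreal (exp (- \<beta> * added_energy (real N) {..<N} X x)) \<partial>lborel) \<partial>gibbs \<beta> N)"
    unfolding e using m by (intro nn_integral_cmult) simp
  then show "(\<integral>\<^sup>+X. (\<integral>\<^sup>+x. ennreal (exp (- \<beta> * local_potential N X x)) \<partial>lborel) \<partial>gibbs \<beta> N) * partition_fun \<beta> N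
      = gas_partition \<beta> (real N) {..<Suc N} * ennreal (exp (\<beta> * real N / 2))"
    unfolding gibbs_insert_particle[OF \<beta>, symmetric] by (simp add: mult_ac)
qed

lemma
  assumes \<beta>: "0 < \<beta>" and i: "i < N"
  shows nn_integral_reduced_potential: "(\<integral>\<^sup>+X. ennreal (exp (\<beta> * reduced_potential N X i) / (1 + (norm (X i))\<^sup>2)\<^sup>2) \<partial>gibbs \<beta> N) * partition_fun \<beta> N
      = ennreal pi * (gas_partition \<beta> (real N) {..<N - 1} * ennreal (exp (- \<beta> * real N / 2)))"
    and measurable_reduced_potential: "(\<lambda>X. ennreal (exp (\<beta> * reduced_potential N X i) / (1 + (norm (X i))\<^sup>2)\<^sup>2)) \<in> borel_measurable (configs {..<N})"
proof -
  define I where "I = {..<N} - {i}"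
  have I: "finite I" "insert i I = {..<N}" using i by (auto simp: I_def)
  have [measurable]: "(\<lambda>X. X i) \<in> borel_measurable (configs {..<N})" using i by (intro component_measurable) simp
  note [measurable] = added_energy_pair_measurable[OF I(1), of "real N" i, unfolded I(2)]
  have e: "ennreal (exp (\<beta> * reduced_potential N X i) / (1 + (norm (X i))\<^sup>2)\<^sup>2)
    = ennreal (exp (- \<beta> * real N / 2)) * (ennreal (exp (\<beta> * added_energy (real N) I X (X i))) * ennreal (1 / (1 + (norm (X i))\<^sup>2)\<^sup>2))" for X
  proof -
    have "exp (\<beta> * reduced_potential N X i) = exp (- \<beta> * real N / 2) * exp (\<beta> * added_energy (real N) I X (X i))"
      unfolding reduced_potential_added_energy I_def by (simp add: mult_exp_exp right_diff_distrib)
    then show ?thesis by (simp add: ennreal_mult[symmetric])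
  qed
  show "(\<lambda>X. ennreal (exp (\<beta> * reduced_potential N X i) / (1 + (norm (X i))\<^sup>2)\<^sup>2)) \<in> borel_measurable (configs {..<N})"
    unfolding e by measurable
  have "(\<integral>\<^sup>+X. ennreal (exp (\<beta> * reduced_potential N X i) / (1 + (norm (X i))\<^sup>2)\<^sup>2) \<partial>gibbs \<beta> N)
    = ennreal (exp (- \<beta> * real N / 2)) * (\<integral>\<^sup>+X. ennreal (exp (\<beta> * added_energy (real N) I X (X i))) * ennreal (1 / (1 + (norm (X i))\<^sup>2)\<^sup>2) \<partial>gibbs \<beta> N)"
    unfolding e by (rule nn_integral_cmult) measurable
  moreover have "(\<integral>\<^sup>+X. ennreal (exp (\<beta> * added_energy (real N) I X (X i))) * ennreal (1 / (1 + (norm (X i))\<^sup>2)\<^sup>2) \<partial>gibbs \<beta> N) * partition_fun \<beta> N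
    = ennreal pi * gas_partition \<beta> (real N) {..<N - 1}"
    unfolding nn_integral_weight[symmetric] I_def
    by (rule gibbs_remove_particle[OF \<beta> i, of "\<lambda>x. ennreal (1 / (1 + (norm x)\<^sup>2)\<^sup>2)"]) measurable
  ultimately show "(\<integral>\<^sup>+X. ennreal (exp (\<beta> * reduced_potential N X i) / (1 + (norm (X i))\<^sup>2)\<^sup>2) \<partial>gibbs \<beta> N) * partition_fun \<beta> N
      = ennreal pi * (gas_partition \<beta> (real N) {..<N - 1} * ennreal (exp (- \<beta> * real N / 2)))"
    by (simp only: mult.assoc) (simp only: mult_ac)
qed

lemma badness_measurable:
  assumes "0 < \<beta>"
  shows "badness \<beta> N \<in> borel_measurable (configs {..<N})"
proof -
  have "(\<lambda>X. \<Sum>i<N. ennreal (exp (\<beta> * reduced_potential N X i) / (1 + (norm (X i))\<^sup>2)\<^sup>2)) \<in> borel_measurable (configs {..<N})"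
    by (intro borel_measurable_sum measurable_reduced_potential[OF assms]) auto
  then show ?thesis
    unfolding badness_def[abs_def] using measurable_local_potential_integral[OF assms, of N] by measurable
qed

text \<open>The first two expectations are ratios of partition functions for \<open>N + 1\<close> and \<open>N\<close>, and
  for \<open>N - 1\<close> and \<open>N\<close> particles; the factors \<open>exp (\<beta> * N / 2)\<close> and \<open>exp (- \<beta> * N / 2)\<close> that
  come from the normalisation of the potentials cancel the leading order of these ratios.\<close>
lemma nn_integral_badness:
  assumes \<beta>: "0 < \<beta>"
  obtains A where "1 \<le> A" "\<And>N. 3 \<le> N \<Longrightarrow> (\<integral>\<^sup>+X. badness \<beta> N X \<partial>gibbs \<beta> N) \<le> ennreal (real N powr A)"
proof -
  obtain A1 where A1: "0 \<le> A1" "\<And>N. 2 \<le> N \<Longrightarrow>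
    gas_partition \<beta> (real N) {..<Suc N} * ennreal (exp (\<beta> * real N / 2)) \<le> ennreal (real N powr A1) * partition_fun \<beta> N"
    using insertion_ratio[OF \<beta>] by blast
  obtain A2 where A2: "0 \<le> A2" "\<And>N. 2 \<le> N \<Longrightarrow>
    gas_partition \<beta> (real N) {..<N - 1} * ennreal (exp (- \<beta> * real N / 2)) \<le> ennreal (real N powr A2) * partition_fun \<beta> N"
    using removal_ratio[OF \<beta>] by blast
  define c where "c = 2 / \<beta> + 1/2"
  have c: "0 \<le> c" using \<beta> by (simp add: c_def)
  define A0 where "A0 = A1 + A2 + 3 + c"
  have bound: "(\<integral>\<^sup>+X. badness \<beta> N X \<partial>gibbs \<beta> N) \<le> ennreal (real N powr (A0 + 1))" if N: "3 \<le> N" for N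
  proof -
    let ?Z = "partition_fun \<beta> N"
    interpret prob_space "gibbs \<beta> N" by (rule prob_space_gibbs[OF \<beta>])
    have Z: "?Z \<noteq> 0" "?Z < top" using partition_fun_pos partition_fun_finite[OF \<beta>] by auto
    have cancel: "E \<le> F" if "E * ?Z \<le> F * ?Z" for E F :: ennreal
    proof -
      have "E * ?Z / ?Z \<le> F * ?Z / ?Z" using that by (rule divide_right_mono_ennreal)
      moreover have "G * ?Z / ?Z = G" for G :: ennreal
        using ennreal_times_divide[of G ?Z ?Z] ennreal_divide_self[OF Z] by simp
      ultimately show ?thesis by simp
    qed
    define E1 where "E1 = (\<integral>\<^sup>+X. (\<integral>\<^sup>+x. ennreal (exp (- \<beta> * local_potential N X x)) \<partial>lborel) \<partial>gibbs \<beta> N)"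
    define E2 where "E2 i = (\<integral>\<^sup>+X. ennreal (exp (\<beta> * reduced_potential N X i) / (1 + (norm (X i))\<^sup>2)\<^sup>2) \<partial>gibbs \<beta> N)" for i
    define E3 where "E3 = (\<integral>\<^sup>+X. ennreal (second_moment N X) \<partial>gibbs \<beta> N)"
    have N1: "1 \<le> real N" using N by simp
    have e1: "E1 \<le> ennreal (real N powr A0)"
    proof -
      have "E1 * ?Z \<le> ennreal (real N powr A1) * ?Z"
        unfolding E1_def nn_integral_local_potential[OF \<beta>] using A1(2)[of N] N by simp
      then have "E1 \<le> ennreal (real N powr A1)" by (rule cancel)
      also have "\<dots> \<le> ennreal (real N powr A0)"
        using A1 A2 c N1 by (intro ennreal_leI powr_mono) (auto simp: A0_def)
      finally show ?thesis .
    qed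
    have e2: "(\<Sum>i<N. E2 i) \<le> ennreal (real N powr A0)"
    proof -
      have "E2 i \<le> ennreal (pi * real N powr A2)" if i: "i < N" for i
      proof (rule cancel)
        have "E2 i * ?Z = ennreal pi * (gas_partition \<beta> (real N) {..<N - 1} * ennreal (exp (- \<beta> * real N / 2)))"
          unfolding E2_def by (rule nn_integral_reduced_potential[OF \<beta> i])
        also have "\<dots> \<le> ennreal pi * (ennreal (real N powr A2) * ?Z)"
          using A2(2)[of N] N by (intro mult_left_mono) auto
        finally show "E2 i * ?Z \<le> ennreal (pi * real N powr A2) * ?Z" by (simp add: ennreal_mult mult.assoc)
      qed
      then have "(\<Sum>i<N. E2 i) \<le> (\<Sum>i<N. ennreal (pi * real N powr A2))" by (intro sum_mono) auto
      also have "\<dots> = ennreal (real N * (pi * real N powr A2))"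
        by (simp add: ennreal_of_nat_eq_real_of_nat ennreal_mult)
      also have "\<dots> \<le> ennreal (real N powr A0)"
      proof (rule ennreal_leI)
        have "pi \<le> real N * real N" using mult_mono[of 3 "real N" 3 "real N"] N pi_less_4 by simp
        then have "real N * (pi * real N powr A2) \<le> real N * ((real N * real N) * real N powr A2)"
          by (intro mult_left_mono mult_right_mono) auto
        also have "\<dots> = real N powr 1 * (real N powr 1 * real N powr 1 * real N powr A2)" using N by simp
        also have "\<dots> = real N powr (1 + (1 + 1 + A2))" by (simp only: powr_add)
        also have "\<dots> \<le> real N powr A0" using A1 c N1 by (intro powr_mono) (auto simp: A0_def)
        finally show "real N * (pi * real N powr A2) \<le> real N powr A0" .
      qed
      finally show ?thesis .
    qed
    have e3: "E3 \<le> ennreal (real N powr A0)"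
    proof -
      have "E3 = ennreal (LINT X|gibbs \<beta> N. second_moment N X)"
        unfolding E3_def using N second_moment_nonneg
        by (intro nn_integral_eq_integral integrable_gibbs_moment[OF \<beta>]) auto
      also have "\<dots> \<le> ennreal (real N * c)"
        using mean_second_moment(1)[OF \<beta>, of N] N by (intro ennreal_leI) (simp add: c_def)
      also have "\<dots> \<le> ennreal (real N powr A0)"
      proof (rule ennreal_leI)
        have "c \<le> exp c" using exp_ge_add_one_self[of c] by linarith
        also have "exp c \<le> exp (c * ln (real N))"
          using mult_left_mono[OF ln_ge_one[OF N] c] by simp
        also have "\<dots> = real N powr c" using N by (simp add: powr_def)
        finally have "real N * c \<le> real N powr 1 * real N powr c" using N c by (intro mult_mono) auto
        also have "\<dots> = real N powr (1 + c)" by (simp only: powr_add)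
        also have "\<dots> \<le> real N powr A0" using A1 A2 N1 by (intro powr_mono) (auto simp: A0_def)
        finally show "real N * c \<le> real N powr A0" .
      qed
      finally show ?thesis .
    qed
    have "(\<integral>\<^sup>+X. badness \<beta> N X \<partial>gibbs \<beta> N) = E1 + (\<Sum>i<N. E2 i) + E3"
    proof -
      have m1: "(\<lambda>X. \<integral>\<^sup>+x. ennreal (exp (- \<beta> * local_potential N X x)) \<partial>lborel) \<in> borel_measurable (gibbs \<beta> N)"
        using measurable_local_potential_integral[OF \<beta>] by simp
      have m2: "(\<lambda>X. ennreal (exp (\<beta> * reduced_potential N X i) / (1 + (norm (X i))\<^sup>2)\<^sup>2)) \<in> borel_measurable (gibbs \<beta> N)" if "i \<in> {..<N}" for i
        using measurable_reduced_potential[OF \<beta>, of i N] that by simp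
      have m3: "(\<lambda>X. ennreal (second_moment N X)) \<in> borel_measurable (gibbs \<beta> N)" by measurable
      show ?thesis
        unfolding badness_def E1_def E2_def E3_def
        by (subst nn_integral_add[OF borel_measurable_add[OF m1 borel_measurable_sum[OF m2]] m3], assumption)
           (subst nn_integral_add[OF m1 borel_measurable_sum[OF m2]], assumption, subst nn_integral_sum[OF m2], auto)
    qed
    also have "\<dots> \<le> ennreal (real N powr A0) + ennreal (real N powr A0) + ennreal (real N powr A0)"
      by (intro add_mono e1 e2 e3)
    also have "\<dots> = ennreal (3 * real N powr A0)"
      by (simp add: ennreal_plus[symmetric] del: ennreal_plus)
    also have "\<dots> \<le> ennreal (real N powr (A0 + 1))"
      using N by (intro ennreal_leI) (simp add: powr_add mult.commute)
    finally show ?thesis .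
  qed
  have "1 \<le> A0 + 1" using A1 A2 c by (simp add: A0_def)
  then show ?thesis using that bound by blast
qed

theorem proposition3p10:
  fixes \<beta> :: real
  assumes "\<beta> > 0"
  shows "\<exists>lam::real. lam \<ge> 1 \<and>
    (\<forall>k::nat. \<exists>C::real. \<forall>r::real. 0 < r \<and> r < 1 \<longrightarrow>
      (\<forall>\<^sub>F N in sequentially.
        measure (gibbs \<beta> N)
          {X \<in> space (gibbs \<beta> N). sup_fluct (test_functions lam r N) N X \<ge> ereal (C * ln (real N))}
        \<le> real N powr (- real k)))"
proof (rule exI[of _ 1], intro conjI allI)
  obtain A where A: "1 \<le> A" "\<And>N. 3 \<le> N \<Longrightarrow> (\<integral>\<^sup>+X. badness \<beta> N X \<partial>gibbs \<beta> N) \<le> ennreal (real N powr A)"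
    using nn_integral_badness[OF assms] by blast
  fix k :: nat
  \<comment> \<open>Markov's inequality at the level \<open>N powr B\<close> gives the probability
    \<open>N powr (A - B) = N powr (- k)\<close>\<close>
  define B where "B = A + real k"
  have B: "1 \<le> B" using A by (simp add: B_def)
  \<comment> \<open>the additional \<open>1\<close> makes the bound on good configurations strict\<close>
  define C where "C = fluct_constant \<beta> B + 1"
  have "measure (gibbs \<beta> N) {X \<in> space (gibbs \<beta> N). sup_fluct (test_functions 1 r N) N X \<ge> ereal (C * ln (real N))} \<le> real N powr (- real k)"
    if r: "0 < r" "r < 1" and N: "3 \<le> N" for r N
  proof -
    interpret prob_space "gibbs \<beta> N" by (rule prob_space_gibbs[OF assms])
    let ?E = "{X \<in> space (gibbs \<beta> N). sup_fluct (test_functions 1 r N) N X \<ge> ereal (C * ln (real N))}"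
    let ?c = "ennreal (real N powr (- B))"
    let ?M = "{X \<in> space (gibbs \<beta> N). 1 \<le> ?c * badness \<beta> N X}"
    have bm: "badness \<beta> N \<in> borel_measurable (gibbs \<beta> N)" using badness_measurable[OF assms] by simp
    have Mset: "?M \<in> sets (gibbs \<beta> N)" using bm by measurable
    have cN: "?c * ennreal (real N powr B) = 1"
      using N by (simp add: ennreal_mult[symmetric] powr_add[symmetric])
    have "AE X in gibbs \<beta> N. X \<in> ?E \<longrightarrow> X \<in> ?M"
      using AE_gibbs_distinct[where \<beta>=\<beta> and n=N] AE_space
    proof eventually_elim
      case (elim X)
      show ?case
      proof (rule impI, rule ccontr)
        assume E: "X \<in> ?E" and nM: "X \<notin> ?M"
        have "badness \<beta> N X \<le> ennreal (real N powr B)"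
        proof (rule ccontr)
          assume "\<not> badness \<beta> N X \<le> ennreal (real N powr B)"
          then have "?c * ennreal (real N powr B) \<le> ?c * badness \<beta> N X" by (intro mult_left_mono) auto
          then show False using nM elim(2) cN by simp
        qed
        then have good: "good_config \<beta> B N X" by (rule good_config_if_badness[OF elim(1)])
        have "sup_fluct (test_functions 1 r N) N X \<le> ereal (fluct_constant \<beta> B * ln (real N))"
          unfolding sup_fluct_def
          by (intro SUP_least) (simp add: good_fluctuation_bound[OF assms B N good r])
        also have "\<dots> < ereal (C * ln (real N))" using ln_ge_one[OF N] by (simp add: C_def distrib_right)
        finally show False using E leD by blast
      qed
    qed
    then have "emeasure (gibbs \<beta> N) ?E \<le> emeasure (gibbs \<beta> N) ?M"
      by (intro emeasure_mono_AE Mset)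
    also have "\<dots> \<le> ?c * (\<integral>\<^sup>+X. badness \<beta> N X * indicator (space (gibbs \<beta> N)) X \<partial>gibbs \<beta> N)"
      by (rule nn_integral_Markov_inequality[OF _ sets.top]) (use bm in measurable)
    also have "(\<integral>\<^sup>+X. badness \<beta> N X * indicator (space (gibbs \<beta> N)) X \<partial>gibbs \<beta> N) = (\<integral>\<^sup>+X. badness \<beta> N X \<partial>gibbs \<beta> N)"
      by (intro nn_integral_cong) auto
    also have "?c * \<dots> \<le> ?c * ennreal (real N powr A)" by (intro mult_left_mono A(2) N) simp
    also have "\<dots> = ennreal (real N powr (- real k))"
      by (simp add: ennreal_mult[symmetric] powr_add[symmetric] B_def)
    finally show ?thesis by (simp add: emeasure_eq_measure)
  qed
  then have "\<forall>r::real. 0 < r \<and> r < 1 \<longrightarrow> (\<forall>\<^sub>F N in sequentially.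
        measure (gibbs \<beta> N) {X \<in> space (gibbs \<beta> N). sup_fluct (test_functions 1 r N) N X \<ge> ereal (C * ln (real N))} \<le> real N powr (- real k))"
    by (auto simp: eventually_sequentially)
  then show "\<exists>C::real. \<forall>r::real. 0 < r \<and> r < 1 \<longrightarrow> (\<forall>\<^sub>F N in sequentially.
        measure (gibbs \<beta> N) {X \<in> space (gibbs \<beta> N). sup_fluct (test_functions 1 r N) N X \<ge> ereal (C * ln (real N))} \<le> real N powr (- real k))"
    by blast
qed simp

end
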